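(* The functor $P_fP_f\!\int:Lax_{Inj}(\mathcal{L}_{\Sigma}^{op},Poset)\longrightarrow Lax_{Inj}(\mathcal{L}_{\Sigma}^{op},Poset)$ induces a cofree comonad $C(P_fP_f\!\int)$ on $Lax_{Inj}(\mathcal{L}_{\Sigma}^{op},Poset)$. Moreover, given a logic program $P$ qua $P_fP_f\!\int$-coalgebra $p:At\longrightarrow P_fP_f\!\int\!At$, the corresponding $C(P_fP_f\!\int)$-coalgebra $\overline{p}:At\longrightarrow C(P_fP_f\!\int)(At)$ sends an atom $A(x_1,\ldots,x_n)\in At(n)$ to the coinductive tree for $A(x_1,\ldots,x_n)$.
   Context: Let $\Sigma$ be a signature of function symbols and $\mathcal{L}_{\Sigma}$ the Lawvere theory it generates: objects are natural numbers, $\mathcal{L}_{\Sigma}(n,m)$ is the set of $m$-tuples of terms over $\Sigma$ in variables $x_1,\ldots,x_n$, composition is substitution. For a logic program $P$ over $\Sigma$, $At:\mathcal{L}_{\Sigma}^{op}\to Poset$ sends $n$ to the (discrete) set of atomic formulae with variables among $x_1,\ldots,x_n$ built from $\Sigma$ and the predicate symbols of $P$, acting on maps by substitution. $P_f:Poset\to Poset$ sends a poset to its finite subsets with $A\le B$ iff every $a\in A$ is below some $b\in B$, acting on maps by image. Let $Inj$ be the category of natural numbers and injections, with canonical identity-on-objects functor $J:Inj^{op}\to\mathcal{L}_{\Sigma}$. $Lax_{Inj}(\mathcal{L}_{\Sigma}^{op},Poset)$ is the category whose objects are functors $\mathcal{L}_{\Sigma}^{op}\to Poset$ and whose maps are lax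 transformations $\alpha:H\Rightarrow K$ (families of monotone maps $\alpha_n$ with $(Kf)\alpha_m\le\alpha_n(Hf)$ for $f:n\to m$) that are strictly natural with respect to injections, composed pointwise. For $H:\mathcal{L}_{\Sigma}^{op}\to Poset$, $\int\! H(n)$ is the colimit of the composite $n/Inj\xrightarrow{cod}Inj\xrightarrow{J}\mathcal{L}_{\Sigma}^{op}\xrightarrow{H}Poset$ (so it contains $H(m)$ for all $m\ge n$ without double counting along injections); on a map $f:n\to n'$, $\int\! H(f)$ is induced by the maps $H(n'+k)\xrightarrow{H(f+k)}H(n+k)\to\int\! H(n)$, and $\int$ acts on maps of $Lax_{Inj}$ via the colimits; this makes $\int$ an endofunctor of $Lax_{Inj}(\mathcal{L}_{\Sigma}^{op},Poset)$. A logic program $P$ is modelled by $p:At\to P_fP_f\!\int\!At$ where $p_n(A(x_1,\ldots,x_n))$ is the set of sets of atoms in the bodies of the clauses of $P$ whose head matches $A(x_1,\ldots,x_n)$ via a most general matcher (bodies may contain extra, existential variables, which is why $\int$ is needed). The coinductive tree for an atom $A$: root $A$; and-nodes are atoms, or-nodes are $\bullet$; for each and-node $A'$ and each clause $B\gets B_1,\ldots,B_k$ of $P$ with $A'=\theta B$ for the most general matcher $\theta$, $A'$ has an or-node whose children are the distinct atoms among $\theta B_1,\ldots,\theta B_k$.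
   Formalization: Poset is read as preordered sets, since with the stated order P_f of a poset need not be antisymmetric (for a<b, {b} and {a,b} lie below each other); the colimit in ∫ is taken in preorders, and carriers are sets in a universe over an arbitrary base type. *)

theory Defs
  imports "HOL-Library.FSet" "HOL-Library.FuncSet"
begin

section \<open>Categories, adjunctions, comonads and coalgebras\<close>

record ('o, 'm) cat =
  Obj :: "'o set"
  Arr :: "'m set"
  Src :: "'m \<Rightarrow> 'o"
  Tgt :: "'m \<Rightarrow> 'o"
  Ide :: "'o \<Rightarrow> 'm"
  Cmp :: "'m \<Rightarrow> 'm \<Rightarrow> 'm"  \<comment> \<open>\<open>Cmp C g f\<close> is \<open>f\<close> followed by \<open>g\<close>\<close>

definition hom :: "('o, 'm) cat \<Rightarrow> 'o \<Rightarrow> 'o \<Rightarrow> 'm set" where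
  "hom C a b = {f \<in> Arr C. Src C f = a \<and> Tgt C f = b}"

definition category :: "('o, 'm) cat \<Rightarrow> bool" where
  "category C \<longleftrightarrow>
     (\<forall>f\<in>Arr C. Src C f \<in> Obj C \<and> Tgt C f \<in> Obj C) \<and>
     (\<forall>a\<in>Obj C. Ide C a \<in> hom C a a) \<and>
     (\<forall>f\<in>Arr C. \<forall>g\<in>Arr C. Src C g = Tgt C f \<longrightarrow> Cmp C g f \<in> hom C (Src C f) (Tgt C g)) \<and>
     (\<forall>f\<in>Arr C. Cmp C f (Ide C (Src C f)) = f \<and> Cmp C (Ide C (Tgt C f)) f = f) \<and>
     (\<forall>f\<in>Arr C. \<forall>g\<in>Arr C. \<forall>h\<in>Arr C. Src C g = Tgt C f \<longrightarrow> Src C h = Tgt C g \<longrightarrow>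
        Cmp C h (Cmp C g f) = Cmp C (Cmp C h g) f)"

record ('o1, 'm1, 'o2, 'm2) fctr =
  fob :: "'o1 \<Rightarrow> 'o2"
  far :: "'m1 \<Rightarrow> 'm2"

definition is_functor ::
  "('o1, 'm1) cat \<Rightarrow> ('o2, 'm2) cat \<Rightarrow> ('o1, 'm1, 'o2, 'm2) fctr \<Rightarrow> bool" where
  "is_functor C D F \<longleftrightarrow> category C \<and> category D \<and>
     (\<forall>a\<in>Obj C. fob F a \<in> Obj D) \<and>
     (\<forall>f\<in>Arr C. far F f \<in> hom D (fob F (Src C f)) (fob F (Tgt C f))) \<and>
     (\<forall>a\<in>Obj C. far F (Ide C a) = Ide D (fob F a)) \<and>
     (\<forall>f\<in>Arr C. \<forall>g\<in>Arr C. Src C g = Tgt C f \<longrightarrow>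
        far F (Cmp C g f) = Cmp D (far F g) (far F f))"

definition idf :: "('o, 'm, 'o, 'm) fctr" where
  "idf = \<lparr>fob = (\<lambda>a. a), far = (\<lambda>f. f)\<rparr>"

definition fcomp ::
  "('o2, 'm2, 'o3, 'm3) fctr \<Rightarrow> ('o1, 'm1, 'o2, 'm2) fctr \<Rightarrow> ('o1, 'm1, 'o3, 'm3) fctr" where
  "fcomp G F = \<lparr>fob = fob G \<circ> fob F, far = far G \<circ> far F\<rparr>"

definition nat_trans ::
  "('o1, 'm1) cat \<Rightarrow> ('o2, 'm2) cat \<Rightarrow> ('o1, 'm1, 'o2, 'm2) fctr \<Rightarrow>
   ('o1, 'm1, 'o2, 'm2) fctr \<Rightarrow> ('o1 \<Rightarrow> 'm2) \<Rightarrow> bool" where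
  "nat_trans C D F G t \<longleftrightarrow> is_functor C D F \<and> is_functor C D G \<and>
     (\<forall>a\<in>Obj C. t a \<in> hom D (fob F a) (fob G a)) \<and>
     (\<forall>f\<in>Arr C. Cmp D (t (Tgt C f)) (far F f) = Cmp D (far G f) (t (Src C f)))"

definition adjunction ::
  "('o1, 'm1) cat \<Rightarrow> ('o2, 'm2) cat \<Rightarrow> ('o1, 'm1, 'o2, 'm2) fctr \<Rightarrow>
   ('o2, 'm2, 'o1, 'm1) fctr \<Rightarrow> ('o1 \<Rightarrow> 'm1) \<Rightarrow> ('o2 \<Rightarrow> 'm2) \<Rightarrow> bool" where
  "adjunction A C U R \<eta> \<epsilon> \<longleftrightarrow>  \<comment> \<open>\<open>U : A \<rightarrow> C\<close> is left adjoint to \<open>R : C \<rightarrow> A\<close>\<close>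
     is_functor A C U \<and> is_functor C A R \<and>
     nat_trans A A idf (fcomp R U) \<eta> \<and> nat_trans C C (fcomp U R) idf \<epsilon> \<and>
     (\<forall>a\<in>Obj A. Cmp C (\<epsilon> (fob U a)) (far U (\<eta> a)) = Ide C (fob U a)) \<and>
     (\<forall>c\<in>Obj C. Cmp A (far R (\<epsilon> c)) (\<eta> (fob R c)) = Ide A (fob R c))"

definition comonad ::
  "('o, 'm) cat \<Rightarrow> ('o, 'm, 'o, 'm) fctr \<Rightarrow> ('o \<Rightarrow> 'm) \<Rightarrow> ('o \<Rightarrow> 'm) \<Rightarrow> bool" where
  "comonad C G \<epsilon> \<delta> \<longleftrightarrow>
     nat_trans C C G idf \<epsilon> \<and> nat_trans C C G (fcomp G G) \<delta> \<and>
     (\<forall>a\<in>Obj C. Cmp C (\<epsilon> (fob G a)) (\<delta> a) = Ide C (fob G a) \<and>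
                Cmp C (far G (\<epsilon> a)) (\<delta> a) = Ide C (fob G a) \<and>
                Cmp C (\<delta> (fob G a)) (\<delta> a) = Cmp C (far G (\<delta> a)) (\<delta> a))"

type_synonym ('o, 'm) coalg = "'o \<times> 'm"
type_synonym ('o, 'm) coalg_arr = "('o, 'm) coalg \<times> ('o, 'm) coalg \<times> 'm"

definition coalgs_cat ::
  "('o, 'm) cat \<Rightarrow> ('o, 'm, 'o, 'm) fctr \<Rightarrow> ('o, 'm) coalg set \<Rightarrow>
   (('o, 'm) coalg, ('o, 'm) coalg_arr) cat" where
  "coalgs_cat C F K =
     \<lparr>Obj = K,
      Arr = {(a, b, f). a \<in> K \<and> b \<in> K \<and> f \<in> hom C (fst a) (fst b) \<and>
                        Cmp C (snd b) f = Cmp C (far F f) (snd a)},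
      Src = (\<lambda>(a, b, f). a),
      Tgt = (\<lambda>(a, b, f). b),
      Ide = (\<lambda>a. (a, a, Ide C (fst a))),
      Cmp = (\<lambda>(b', c, g) (a, b, f). (a, c, Cmp C g f))\<rparr>"

definition coalg_cat ::
  "('o, 'm) cat \<Rightarrow> ('o, 'm, 'o, 'm) fctr \<Rightarrow> (('o, 'm) coalg, ('o, 'm) coalg_arr) cat" where
  "coalg_cat C F = coalgs_cat C F {(X, x). X \<in> Obj C \<and> x \<in> hom C X (fob F X)}"

definition comonad_coalg_cat ::
  "('o, 'm) cat \<Rightarrow> ('o, 'm, 'o, 'm) fctr \<Rightarrow> ('o \<Rightarrow> 'm) \<Rightarrow> ('o \<Rightarrow> 'm) \<Rightarrow>
   (('o, 'm) coalg, ('o, 'm) coalg_arr) cat" where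
  "comonad_coalg_cat C G \<epsilon> \<delta> = coalgs_cat C G
     {(X, x). X \<in> Obj C \<and> x \<in> hom C X (fob G X) \<and> Cmp C (\<epsilon> X) x = Ide C X \<and>
              Cmp C (\<delta> X) x = Cmp C (far G x) x}"

definition forget :: "(('o, 'm) coalg, ('o, 'm) coalg_arr, 'o, 'm) fctr" where
  "forget = \<lparr>fob = fst, far = (\<lambda>(a, b, f). f)\<rparr>"

text \<open>
  The cofree comonad on an endofunctor \<open>F\<close> is the comonad induced by a right adjoint \<open>R\<close>
  of the forgetful functor from \<open>F\<close>-coalgebras.  The \<open>F\<close>-coalgebra \<open>(X, x)\<close> then corresponds
  to the comonad coalgebra on \<open>X\<close> given by the unit at \<open>(X, x)\<close>.
\<close>

definition cofree_adjunction ::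
  "('o, 'm) cat \<Rightarrow> ('o, 'm, 'o, 'm) fctr \<Rightarrow> ('o, 'm, ('o, 'm) coalg, ('o, 'm) coalg_arr) fctr \<Rightarrow>
   (('o, 'm) coalg \<Rightarrow> ('o, 'm) coalg_arr) \<Rightarrow> ('o \<Rightarrow> 'm) \<Rightarrow> bool" where
  "cofree_adjunction C F R \<eta> \<epsilon> \<longleftrightarrow> adjunction (coalg_cat C F) C forget R \<eta> \<epsilon>"

definition cofree_comonad ::
  "('o, 'm, ('o, 'm) coalg, ('o, 'm) coalg_arr) fctr \<Rightarrow> ('o, 'm, 'o, 'm) fctr" where
  "cofree_comonad R = fcomp forget R"

definition cofree_comult ::
  "('o, 'm, ('o, 'm) coalg, ('o, 'm) coalg_arr) fctr \<Rightarrow>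
   (('o, 'm) coalg \<Rightarrow> ('o, 'm) coalg_arr) \<Rightarrow> 'o \<Rightarrow> 'm" where
  "cofree_comult R \<eta> X = far forget (\<eta> (fob R X))"

definition comparison ::
  "(('o, 'm) coalg \<Rightarrow> ('o, 'm) coalg_arr) \<Rightarrow>
   (('o, 'm) coalg, ('o, 'm) coalg_arr, ('o, 'm) coalg, ('o, 'm) coalg_arr) fctr" where
  "comparison \<eta> =
     \<lparr>fob = (\<lambda>a. (fst a, far forget (\<eta> a))),
      far = (\<lambda>(a, b, f). ((fst a, far forget (\<eta> a)), (fst b, far forget (\<eta> b)), f))\<rparr>"

definition cat_iso ::
  "('o1, 'm1) cat \<Rightarrow> ('o2, 'm2) cat \<Rightarrow> ('o1, 'm1, 'o2, 'm2) fctr \<Rightarrow> bool" where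
  "cat_iso C D F \<longleftrightarrow> is_functor C D F \<and>
     bij_betw (fob F) (Obj C) (Obj D) \<and> bij_betw (far F) (Arr C) (Arr D)"


section \<open>The Lawvere theory of a signature and the category of injections\<close>

text \<open>
  Variables are numbered from 0: \<open>Var i\<close> is $x_{i+1}$.  A signature is a set of
  function symbols paired with their arities.
\<close>

datatype 'f trm = Var nat | Fun 'f "'f trm list"

type_synonym 'f sig = "('f \<times> nat) set"

inductive_set terms :: "'f sig \<Rightarrow> nat \<Rightarrow> 'f trm set" for \<Sigma> n where
  "i < n \<Longrightarrow> Var i \<in> terms \<Sigma> n"
| "(f, length ts) \<in> \<Sigma> \<Longrightarrow> (\<forall>t\<in>set ts. t \<in> terms \<Sigma> n) \<Longrightarrow> Fun f ts \<in> terms \<Sigma> n"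

primrec subst :: "(nat \<Rightarrow> 'f trm) \<Rightarrow> 'f trm \<Rightarrow> 'f trm" where
  "subst s (Var i) = s i"
| "subst s (Fun f ts) = Fun f (map (subst s) ts)"

primrec vars :: "'f trm \<Rightarrow> nat set" where
  "vars (Var i) = {i}"
| "vars (Fun f ts) = \<Union> (set (map vars ts))"

definition law :: "'f sig \<Rightarrow> nat \<Rightarrow> nat \<Rightarrow> 'f trm list set" where
  "law \<Sigma> n m = {f. length f = m \<and> set f \<subseteq> terms \<Sigma> n}"

definition law_id :: "nat \<Rightarrow> 'f trm list" where
  "law_id n = map Var [0..<n]"

definition law_comp :: "'f trm list \<Rightarrow> 'f trm list \<Rightarrow> 'f trm list" where
  "law_comp g f = map (subst ((!) f)) g"

text \<open>\<open>law_plus n k f\<close> is $f + k : n + k \to n' + k$ for $f : n \to n'$.\<close>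

definition law_plus :: "nat \<Rightarrow> nat \<Rightarrow> 'f trm list \<Rightarrow> 'f trm list" where
  "law_plus n k f = f @ map Var [n..<n + k]"

text \<open>An injection \<open>n \<rightarrow> m\<close> is the list of its values; \<open>[0..<n]\<close> is the inclusion.\<close>

definition injs :: "nat \<Rightarrow> nat \<Rightarrow> nat list set" where
  "injs n m = {i. length i = n \<and> distinct i \<and> set i \<subseteq> {..<m}}"

definition inj_comp :: "nat list \<Rightarrow> nat list \<Rightarrow> nat list" where
  "inj_comp j i = map ((!) j) i"

definition J :: "nat list \<Rightarrow> 'f trm list" where
  "J i = map Var i"


section \<open>Lax transformations strict on injections\<close>

text \<open>
  The objects of \<open>Poset\<close> have to be preordered sets: already on finite sets of finite
  subsets of a discrete set the order is not antisymmetric, as $\{\{a\},\{a,b\}\}$ and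
  $\{\{a,b\}\}$ are below each other.
\<close>

record 'u proset =
  pts :: "'u set"
  le :: "('u \<times> 'u) set"

record ('f, 'u) psh =
  ob :: "nat \<Rightarrow> 'u proset"
  act :: "nat \<Rightarrow> 'f trm list \<Rightarrow> 'u \<Rightarrow> 'u"
    \<comment> \<open>\<open>act H n f : H(m) \<rightarrow> H(n)\<close> is \<open>H(f)\<close> for \<open>f \<in> law \<Sigma> n m\<close>; here \<open>m = length f\<close>\<close>

definition monotone_map :: "'u proset \<Rightarrow> 'u proset \<Rightarrow> ('u \<Rightarrow> 'u) \<Rightarrow> bool" where
  "monotone_map X Y g \<longleftrightarrow> g \<in> pts X \<rightarrow>\<^sub>E pts Y \<and> (\<forall>(x, y)\<in>le X. (g x, g y) \<in> le Y)"

definition presheaf :: "'f sig \<Rightarrow> ('f, 'u) psh \<Rightarrow> bool" where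
  "presheaf \<Sigma> H \<longleftrightarrow>
     (\<forall>n. preorder_on (pts (ob H n)) (le (ob H n))) \<and>
     (\<forall>n m. \<forall>f\<in>law \<Sigma> n m. monotone_map (ob H m) (ob H n) (act H n f)) \<and>
     (\<forall>n. \<forall>x\<in>pts (ob H n). act H n (law_id n) x = x) \<and>
     (\<forall>n m k. \<forall>f\<in>law \<Sigma> n m. \<forall>g\<in>law \<Sigma> m k. \<forall>x\<in>pts (ob H k).
        act H n (law_comp g f) x = act H n f (act H m g x)) \<and>
     (\<forall>n f. f \<notin> law \<Sigma> n (length f) \<longrightarrow> act H n f = (\<lambda>_. undefined))"

record ('f, 'u) lax =
  src :: "('f, 'u) psh"
  tgt :: "('f, 'u) psh"
  cmpt :: "nat \<Rightarrow> 'u \<Rightarrow> 'u"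

definition lax_inj :: "'f sig \<Rightarrow> ('f, 'u) lax \<Rightarrow> bool" where
  "lax_inj \<Sigma> \<alpha> \<longleftrightarrow> presheaf \<Sigma> (src \<alpha>) \<and> presheaf \<Sigma> (tgt \<alpha>) \<and>
     (\<forall>n. monotone_map (ob (src \<alpha>) n) (ob (tgt \<alpha>) n) (cmpt \<alpha> n)) \<and>
     (\<forall>n m. \<forall>f\<in>law \<Sigma> n m. \<forall>x\<in>pts (ob (src \<alpha>) m).
        (act (tgt \<alpha>) n f (cmpt \<alpha> m x), cmpt \<alpha> n (act (src \<alpha>) n f x)) \<in> le (ob (tgt \<alpha>) n)) \<and>
     (\<forall>n m. \<forall>i\<in>injs m n. \<forall>x\<in>pts (ob (src \<alpha>) m).
        act (tgt \<alpha>) n (J i) (cmpt \<alpha> m x) = cmpt \<alpha> n (act (src \<alpha>) n (J i) x))"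

definition Lax_Inj :: "'f sig \<Rightarrow> (('f, 'u) psh, ('f, 'u) lax) cat" where
  "Lax_Inj \<Sigma> =
     \<lparr>Obj = {H. presheaf \<Sigma> H},
      Arr = {\<alpha>. lax_inj \<Sigma> \<alpha>},
      Src = src,
      Tgt = tgt,
      Ide = (\<lambda>H. \<lparr>src = H, tgt = H, cmpt = (\<lambda>n. \<lambda>x\<in>pts (ob H n). x)\<rparr>),
      Cmp = (\<lambda>\<beta> \<alpha>. \<lparr>src = src \<alpha>, tgt = tgt \<beta>,
                    cmpt = (\<lambda>n. \<lambda>x\<in>pts (ob (src \<alpha>) n). cmpt \<beta> n (cmpt \<alpha> n x))\<rparr>)\<rparr>"

definition act_on ::
  "'f sig \<Rightarrow> (nat \<Rightarrow> 'u proset) \<Rightarrow> (nat \<Rightarrow> 'f trm list \<Rightarrow> 'u \<Rightarrow> 'u) \<Rightarrow> nat \<Rightarrow> 'f trm list \<Rightarrow> 'u \<Rightarrow> 'u" where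
  "act_on \<Sigma> X \<phi> n f =
     (if f \<in> law \<Sigma> n (length f) then restrict (\<phi> n f) (pts (X (length f))) else (\<lambda>_. undefined))"


section \<open>The endofunctors\<close>

text \<open>
  The underlying sets of the objects of \<open>Poset\<close> are subsets of a universe over an arbitrary type
  of urelements.  \<open>Fin\<close> holds finite subsets and \<open>Cop m i a\<close> is the element \<open>a\<close> of the summand
  at \<open>i : n \<rightarrow> m\<close> of a coproduct over \<open>n/Inj\<close>.  \<open>Seq\<close> occurs in no definition below: it
  closes the universe under countable powers, so that it has room for infinite trees.
\<close>

datatype 'e univ =
  Elem 'e
| Cop nat "nat list" "'e univ"
| Fin "'e univ fset"
| Seq "nat \<Rightarrow> 'e univ"

definition fin :: "'e univ set \<Rightarrow> 'e univ" where
  "fin A = Fin (Abs_fset A)"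

definition Pf :: "'e univ proset \<Rightarrow> 'e univ proset" where
  "Pf X = \<lparr>pts = {Fin A | A. fset A \<subseteq> pts X},
           le = {(Fin A, Fin B) | A B. fset A \<subseteq> pts X \<and> fset B \<subseteq> pts X \<and>
                   (\<forall>a\<in>fset A. \<exists>b\<in>fset B. (a, b) \<in> le X)}\<rparr>"

definition Pf_map :: "('e univ \<Rightarrow> 'e univ) \<Rightarrow> 'e univ \<Rightarrow> 'e univ" where
  "Pf_map g x = (case x of Fin A \<Rightarrow> Fin (g |`| A))"

definition Pf_psh :: "'f sig \<Rightarrow> ('f, 'e univ) psh \<Rightarrow> ('f, 'e univ) psh" where
  "Pf_psh \<Sigma> H = \<lparr>ob = (\<lambda>n. Pf (ob H n)),
                 act = act_on \<Sigma> (\<lambda>n. Pf (ob H n)) (\<lambda>n f. Pf_map (act H n f))\<rparr>"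

definition PfF :: "'f sig \<Rightarrow> (('f, 'e univ) psh, ('f, 'e univ) lax, ('f, 'e univ) psh, ('f, 'e univ) lax) fctr" where
  "PfF \<Sigma> = \<lparr>fob = Pf_psh \<Sigma>,
            far = (\<lambda>\<alpha>. \<lparr>src = Pf_psh \<Sigma> (src \<alpha>), tgt = Pf_psh \<Sigma> (tgt \<alpha>),
                        cmpt = (\<lambda>n. \<lambda>x\<in>pts (Pf (ob (src \<alpha>) n)). Pf_map (cmpt \<alpha> n) x)\<rparr>)\<rparr>"

definition colim_step :: "('f, 'e univ) psh \<Rightarrow> nat \<Rightarrow> ('e univ \<times> 'e univ) set" where
  "colim_step H n =
     {(Cop m i a, Cop m' (inj_comp j i) (act H m' (J j) a)) | m i a m' j.
        i \<in> injs n m \<and> j \<in> injs m m' \<and> a \<in> pts (ob H m)}"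

definition colim_eq :: "('f, 'e univ) psh \<Rightarrow> nat \<Rightarrow> ('e univ \<times> 'e univ) set" where
  "colim_eq H n = (colim_step H n \<union> (colim_step H n)\<inverse>)\<^sup>*"

text \<open>An equivalence class is encoded by a chosen representative; \<open>cls H n\<close> is the quotient map.\<close>

definition cls :: "('f, 'e univ) psh \<Rightarrow> nat \<Rightarrow> 'e univ \<Rightarrow> 'e univ" where
  "cls H n x = (SOME y. (x, y) \<in> colim_eq H n)"

definition Int_ob :: "('f, 'e univ) psh \<Rightarrow> nat \<Rightarrow> 'e univ proset" where
  "Int_ob H n =
     \<lparr>pts = {cls H n (Cop m i a) | m i a. i \<in> injs n m \<and> a \<in> pts (ob H m)},
      le = {(cls H n (Cop m i a), cls H n (Cop m i b)) | m i a b.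
              i \<in> injs n m \<and> (a, b) \<in> le (ob H m)}\<^sup>+\<rparr>"

text \<open>
  The coprojection at the inclusion \<open>n \<le> m\<close>.  Every element of the colimit is of this form.
\<close>

definition incl :: "('f, 'e univ) psh \<Rightarrow> nat \<Rightarrow> nat \<Rightarrow> 'e univ \<Rightarrow> 'e univ" where
  "incl H n m a = cls H n (Cop m [0..<n] a)"

definition Int_act :: "('f, 'e univ) psh \<Rightarrow> nat \<Rightarrow> 'f trm list \<Rightarrow> 'e univ \<Rightarrow> 'e univ" where
  "Int_act H n f c =
     (THE d. \<exists>k. \<exists>a\<in>pts (ob H (length f + k)).
        c = incl H (length f) (length f + k) a \<and>
        d = incl H n (n + k) (act H (n + k) (law_plus n k f) a))"

definition Int_psh :: "'f sig \<Rightarrow> ('f, 'e univ) psh \<Rightarrow> ('f, 'e univ) psh" where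
  "Int_psh \<Sigma> H = \<lparr>ob = Int_ob H, act = act_on \<Sigma> (Int_ob H) (Int_act H)\<rparr>"

definition Int_map :: "('f, 'e univ) lax \<Rightarrow> nat \<Rightarrow> 'e univ \<Rightarrow> 'e univ" where
  "Int_map \<alpha> n c =
     (THE d. \<exists>m. \<exists>i\<in>injs n m. \<exists>a\<in>pts (ob (src \<alpha>) m).
        c = cls (src \<alpha>) n (Cop m i a) \<and> d = cls (tgt \<alpha>) n (Cop m i (cmpt \<alpha> m a)))"

definition IntF :: "'f sig \<Rightarrow> (('f, 'e univ) psh, ('f, 'e univ) lax, ('f, 'e univ) psh, ('f, 'e univ) lax) fctr" where
  "IntF \<Sigma> = \<lparr>fob = Int_psh \<Sigma>,
             far = (\<lambda>\<alpha>. \<lparr>src = Int_psh \<Sigma> (src \<alpha>), tgt = Int_psh \<Sigma> (tgt \<alpha>),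
                         cmpt = (\<lambda>n. restrict (Int_map \<alpha> n) (pts (Int_ob (src \<alpha>) n)))\<rparr>)\<rparr>"

definition PfPfInt :: "'f sig \<Rightarrow> (('f, 'e univ) psh, ('f, 'e univ) lax, ('f, 'e univ) psh, ('f, 'e univ) lax) fctr" where
  "PfPfInt \<Sigma> = fcomp (PfF \<Sigma>) (fcomp (PfF \<Sigma>) (IntF \<Sigma>))"


section \<open>Logic programs\<close>

type_synonym ('p, 'f) atm = "'p \<times> 'f trm list"
type_synonym ('p, 'f) clause = "('p, 'f) atm \<times> ('p, 'f) atm list"  \<comment> \<open>head and body\<close>

definition asubst :: "(nat \<Rightarrow> 'f trm) \<Rightarrow> ('p, 'f) atm \<Rightarrow> ('p, 'f) atm" where
  "asubst s A = (fst A, map (subst s) (snd A))"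

definition clause_atoms :: "('p, 'f) clause \<Rightarrow> ('p, 'f) atm set" where
  "clause_atoms c = insert (fst c) (set (snd c))"

definition clause_vars :: "('p, 'f) clause \<Rightarrow> nat set" where
  "clause_vars c = (\<Union>A\<in>clause_atoms c. \<Union>t\<in>set (snd A). vars t)"

definition preds :: "('p, 'f) clause set \<Rightarrow> ('p \<times> nat) set" where
  "preds P = {(fst A, length (snd A)) | A. \<exists>c\<in>P. A \<in> clause_atoms c}"

definition logic_program :: "'f sig \<Rightarrow> ('p, 'f) clause set \<Rightarrow> bool" where
  "logic_program \<Sigma> P \<longleftrightarrow> finite P \<and>
     (\<forall>c\<in>P. \<forall>A\<in>clause_atoms c. \<forall>t\<in>set (snd A). \<exists>m. t \<in> terms \<Sigma> m)"

definition atoms :: "'f sig \<Rightarrow> ('p, 'f) clause set \<Rightarrow> nat \<Rightarrow> ('p, 'f) atm set" where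
  "atoms \<Sigma> P n = {(p, ts). (p, length ts) \<in> preds P \<and> set ts \<subseteq> terms \<Sigma> n}"

type_synonym ('p, 'f, 'e) luniv = "(('p, 'f) atm + 'e) univ"

definition Atm :: "('p, 'f) atm \<Rightarrow> ('p, 'f, 'e) luniv" where
  "Atm A = Elem (Inl A)"

definition At_ob :: "'f sig \<Rightarrow> ('p, 'f) clause set \<Rightarrow> nat \<Rightarrow> ('p, 'f, 'e) luniv proset" where
  "At_ob \<Sigma> P n = \<lparr>pts = Atm ` atoms \<Sigma> P n, le = Id_on (Atm ` atoms \<Sigma> P n)\<rparr>"

definition At :: "'f sig \<Rightarrow> ('p, 'f) clause set \<Rightarrow> ('f, ('p, 'f, 'e) luniv) psh" where
  "At \<Sigma> P = \<lparr>ob = At_ob \<Sigma> P,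
             act = act_on \<Sigma> (At_ob \<Sigma> P)
                     (\<lambda>n f x. case x of Elem (Inl A) \<Rightarrow> Atm (asubst ((!) f) A))\<rparr>"

text \<open>
  Only the variables of the clause are instantiated; the atom \<open>A\<close> and its context
  $x_1,\dots,x_n$ stay fixed.  A most general matcher therefore sends the existential variables
  of the clause to distinct variables outside that context.
\<close>

definition matcher ::
  "'f sig \<Rightarrow> nat \<Rightarrow> ('p, 'f) clause \<Rightarrow> ('p, 'f) atm \<Rightarrow> (nat \<Rightarrow> 'f trm) \<Rightarrow> bool" where
  "matcher \<Sigma> m c A \<theta> \<longleftrightarrow> asubst \<theta> (fst c) = A \<and> (\<forall>v\<in>clause_vars c. \<theta> v \<in> terms \<Sigma> m)"

definition mgm ::
  "'f sig \<Rightarrow> nat \<Rightarrow> nat \<Rightarrow> ('p, 'f) clause \<Rightarrow> ('p, 'f) atm \<Rightarrow> (nat \<Rightarrow> 'f trm) \<Rightarrow> bool" where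
  "mgm \<Sigma> n m c A \<theta> \<longleftrightarrow> n \<le> m \<and> matcher \<Sigma> m c A \<theta> \<and>
     (\<forall>m' \<sigma>. n \<le> m' \<and> matcher \<Sigma> m' c A \<sigma> \<longrightarrow>
        (\<exists>\<tau>. (\<forall>i<n. \<tau> i = Var i) \<and> (\<forall>i<m. \<tau> i \<in> terms \<Sigma> m') \<and>
             (\<forall>v\<in>clause_vars c. \<sigma> v = subst \<tau> (\<theta> v))))"

definition prog_map :: "'f sig \<Rightarrow> ('p, 'f) clause set \<Rightarrow> ('f, ('p, 'f, 'e) luniv) lax" where
  "prog_map \<Sigma> P =
     \<lparr>src = At \<Sigma> P,
      tgt = fob (PfPfInt \<Sigma>) (At \<Sigma> P),
      cmpt = (\<lambda>n. \<lambda>x\<in>pts (At_ob \<Sigma> P n).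
                fin {fin ((\<lambda>B. incl (At \<Sigma> P) n m (Atm (asubst \<theta> B))) ` set (snd c)) | c m \<theta> A.
                       x = Atm A \<and> c \<in> P \<and> mgm \<Sigma> n m c A \<theta>})\<rparr>"


section \<open>Coinductive trees\<close>

text \<open>
  And-nodes carry an atom together with its context, \<open>A \<in> At(n)\<close>; the context records which
  variables are not fresh.  The or-nodes below an and-node are indexed by the clauses of the
  program, \<open>None\<close> meaning that there is no or-node for that clause.
\<close>

codatatype ('p, 'f) ctree =
  And_node (ctx: nat) (label: "('p, 'f) atm")
    (or_nodes: "('p, 'f) clause \<Rightarrow> ('p, 'f) ctree fset option")

coinductive coinductive_tree ::
  "'f sig \<Rightarrow> ('p, 'f) clause set \<Rightarrow> nat \<Rightarrow> ('p, 'f) atm \<Rightarrow> ('p, 'f) ctree \<Rightarrow> bool"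
  for \<Sigma> :: "'f sig" and P :: "('p, 'f) clause set" where
  "\<lbrakk>ctx t = n; label t = A;
    dom (or_nodes t) = {c \<in> P. \<exists>m \<theta>. mgm \<Sigma> n m c A \<theta>};
    \<forall>c S. or_nodes t c = Some S \<longrightarrow>
      (\<exists>m \<theta>. mgm \<Sigma> n m c A \<theta> \<and> bij_betw label (fset S) (asubst \<theta> ` set (snd c)) \<and>
         (\<forall>s\<in>fset S. ctx s = m \<and> coinductive_tree \<Sigma> P m (label s) s))\<rbrakk>
   \<Longrightarrow> coinductive_tree \<Sigma> P n A t"

text \<open>
  For a coalgebra \<open>r : T \<rightarrow> P\<^sub>fP\<^sub>f\<integral>T\<close> with \<open>e : T \<rightarrow> At\<close>, as carried by the cofree
  coalgebra on \<open>At\<close>, \<open>denotes T e r n x t\<close> says that \<open>x \<in> T(n)\<close> is the element given by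
  the tree \<open>t\<close>: \<open>e\<close> yields the root, and \<open>r\<close> yields the set, over the or-nodes of \<open>t\<close>,
  of the sets of elements given by the subtrees below them, put into \<open>\<integral>T(n)\<close>.
  Since \<open>T\<close> is only determined up to isomorphism, a tree can only be identified with an
  element of \<open>T(n)\<close> in this way.
\<close>

coinductive denotes ::
  "('f, ('p, 'f, 'e) luniv) psh \<Rightarrow> ('f, ('p, 'f, 'e) luniv) lax \<Rightarrow> ('f, ('p, 'f, 'e) luniv) lax \<Rightarrow>
   nat \<Rightarrow> ('p, 'f, 'e) luniv \<Rightarrow> ('p, 'f) ctree \<Rightarrow> bool"
  for T e r where
  "\<lbrakk>x \<in> pts (ob T n); ctx t = n; cmpt e n x = Atm (label t);
    \<forall>S\<in>ran (or_nodes t). \<forall>s\<in>fset S. n \<le> ctx s \<and> denotes T e r (ctx s) (y s) s;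
    cmpt r n x = fin ((\<lambda>S. fin ((\<lambda>s. incl T n (ctx s) (y s)) ` fset S)) ` ran (or_nodes t))\<rbrakk>
   \<Longrightarrow> denotes T e r n x t"

end

theory Submission
  imports Defs
begin

text \<open>
  The carrier of the cofree coalgebra on \<open>X\<close> consists of finitely branching trees with roots in
  \<open>X\<close>, modulo the coarsest bisimilarity that compares children as elements of the colimit
  \<open>\<integral>\<close>; two elements presented over \<open>n + k\<close> and \<open>n + k'\<close> are equal there iff they agree after
  injections into a common \<open>n + K\<close>, since injections amalgamate.  The same relator with the
  order of \<open>X\<close> in place of equality gives a similarity preorder, and the Lawvere theory acts on trees
  strictly.  Unfolding a coalgebra into trees is strictly natural for injections by bisimilarity
  and lax for all maps by similarity, and it is unique because behaviours form a bisimulation;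
  so every object has a cofree coalgebra.  That the forgetful functor is then strictly comonadic
  is general category theory.  For a logic program, a most general matcher is determined up to a
  renaming of the existential variables, which the colimit does not see; hence the unfolding of
  the program is denoted by the coinductive tree, and two elements denoted by one tree are bisimilar.
\<close>

section \<open>Coalgebras and cofree comonads\<close>

text \<open>Two obstacles shape the construction. The carrier of a cofree coalgebra has to consist
  of elements of \<open>'e univ\<close>, so infinite trees and their equivalence classes must be
  coded: a tree becomes the \<open>Seq\<close> of the labels found at all addresses, which needs
  ordered children, and a class becomes the code of a chosen member. Moreover, an element of the
  colimit has no canonical presentation: one child may be presented over different numbers of extra
  variables and with different names for them. Trees therefore carry arbitrary presentations, and
  bisimulations have to be stable under the injections by which presentations are compared. The
  direction of laxness comes from the programs: an instance of an atom may match more clauses than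
  the atom, whereas a renaming of it matches the same ones. The conclusion speaks of every cofree
  adjunction, while the construction gives one. That a tree denotes at most one element is therefore
  carried over to an arbitrary cofree coalgebra by an injective coalgebra map into the constructed
  one.\<close>

lemma hom_Obj: "category C \<Longrightarrow> f \<in> hom C a b \<Longrightarrow> a \<in> Obj C \<and> b \<in> Obj C"
  by (auto simp: category_def hom_def)

lemma Ide_hom: "category C \<Longrightarrow> a \<in> Obj C \<Longrightarrow> Ide C a \<in> hom C a a"
  by (auto simp: category_def)

lemma Cmp_hom: "category C \<Longrightarrow> f \<in> hom C a b \<Longrightarrow> g \<in> hom C b c \<Longrightarrow> Cmp C g f \<in> hom C a c"
  by (auto simp: category_def hom_def)

lemma Cmp_Ide: "category C \<Longrightarrow> f \<in> hom C a b \<Longrightarrow> Cmp C f (Ide C a) = f"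
  and Ide_Cmp: "category C \<Longrightarrow> f \<in> hom C a b \<Longrightarrow> Cmp C (Ide C b) f = f"
  by (auto simp: category_def hom_def)

lemma Cmp_assoc: "category C \<Longrightarrow> f \<in> hom C a b \<Longrightarrow> g \<in> hom C b c \<Longrightarrow> h \<in> hom C c d \<Longrightarrow>
    Cmp C (Cmp C h g) f = Cmp C h (Cmp C g f)"
  by (auto simp: category_def hom_def)

lemma far_hom: "is_functor C D F \<Longrightarrow> f \<in> hom C a b \<Longrightarrow> far F f \<in> hom D (fob F a) (fob F b)"
  by (auto simp: is_functor_def hom_def)

lemma fob_Obj: "is_functor C D F \<Longrightarrow> a \<in> Obj C \<Longrightarrow> fob F a \<in> Obj D"
  by (auto simp: is_functor_def)

lemma far_Ide: "is_functor C D F \<Longrightarrow> a \<in> Obj C \<Longrightarrow> far F (Ide C a) = Ide D (fob F a)"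
  by (auto simp: is_functor_def)

lemma far_Cmp: "is_functor C D F \<Longrightarrow> f \<in> hom C a b \<Longrightarrow> g \<in> hom C b c \<Longrightarrow>
    far F (Cmp C g f) = Cmp D (far F g) (far F f)"
  by (auto simp: is_functor_def hom_def)

lemma functor_cat: "is_functor C D F \<Longrightarrow> category C" "is_functor C D F \<Longrightarrow> category D"
  by (auto simp: is_functor_def)

lemma functorI:
  assumes "category C" "category D"
    "\<And>a. a \<in> Obj C \<Longrightarrow> fob F a \<in> Obj D"
    "\<And>f a b. f \<in> hom C a b \<Longrightarrow> far F f \<in> hom D (fob F a) (fob F b)"
    "\<And>a. a \<in> Obj C \<Longrightarrow> far F (Ide C a) = Ide D (fob F a)"
    "\<And>f g a b c. f \<in> hom C a b \<Longrightarrow> g \<in> hom C b c \<Longrightarrow> far F (Cmp C g f) = Cmp D (far F g) (far F f)"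
  shows "is_functor C D F"
  unfolding is_functor_def using assms by (auto simp: hom_def)

lemma nat_transI:
  assumes "is_functor C D F" "is_functor C D G"
    "\<And>a. a \<in> Obj C \<Longrightarrow> t a \<in> hom D (fob F a) (fob G a)"
    "\<And>f a b. f \<in> hom C a b \<Longrightarrow> Cmp D (t b) (far F f) = Cmp D (far G f) (t a)"
  shows "nat_trans C D F G t"
  unfolding nat_trans_def using assms by (auto simp: hom_def)

lemma nat_trans_hom: "nat_trans C D F G t \<Longrightarrow> a \<in> Obj C \<Longrightarrow> t a \<in> hom D (fob F a) (fob G a)"
  by (auto simp: nat_trans_def)

lemma nat_trans_nat: "nat_trans C D F G t \<Longrightarrow> f \<in> hom C a b \<Longrightarrow>
    Cmp D (t b) (far F f) = Cmp D (far G f) (t a)"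
  by (auto simp: nat_trans_def hom_def)

lemma functor_idf: "category C \<Longrightarrow> is_functor C C idf"
  by (auto simp: is_functor_def idf_def category_def hom_def)

lemma functor_fcomp: "is_functor C D F \<Longrightarrow> is_functor D E G \<Longrightarrow> is_functor C E (fcomp G F)"
  unfolding is_functor_def fcomp_def hom_def by auto

lemma fcomp_simps [simp]: "fob (fcomp G F) a = fob G (fob F a)" "far (fcomp G F) f = far G (far F f)"
  "fob idf a = a" "far idf f = f"
  by (auto simp: fcomp_def idf_def)

lemma forget_simps [simp]: "fob forget a = fst a" "far forget (a, b, f) = f"
  by (auto simp: forget_def)

section \<open>Coalgebras of an endofunctor, and cofree coalgebras over single objects\<close>

locale endo =
  fixes C :: "('o, 'm) cat" and F :: "('o, 'm, 'o, 'm) fctr"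
  assumes F: "is_functor C C F"
begin

lemma C: "category C" using F functor_cat by blast

lemma coalgs_cat_category:
  assumes "\<And>X x. (X, x) \<in> K \<Longrightarrow> X \<in> Obj C \<and> x \<in> hom C X (fob F X)"
  shows "category (coalgs_cat C F K)"
proof -
  have K1: "fst a \<in> Obj C" "snd a \<in> hom C (fst a) (fob F (fst a))" if "a \<in> K" for a
    using assms[of "fst a" "snd a"] that by auto
  have id: "Cmp C (snd a) (Ide C (fst a)) = Cmp C (far F (Ide C (fst a))) (snd a)" if "a \<in> K" for a
    using K1[OF that] by (simp add: far_Ide[OF F] Cmp_Ide[OF C] Ide_Cmp[OF C])
  have comp: "Cmp C (snd c) (Cmp C g f) = Cmp C (far F (Cmp C g f)) (snd a)"
    if "a \<in> K" "b \<in> K" "c \<in> K" "f \<in> hom C (fst a) (fst b)" "g \<in> hom C (fst b) (fst c)"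
      "Cmp C (snd b) f = Cmp C (far F f) (snd a)" "Cmp C (snd c) g = Cmp C (far F g) (snd b)" for a b c f g
  proof -
    note h = K1(2)[OF that(1)] K1(2)[OF that(2)] K1(2)[OF that(3)] far_hom[OF F that(4)] far_hom[OF F that(5)]
    have "Cmp C (snd c) (Cmp C g f) = Cmp C (Cmp C (far F g) (snd b)) f"
      using Cmp_assoc[OF C that(4,5) h(3)] that(7) by simp
    also have "\<dots> = Cmp C (far F g) (Cmp C (far F f) (snd a))"
      using Cmp_assoc[OF C that(4) h(2) h(5)] that(6) by simp
    also have "\<dots> = Cmp C (far F (Cmp C g f)) (snd a)"
      using Cmp_assoc[OF C h(1) h(4) h(5)] far_Cmp[OF F that(4,5)] by simp
    finally show ?thesis .
  qed
  note comp' = comp[of "(a, x)" "(b, y)" "(c, z)" for a x b y c z, simplified]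
  show ?thesis
    unfolding category_def coalgs_cat_def
    using K1 by (auto simp: hom_def[of "\<lparr>Obj = K, Arr = _, Src = _, Tgt = _, Ide = _, Cmp = _\<rparr>"]
        Ide_hom[OF C] id comp' Cmp_hom[OF C] Cmp_Ide[OF C] Ide_Cmp[OF C] Cmp_assoc[OF C])
qed

lemma coalg_category: "category (coalg_cat C F)"
  unfolding coalg_cat_def by (rule coalgs_cat_category) auto

lemma coalg_Obj: "(X, x) \<in> Obj (coalg_cat C F) \<longleftrightarrow> X \<in> Obj C \<and> x \<in> hom C X (fob F X)"
  by (auto simp: coalg_cat_def coalgs_cat_def)

text \<open>An arrow of \<open>coalg_cat\<close> is a triple that records its endpoints;
  \<open>chom\<close> isolates the third component, so that the equations below can be stated in
  \<open>C\<close> itself.\<close>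

definition chom :: "'o \<times> 'm \<Rightarrow> 'o \<times> 'm \<Rightarrow> 'm \<Rightarrow> bool" where
  "chom a b f \<longleftrightarrow> a \<in> Obj (coalg_cat C F) \<and> b \<in> Obj (coalg_cat C F) \<and> f \<in> hom C (fst a) (fst b) \<and>
     Cmp C (snd b) f = Cmp C (far F f) (snd a)"

lemma coalg_hom: "h \<in> hom (coalg_cat C F) a b \<longleftrightarrow> (\<exists>f. h = (a, b, f) \<and> chom a b f)"
  by (auto simp: coalg_cat_def coalgs_cat_def hom_def chom_def)

lemma coalg_simps [simp]: "Ide (coalg_cat C F) a = (a, a, Ide C (fst a))"
   "Cmp (coalg_cat C F) (b', c, g) (a, b, f) = (a, c, Cmp C g f)"
   "Src (coalg_cat C F) (a, b, f) = a" "Tgt (coalg_cat C F) (a, b, f) = b"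
  by (auto simp: coalg_cat_def coalgs_cat_def)

lemma chom_Ide: "a \<in> Obj (coalg_cat C F) \<Longrightarrow> chom a a (Ide C (fst a))"
  using Ide_hom[OF coalg_category] by (fastforce simp: coalg_hom)

lemma chom_Cmp: "chom a b f \<Longrightarrow> chom b c g \<Longrightarrow> chom a c (Cmp C g f)"
  using Cmp_hom[OF coalg_category, of "(a, b, f)" a b "(b, c, g)" c] by (simp add: coalg_hom)

lemma chomD: "chom a b f \<Longrightarrow> f \<in> hom C (fst a) (fst b)" by (simp add: chom_def)

lemma forget_functor: "is_functor (coalg_cat C F) C forget"
proof (rule functorI[OF coalg_category C])
  fix a assume "a \<in> Obj (coalg_cat C F)"
  then show "fob forget a \<in> Obj C" by (cases a) (simp add: coalg_Obj)
qed (auto simp: coalg_hom chom_def)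

text \<open>A right adjoint of the forgetful functor amounts to terminal coalgebras over each object.\<close>

definition cofree_on :: "'o \<Rightarrow> 'o \<times> 'm \<Rightarrow> 'm \<Rightarrow> bool" where
  "cofree_on X t e \<longleftrightarrow> t \<in> Obj (coalg_cat C F) \<and> e \<in> hom C (fst t) X \<and>
     (\<forall>a\<in>Obj (coalg_cat C F). \<forall>g\<in>hom C (fst a) X. \<exists>!h. chom a t h \<and> Cmp C e h = g)"

text \<open>Source of the functoriality of the right adjoint, the naturality of the unit and the
  second triangle identity: each equates two coalgebra maps into a cofree coalgebra, and it suffices
  to compare them after the counit.\<close>

lemma cofree_on_uniq:
  "cofree_on X t e \<Longrightarrow> chom a t h \<Longrightarrow> chom a t h' \<Longrightarrow> Cmp C e h = Cmp C e h' \<Longrightarrow> h = h'"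
  unfolding cofree_on_def chom_def by (metis (no_types, lifting) C Cmp_hom)

lemma cofree_on_ex:
  assumes "\<And>X. X \<in> Obj C \<Longrightarrow> \<exists>t e. cofree_on X t e"
  shows "\<exists>R \<eta> \<epsilon>. cofree_adjunction C F R \<eta> \<epsilon>"
proof -
  obtain T E where TE: "\<And>X. X \<in> Obj C \<Longrightarrow> cofree_on X (T X) (E X)" using assms by metis
  have T: "T X \<in> Obj (coalg_cat C F)" and E: "E X \<in> hom C (fst (T X)) X" if "X \<in> Obj C" for X
    using TE[OF that] by (auto simp: cofree_on_def)
  \<comment> \<open>\<open>tr a X g\<close> is the transpose of \<open>g\<close>. The action on
    arrows is then the transpose of \<open>f\<close> after the counit, and the unit is the transpose
    of an identity.\<close>
  define tr where "tr a X g = (THE h. chom a (T X) h \<and> Cmp C (E X) h = g)" for a X g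
  have tr: "chom a (T X) (tr a X g) \<and> Cmp C (E X) (tr a X g) = g"
    if "a \<in> Obj (coalg_cat C F)" "X \<in> Obj C" "g \<in> hom C (fst a) X" for a X g
  proof -
    have "\<exists>!h. chom a (T X) h \<and> Cmp C (E X) h = g" using TE[OF that(2)] that by (simp add: cofree_on_def)
    then show ?thesis unfolding tr_def by (rule theI')
  qed
  define Rf where "Rf f = tr (T (Src C f)) (Tgt C f) (Cmp C f (E (Src C f)))" for f
  define R where "R = \<lparr>fob = T, far = (\<lambda>f. (T (Src C f), T (Tgt C f), Rf f))\<rparr>"
  define \<eta> where "\<eta> a = (a, T (fst a), tr a (fst a) (Ide C (fst a)))" for a
  have Rf: "chom (T a) (T b) (Rf f) \<and> Cmp C (E b) (Rf f) = Cmp C f (E a)" if "f \<in> hom C a b" for f a b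
    using tr[of "T a" b "Cmp C f (E a)"] that hom_Obj[OF C that] T E Cmp_hom[OF C]
    by (auto simp: Rf_def hom_def)
  have Rfar: "far R f = (T a, T b, Rf f)" if "f \<in> hom C a b" for f a b
    using that by (simp add: R_def hom_def)
  have Rfun: "is_functor C (coalg_cat C F) R"
  proof (rule functorI[OF C coalg_category])
    fix a assume a: "a \<in> Obj C"
    then show "fob R a \<in> Obj (coalg_cat C F)" by (simp add: R_def T)
    have "Rf (Ide C a) = Ide C (fst (T a))"
      using Rf[OF Ide_hom[OF C a]] chom_Ide[OF T[OF a]] Cmp_Ide[OF C E[OF a]] Ide_Cmp[OF C E[OF a]]
      by - (rule cofree_on_uniq[OF TE[OF a], of "T a"], simp_all)
    then show "far R (Ide C a) = Ide (coalg_cat C F) (fob R a)"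
      using Rfar[OF Ide_hom[OF C a]] by (simp add: R_def)
  next
    fix f a b assume f: "f \<in> hom C a b"
    then show "far R f \<in> hom (coalg_cat C F) (fob R a) (fob R b)"
      using Rf[OF f] by (simp add: Rfar coalg_hom) (simp add: R_def)
    fix g c assume g: "g \<in> hom C b c"
    have o: "a \<in> Obj C" "b \<in> Obj C" "c \<in> Obj C" using hom_Obj[OF C] f g by auto
    have gf: "Cmp C g f \<in> hom C a c" using Cmp_hom[OF C f g] .
    have "Cmp C (E c) (Cmp C (Rf g) (Rf f)) = Cmp C (Cmp C (E c) (Rf g)) (Rf f)"
      using Cmp_assoc[OF C chomD[OF Rf[OF f, THEN conjunct1]] chomD[OF Rf[OF g, THEN conjunct1]] E[OF o(3)]] by simp
    also have "\<dots> = Cmp C g (Cmp C (E b) (Rf f))"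
      using Rf[OF g] Cmp_assoc[OF C chomD[OF Rf[OF f, THEN conjunct1]] E[OF o(2)] g] by simp
    also have "\<dots> = Cmp C (E c) (Rf (Cmp C g f))"
      using Rf[OF f] Rf[OF gf] Cmp_assoc[OF C E[OF o(1)] f g] by simp
    finally have "Rf (Cmp C g f) = Cmp C (Rf g) (Rf f)"
      using Rf[OF gf] chom_Cmp[OF Rf[OF f, THEN conjunct1] Rf[OF g, THEN conjunct1]] by - (rule cofree_on_uniq[OF TE[OF o(3)], of "T a"], auto)
    then show "far R (Cmp C g f) = Cmp (coalg_cat C F) (far R g) (far R f)"
      using Rfar[OF f] Rfar[OF g] Rfar[OF gf] by simp
  qed
  have \<eta>': "chom a (T (fst a)) (far forget (\<eta> a)) \<and> Cmp C (E (fst a)) (far forget (\<eta> a)) = Ide C (fst a)"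
    if "a \<in> Obj (coalg_cat C F)" for a
    using tr[OF that, of "fst a" "Ide C (fst a)"] that Ide_hom[OF C] by (cases a) (auto simp: \<eta>_def coalg_Obj)
  have "nat_trans C C (fcomp forget R) idf E"
  proof (rule nat_transI)
    show "is_functor C C (fcomp forget R)" using functor_fcomp[OF Rfun forget_functor] .
    show "is_functor C C idf" using functor_idf[OF C] .
  next
    fix f a b assume f: "f \<in> hom C a b"
    then show "Cmp C (E b) (far (fcomp forget R) f) = Cmp C (far idf f) (E a)"
      using Rf[OF f] by (simp add: Rfar)
  qed (simp add: R_def E)
  moreover have "nat_trans (coalg_cat C F) (coalg_cat C F) idf (fcomp R forget) \<eta>"
  proof (rule nat_transI)
    show "is_functor (coalg_cat C F) (coalg_cat C F) (fcomp R forget)"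
      using functor_fcomp[OF forget_functor Rfun] .
    show "is_functor (coalg_cat C F) (coalg_cat C F) idf" using functor_idf[OF coalg_category] .
  next
    fix a assume a: "a \<in> Obj (coalg_cat C F)"
    show "\<eta> a \<in> hom (coalg_cat C F) (fob idf a) (fob (fcomp R forget) a)"
      using \<eta>'[OF a] by (auto simp: coalg_hom) (auto simp: \<eta>_def R_def)
  next
    fix h a b assume "h \<in> hom (coalg_cat C F) a b"
    then obtain f where h: "h = (a, b, f)" "chom a b f" by (auto simp: coalg_hom)
    then have a: "a \<in> Obj (coalg_cat C F)" and b: "b \<in> Obj (coalg_cat C F)" and f: "f \<in> hom C (fst a) (fst b)"
      by (auto simp: chom_def)
    have o: "fst a \<in> Obj C" "fst b \<in> Obj C" using hom_Obj[OF C f] by auto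
    note \<eta>a = \<eta>'[OF a] and \<eta>b = \<eta>'[OF b]
    \<comment> \<open>Both sides of the naturality square reduce to \<open>f\<close> after the
      counit, so uniqueness makes them equal.\<close>
    have "Cmp C (E (fst b)) (Cmp C (far forget (\<eta> b)) f) = f"
      using Cmp_assoc[OF C f chomD[OF \<eta>b[THEN conjunct1]] E[OF o(2)]] \<eta>b Ide_Cmp[OF C f] by simp
    moreover have "Cmp C (E (fst b)) (Cmp C (Rf f) (far forget (\<eta> a))) = f"
    proof -
      have "Cmp C (E (fst b)) (Cmp C (Rf f) (far forget (\<eta> a))) = Cmp C (Cmp C (E (fst b)) (Rf f)) (far forget (\<eta> a))"
        using Cmp_assoc[OF C chomD[OF \<eta>a[THEN conjunct1]] chomD[OF Rf[OF f, THEN conjunct1]] E[OF o(2)]] by simp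
      also have "\<dots> = Cmp C f (Cmp C (E (fst a)) (far forget (\<eta> a)))"
        using Cmp_assoc[OF C chomD[OF \<eta>a[THEN conjunct1]] E[OF o(1)] f] Rf[OF f] by simp
      finally show ?thesis using \<eta>a Cmp_Ide[OF C f] by simp
    qed
    ultimately have "Cmp C (far forget (\<eta> b)) f = Cmp C (Rf f) (far forget (\<eta> a))"
      using chom_Cmp[OF h(2) \<eta>b[THEN conjunct1]] chom_Cmp[OF \<eta>a[THEN conjunct1] Rf[OF f, THEN conjunct1]] by - (rule cofree_on_uniq[OF TE[OF o(2)], of a], auto)
    then show "Cmp (coalg_cat C F) (\<eta> b) (far idf h) = Cmp (coalg_cat C F) (far (fcomp R forget) h) (\<eta> a)"
      by (simp add: h Rfar[OF f]) (simp add: \<eta>_def)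
  qed
  moreover have "Cmp (coalg_cat C F) (far R (E c)) (\<eta> (fob R c)) = Ide (coalg_cat C F) (fob R c)"
    if c: "c \<in> Obj C" for c
  proof -
    note E' = E[OF c] and t = T[OF c]
    note \<eta>t = \<eta>'[OF t] and R' = Rf[OF E']
    have o: "fst (T c) \<in> Obj C" using hom_Obj[OF C E'] by simp
    have "Cmp C (E c) (Cmp C (Rf (E c)) (far forget (\<eta> (T c)))) = Cmp C (Cmp C (E c) (Rf (E c))) (far forget (\<eta> (T c)))"
      using Cmp_assoc[OF C chomD[OF \<eta>t[THEN conjunct1]] chomD[OF R'[THEN conjunct1]] E'] by simp
    also have "\<dots> = Cmp C (E c) (Cmp C (E (fst (T c))) (far forget (\<eta> (T c))))"
      using Cmp_assoc[OF C chomD[OF \<eta>t[THEN conjunct1]] E[OF o] E'] R' by simp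
    also have "\<dots> = Cmp C (E c) (Ide C (fst (T c)))" using \<eta>t by simp
    finally have "Cmp C (Rf (E c)) (far forget (\<eta> (T c))) = Ide C (fst (T c))"
      using chom_Cmp[OF \<eta>t[THEN conjunct1] R'[THEN conjunct1]] chom_Ide[OF t] by - (rule cofree_on_uniq[OF TE[OF c], of "T c"], auto)
    then show ?thesis by (simp add: Rfar[OF E']) (simp add: \<eta>_def R_def)
  qed
  moreover have "Cmp C (E (fob forget a)) (far forget (\<eta> a)) = Ide C (fob forget a)"
    if "a \<in> Obj (coalg_cat C F)" for a using \<eta>'[OF that] by simp
  ultimately have "cofree_adjunction C F R \<eta> E"
    unfolding cofree_adjunction_def adjunction_def using Rfun forget_functor by blast
  then show ?thesis by blast
qed

end

section \<open>Strict comonadicity of an arbitrary cofree adjunction\<close>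

locale cofree_adj = endo C F for C :: "('o, 'm) cat" and F +
  fixes R \<eta> \<epsilon>
  assumes adj: "cofree_adjunction C F R \<eta> \<epsilon>"
begin

lemma R: "is_functor C (coalg_cat C F) R"
  and nat_\<eta>: "nat_trans (coalg_cat C F) (coalg_cat C F) idf (fcomp R forget) \<eta>"
  and nat_\<epsilon>: "nat_trans C C (fcomp forget R) idf \<epsilon>"
  and tri1: "a \<in> Obj (coalg_cat C F) \<Longrightarrow> Cmp C (\<epsilon> (fst a)) (far forget (\<eta> a)) = Ide C (fst a)"
  and tri2: "c \<in> Obj C \<Longrightarrow> Cmp (coalg_cat C F) (far R (\<epsilon> c)) (\<eta> (fob R c)) = Ide (coalg_cat C F) (fob R c)"
  using adj unfolding cofree_adjunction_def adjunction_def by auto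

abbreviation "G \<equiv> cofree_comonad R"
abbreviation "\<delta> \<equiv> cofree_comult R \<eta>"

abbreviation "un a \<equiv> far forget (\<eta> a)"

lemma G_fob: "fob G X = fst (fob R X)" by (simp add: cofree_comonad_def)

lemma G: "is_functor C C G"
  unfolding cofree_comonad_def by (rule functor_fcomp[OF R forget_functor])

lemma R_Obj: "X \<in> Obj C \<Longrightarrow> fob R X \<in> Obj (coalg_cat C F)"
  using fob_Obj[OF R] .

lemma un: "a \<in> Obj (coalg_cat C F) \<Longrightarrow> chom a (fob R (fst a)) (un a)"
  using nat_trans_hom[OF nat_\<eta>] by (fastforce simp: coalg_hom)

lemma \<eta>_eq: "a \<in> Obj (coalg_cat C F) \<Longrightarrow> \<eta> a = (a, fob R (fst a), un a)"
  using nat_trans_hom[OF nat_\<eta>] by (fastforce simp: coalg_hom)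

lemma R_hom: "f \<in> hom C a b \<Longrightarrow> chom (fob R a) (fob R b) (far G f) \<and> far R f = (fob R a, fob R b, far G f)"
  using far_hom[OF R] by (fastforce simp: coalg_hom cofree_comonad_def)

lemma \<epsilon>_hom: "X \<in> Obj C \<Longrightarrow> \<epsilon> X \<in> hom C (fst (fob R X)) X"
  using nat_trans_hom[OF nat_\<epsilon>] by simp

lemma \<epsilon>_nat: "f \<in> hom C a b \<Longrightarrow> Cmp C (\<epsilon> b) (far G f) = Cmp C f (\<epsilon> a)"
  using nat_trans_nat[OF nat_\<epsilon>] by (simp add: cofree_comonad_def)

lemma un_nat: "chom a b f \<Longrightarrow> Cmp C (un b) f = Cmp C (far G f) (un a)"
proof -
  assume f: "chom a b f"
  then have o: "a \<in> Obj (coalg_cat C F)" "b \<in> Obj (coalg_cat C F)" by (auto simp: chom_def)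
  obtain u v where uv: "\<eta> a = (a, fob R (fst a), u)" "\<eta> b = (b, fob R (fst b), v)"
    using \<eta>_eq[OF o(1)] \<eta>_eq[OF o(2)] by blast
  have "Cmp (coalg_cat C F) (\<eta> b) (a, b, f) = Cmp (coalg_cat C F) (far R f) (\<eta> a)"
    using nat_trans_nat[OF nat_\<eta>, of "(a, b, f)" a b] f by (simp add: coalg_hom)
  then show ?thesis using R_hom[OF chomD[OF f]] by (simp add: uv)
qed

lemma tri2': "c \<in> Obj C \<Longrightarrow> Cmp C (far G (\<epsilon> c)) (un (fob R c)) = Ide C (fst (fob R c))"
proof -
  assume c: "c \<in> Obj C"
  obtain u where "\<eta> (fob R c) = (fob R c, fob R (fst (fob R c)), u)"
    using \<eta>_eq[OF R_Obj[OF c]] by blast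
  then show ?thesis using tri2[OF c] R_hom[OF \<epsilon>_hom[OF c]] by simp
qed

text \<open>Naturality of the unit followed by the second triangle identity: transposing the
  composite with the counit gives back the map itself.\<close>

lemma un_uniq:
  assumes h: "chom a (fob R X) h" and X: "X \<in> Obj C"
  shows "h = Cmp C (far G (Cmp C (\<epsilon> X) h)) (un a)"
proof -
  have a: "a \<in> Obj (coalg_cat C F)" using h by (simp add: chom_def)
  have h': "far G h \<in> hom C (fst (fob R (fst a))) (fst (fob R (fst (fob R X))))" using R_hom[OF chomD[OF h]] chomD by blast
  have e: "far G (\<epsilon> X) \<in> hom C (fst (fob R (fst (fob R X)))) (fst (fob R X))" using R_hom[OF \<epsilon>_hom[OF X]] chomD by blast
  have "Cmp C (far G (Cmp C (\<epsilon> X) h)) (un a) = Cmp C (Cmp C (far G (\<epsilon> X)) (far G h)) (un a)"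
    using far_Cmp[OF G chomD[OF h] \<epsilon>_hom[OF X]] by simp
  also have "\<dots> = Cmp C (far G (\<epsilon> X)) (Cmp C (un (fob R X)) h)"
    using Cmp_assoc[OF C chomD[OF un[OF a]] h' e] un_nat[OF h] by simp
  also have "\<dots> = h"
    using Cmp_assoc[OF C chomD[OF h] chomD[OF un[OF R_Obj[OF X]]] e] tri2'[OF X] Ide_Cmp[OF C chomD[OF h]] by simp
  finally show ?thesis by simp
qed

text \<open>Converse of \<open>cofree_on_ex\<close>. It allows the value of an arbitrary given right
  adjoint to be compared with a cofree coalgebra constructed by hand.\<close>

lemma cofree_on: "X \<in> Obj C \<Longrightarrow> cofree_on X (fob R X) (\<epsilon> X)"
  unfolding cofree_on_def
proof (intro conjI ballI)
  fix a g assume X: "X \<in> Obj C" and a: "a \<in> Obj (coalg_cat C F)" and g: "g \<in> hom C (fst a) X"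
  have o: "fst a \<in> Obj C" using hom_Obj[OF C g] by simp
  have "chom a (fob R X) (Cmp C (far G g) (un a))" using un[OF a] R_hom[OF g] chom_Cmp by blast
  moreover have "Cmp C (\<epsilon> X) (Cmp C (far G g) (un a)) = g"
    using Cmp_assoc[OF C chomD[OF un[OF a]] chomD[OF R_hom[OF g, THEN conjunct1]] \<epsilon>_hom[OF X]]
      \<epsilon>_nat[OF g] Cmp_assoc[OF C chomD[OF un[OF a]] \<epsilon>_hom[OF o] g] tri1[OF a] Cmp_Ide[OF C g] by simp
  moreover have "h = Cmp C (far G g) (un a)" if "chom a (fob R X) h \<and> Cmp C (\<epsilon> X) h = g" for h
    using un_uniq[of a X h] X that by auto
  ultimately show "\<exists>!h. chom a (fob R X) h \<and> Cmp C (\<epsilon> X) h = g"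
    by (rule ex1I[of _ "Cmp C (far G g) (un a)", OF conjI])
qed (auto simp: R_Obj \<epsilon>_hom)

lemma \<delta>: "X \<in> Obj C \<Longrightarrow> chom (fob R X) (fob R (fob G X)) (\<delta> X)"
  using un[OF R_Obj] by (simp add: cofree_comult_def G_fob)

lemma comonad: "comonad C G \<epsilon> \<delta>"
  unfolding comonad_def
proof (intro conjI ballI)
  show "nat_trans C C G idf \<epsilon>" using nat_\<epsilon> by (simp add: cofree_comonad_def)
  show "nat_trans C C G (fcomp G G) \<delta>"
  proof (rule nat_transI[OF G functor_fcomp[OF G G]])
    fix a assume "a \<in> Obj C" then show "\<delta> a \<in> hom C (fob G a) (fob (fcomp G G) a)"
      using chomD[OF \<delta>] by (simp add: G_fob)
  next
    fix f a b assume f: "f \<in> hom C a b"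
    show "Cmp C (\<delta> b) (far G f) = Cmp C (far (fcomp G G) f) (\<delta> a)"
      using un_nat[OF R_hom[OF f, THEN conjunct1]] by (simp add: cofree_comult_def)
  qed
  fix X assume X: "X \<in> Obj C"
  show "Cmp C (\<epsilon> (fob G X)) (\<delta> X) = Ide C (fob G X)"
    using tri1[OF R_Obj[OF X]] by (simp add: cofree_comult_def G_fob)
  show "Cmp C (far G (\<epsilon> X)) (\<delta> X) = Ide C (fob G X)"
    using tri2'[OF X] by (simp add: cofree_comult_def G_fob)
  \<comment> \<open>\<open>\<delta> X\<close> is itself a coalgebra map, and naturality of the unit
    at it is coassociativity.\<close>
  show "Cmp C (\<delta> (fob G X)) (\<delta> X) = Cmp C (far G (\<delta> X)) (\<delta> X)"
    using un_nat[OF \<delta>[OF X]] by (simp add: cofree_comult_def)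
qed

abbreviation "EM \<equiv> comonad_coalg_cat C G \<epsilon> \<delta>"

lemma EM_category: "category EM"
proof -
  interpret G: endo C G by unfold_locales (rule G)
  show ?thesis unfolding comonad_coalg_cat_def by (rule G.coalgs_cat_category) auto
qed

lemma EM_Obj: "(X, x) \<in> Obj EM \<longleftrightarrow> X \<in> Obj C \<and> x \<in> hom C X (fob G X) \<and> Cmp C (\<epsilon> X) x = Ide C X \<and>
              Cmp C (\<delta> X) x = Cmp C (far G x) x"
  by (auto simp: comonad_coalg_cat_def coalgs_cat_def)

lemma EM_hom: "h \<in> hom EM a b \<longleftrightarrow> (\<exists>f. h = (a, b, f) \<and> a \<in> Obj EM \<and> b \<in> Obj EM \<and> f \<in> hom C (fst a) (fst b) \<and>
    Cmp C (snd b) f = Cmp C (far G f) (snd a))"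
  by (auto simp: comonad_coalg_cat_def coalgs_cat_def hom_def)

lemma EM_Arr: "h \<in> Arr EM \<longleftrightarrow> (\<exists>a b. h \<in> hom EM a b)"
  by (auto simp: hom_def)

lemma comp_simps [simp]: "fob (comparison \<eta>) a = (fst a, un a)"
  "far (comparison \<eta>) (a, b, f) = ((fst a, un a), (fst b, un b), f)"
  by (auto simp: comparison_def)

lemma comp_Obj: "a \<in> Obj (coalg_cat C F) \<Longrightarrow> (fst a, un a) \<in> Obj EM"
  unfolding EM_Obj using un[of a] tri1[of a] un_nat[OF un, of a]
  by (cases a) (auto simp: chom_def coalg_Obj G_fob cofree_comult_def)

text \<open>The inverse of \<open>comparison\<close> on objects: map into the cofree coalgebra, use
  its structure, and come back along \<open>F\<close> of the counit.\<close>

definition coalg_of :: "'o \<times> 'm \<Rightarrow> 'm" where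
  "coalg_of a = Cmp C (far F (\<epsilon> (fst a))) (Cmp C (snd (fob R (fst a))) (snd a))"

lemma R_str: "X \<in> Obj C \<Longrightarrow> snd (fob R X) \<in> hom C (fob G X) (fob F (fob G X))"
  using R_Obj[of X] by (cases "fob R X") (simp add: coalg_Obj G_fob)

lemma coalg_of_un: assumes a: "a \<in> Obj (coalg_cat C F)" shows "coalg_of (fst a, un a) = snd a"
proof -
  have o: "fst a \<in> Obj C" and s: "snd a \<in> hom C (fst a) (fob F (fst a))" using a by (cases a, simp add: coalg_Obj)+
  have u: "un a \<in> hom C (fst a) (fob G (fst a))" using chomD[OF un[OF a]] by (simp add: G_fob)
  have e: "\<epsilon> (fst a) \<in> hom C (fob G (fst a)) (fst a)" using \<epsilon>_hom[OF o] by (simp add: G_fob)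
  have "coalg_of (fst a, un a) = Cmp C (far F (\<epsilon> (fst a))) (Cmp C (far F (un a)) (snd a))"
    using un[OF a] by (simp add: coalg_of_def chom_def)
  also have "\<dots> = Cmp C (far F (Cmp C (\<epsilon> (fst a)) (un a))) (snd a)"
    using far_Cmp[OF F u e] Cmp_assoc[OF C s far_hom[OF F u] far_hom[OF F e]] by simp
  also have "\<dots> = snd a" using tri1[OF a] far_Ide[OF F o] Ide_Cmp[OF C s] by simp
  finally show ?thesis .
qed

text \<open>The computation behind strict comonadicity: the structure \<open>x\<close> of an Eilenberg--Moore coalgebra
  is itself a morphism from \<open>(X, coalg_of (X, x))\<close> to the cofree coalgebra.\<close>

lemma un_coalg_of:
  assumes a: "(X, x) \<in> Obj EM"
  shows "(X, coalg_of (X, x)) \<in> Obj (coalg_cat C F)" "un (X, coalg_of (X, x)) = x"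
proof -
  have X: "X \<in> Obj C" and x: "x \<in> hom C X (fob G X)" and e: "Cmp C (\<epsilon> X) x = Ide C X"
    and d: "Cmp C (\<delta> X) x = Cmp C (far G x) x" using a by (auto simp: EM_Obj)
  let ?r = "\<lambda>X. snd (fob R X)"
  have GX: "fob G X \<in> Obj C" using hom_Obj[OF C x] by simp
  have eps: "\<epsilon> X \<in> hom C (fob G X) X" "\<epsilon> (fob G X) \<in> hom C (fob G (fob G X)) (fob G X)"
    using \<epsilon>_hom X GX by (auto simp: G_fob)
  have dh: "\<delta> X \<in> hom C (fob G X) (fob G (fob G X))" using chomD[OF \<delta>[OF X]] by (simp add: G_fob)
  have rx: "Cmp C (?r X) x \<in> hom C X (fob F (fob G X))" using Cmp_hom[OF C x R_str[OF X]] .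
  have b: "coalg_of (X, x) \<in> hom C X (fob F X)"
    unfolding coalg_of_def using Cmp_hom[OF C rx far_hom[OF F eps(1)]] by simp
  then show ob: "(X, coalg_of (X, x)) \<in> Obj (coalg_cat C F)" using X by (simp add: coalg_Obj)
  have Gx: "far G x \<in> hom C (fob G X) (fob G (fob G X))" using far_hom[OF G x] .
  \<comment> \<open>\<open>\<delta> X\<close> and \<open>far G x\<close> are both coalgebra maps;
    moved past the structure maps, coassociativity of \<open>x\<close> becomes an equation between
    arrows into \<open>F (G (G X))\<close>.\<close>
  have "Cmp C (far F (\<delta> X)) (Cmp C (?r X) x) = Cmp C (?r (fob G X)) (Cmp C (\<delta> X) x)"
    using \<delta>[OF X] Cmp_assoc[OF C x R_str[OF X] far_hom[OF F dh]] Cmp_assoc[OF C x dh R_str[OF GX]]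
    by (simp add: chom_def)
  also have "\<dots> = Cmp C (far F (far G x)) (Cmp C (?r X) x)"
    using R_hom[OF x] Cmp_assoc[OF C x R_str[OF X] far_hom[OF F Gx]] Cmp_assoc[OF C x Gx R_str[OF GX]] d
    by (simp add: chom_def)
  finally have 1: "Cmp C (far F (\<delta> X)) (Cmp C (?r X) x) = Cmp C (far F (far G x)) (Cmp C (?r X) x)" .
  have ed: "Cmp C (\<epsilon> (fob G X)) (\<delta> X) = Ide C (fob G X)" using comonad X by (simp add: comonad_def)
  \<comment> \<open>Insert the counit law \<open>ed\<close>, replace \<open>\<delta> X\<close> by
    \<open>far G x\<close> using \<open>1\<close>, and move \<open>x\<close> out by naturality of
    the counit: \<open>x\<close> turns out to be a coalgebra map.\<close>
  have "Cmp C (?r X) x = Cmp C (far F (Cmp C (\<epsilon> (fob G X)) (\<delta> X))) (Cmp C (?r X) x)"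
    using ed far_Ide[OF F GX] Ide_Cmp[OF C rx] by simp
  also have "\<dots> = Cmp C (far F (\<epsilon> (fob G X))) (Cmp C (far F (\<delta> X)) (Cmp C (?r X) x))"
    using far_Cmp[OF F dh eps(2)] Cmp_assoc[OF C rx far_hom[OF F dh] far_hom[OF F eps(2)]] by simp
  also have "\<dots> = Cmp C (far F (Cmp C (\<epsilon> (fob G X)) (far G x))) (Cmp C (?r X) x)"
    unfolding 1 using far_Cmp[OF F Gx eps(2)] Cmp_assoc[OF C rx far_hom[OF F Gx] far_hom[OF F eps(2)]] by simp
  also have "\<dots> = Cmp C (far F x) (Cmp C (far F (\<epsilon> X)) (Cmp C (?r X) x))"
    using \<epsilon>_nat[OF x] far_Cmp[OF F eps(1) x] Cmp_assoc[OF C rx far_hom[OF F eps(1)] far_hom[OF F x]] by simp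
  finally have "chom (X, coalg_of (X, x)) (fob R X) x"
    using ob R_Obj[OF X] x by (simp add: chom_def coalg_of_def G_fob)
  from un_uniq[OF this X] show "un (X, coalg_of (X, x)) = x"
    using e far_Ide[OF G X] Ide_Cmp[OF C chomD[OF un[OF ob]]] by (simp add: G_fob)
qed

text \<open>For the direction from right to left both coalgebra structures are rewritten as
  \<open>coalg_of\<close>, whose three factors each commute with a map of
  \<open>G\<close>-coalgebras.\<close>

lemma comp_hom:
  assumes a: "a \<in> Obj (coalg_cat C F)" and b: "b \<in> Obj (coalg_cat C F)" and f: "f \<in> hom C (fst a) (fst b)"
  shows "chom a b f \<longleftrightarrow> Cmp C (un b) f = Cmp C (far G f) (un a)"
proof
  assume "chom a b f" then show "Cmp C (un b) f = Cmp C (far G f) (un a)" by (rule un_nat)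
next
  assume eq: "Cmp C (un b) f = Cmp C (far G f) (un a)"
  have o: "fst a \<in> Obj C" "fst b \<in> Obj C" using hom_Obj[OF C f] by auto
  have u: "un a \<in> hom C (fst a) (fob G (fst a))" "un b \<in> hom C (fst b) (fob G (fst b))"
    using chomD[OF un] a b by (auto simp: G_fob)
  have e: "\<epsilon> (fst a) \<in> hom C (fob G (fst a)) (fst a)" "\<epsilon> (fst b) \<in> hom C (fob G (fst b)) (fst b)"
    using \<epsilon>_hom o by (auto simp: G_fob)
  have Gf: "far G f \<in> hom C (fob G (fst a)) (fob G (fst b))" using far_hom[OF G f] .
  let ?r = "\<lambda>X. snd (fob R X)"
  note r = R_str[OF o(1)] R_str[OF o(2)]
  have rG: "Cmp C (?r (fst b)) (far G f) = Cmp C (far F (far G f)) (?r (fst a))"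
    using R_hom[OF f] by (simp add: chom_def)
  have "Cmp C (snd b) f = Cmp C (Cmp C (far F (\<epsilon> (fst b))) (Cmp C (?r (fst b)) (un b))) f"
    using coalg_of_un[OF b] by (simp add: coalg_of_def)
  also have "\<dots> = Cmp C (far F (\<epsilon> (fst b))) (Cmp C (?r (fst b)) (Cmp C (far G f) (un a)))"
    using Cmp_assoc[OF C f Cmp_hom[OF C u(2) r(2)] far_hom[OF F e(2)]] Cmp_assoc[OF C f u(2) r(2)] eq by simp
  also have "\<dots> = Cmp C (far F (\<epsilon> (fst b))) (Cmp C (far F (far G f)) (Cmp C (?r (fst a)) (un a)))"
    using Cmp_assoc[OF C u(1) Gf r(2)] Cmp_assoc[OF C u(1) r(1) far_hom[OF F Gf]] rG by simp
  also have "\<dots> = Cmp C (far F (Cmp C (\<epsilon> (fst b)) (far G f))) (Cmp C (?r (fst a)) (un a))"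
    using far_Cmp[OF F Gf e(2)]
      Cmp_assoc[OF C Cmp_hom[OF C u(1) r(1)] far_hom[OF F Gf] far_hom[OF F e(2)]] by simp
  also have "\<dots> = Cmp C (far F f) (coalg_of (fst a, un a))"
    using \<epsilon>_nat[OF f] far_Cmp[OF F e(1) f]
      Cmp_assoc[OF C Cmp_hom[OF C u(1) r(1)] far_hom[OF F e(1)] far_hom[OF F f]] by (simp add: coalg_of_def)
  finally show "chom a b f" using a b f coalg_of_un[OF a] by (simp add: chom_def)
qed

text \<open>Bijectivity holds on the nose because \<open>coalg_of\<close> inverts
  \<open>comparison\<close> by equations. Arrows carry their endpoints, so injectivity on objects
  enters the argument for arrows as well.\<close>

lemma cat_iso: "cat_iso (coalg_cat C F) EM (comparison \<eta>)"
proof -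
  have "is_functor (coalg_cat C F) EM (comparison \<eta>)"
  proof (rule functorI[OF coalg_category EM_category])
    fix a assume a: "a \<in> Obj (coalg_cat C F)"
    then show "fob (comparison \<eta>) a \<in> Obj EM" by (simp add: comp_Obj)
    show "far (comparison \<eta>) (Ide (coalg_cat C F) a) = Ide EM (fob (comparison \<eta>) a)"
      by (simp add: comonad_coalg_cat_def coalgs_cat_def)
  next
    fix h a b assume h: "h \<in> hom (coalg_cat C F) a b"
    show "far (comparison \<eta>) h \<in> hom EM (fob (comparison \<eta>) a) (fob (comparison \<eta>) b)"
    proof -
      obtain f where f: "h = (a, b, f)" "chom a b f" using h by (auto simp: coalg_hom)
      then show ?thesis using un_nat[OF f(2)] comp_Obj[of a] comp_Obj[of b]
        unfolding EM_hom by (simp add: chom_def)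
    qed
    fix g c assume "g \<in> hom (coalg_cat C F) b c"
    with h show "far (comparison \<eta>) (Cmp (coalg_cat C F) g h) = Cmp EM (far (comparison \<eta>) g) (far (comparison \<eta>) h)"
      by (auto simp: coalg_hom comonad_coalg_cat_def coalgs_cat_def)
  qed
  moreover have inj: "a = b" if "a \<in> Obj (coalg_cat C F)" "b \<in> Obj (coalg_cat C F)"
    "(fst a, un a) = (fst b, un b)" for a b
    using coalg_of_un that by (metis prod.collapse fst_conv)
  then have "bij_betw (fob (comparison \<eta>)) (Obj (coalg_cat C F)) (Obj EM)"
  proof (intro bij_betw_imageI inj_onI)
    show "fob (comparison \<eta>) ` Obj (coalg_cat C F) = Obj EM"
    proof (intro set_eqI iffI)
      fix y assume y: "y \<in> Obj EM"
      then show "y \<in> fob (comparison \<eta>) ` Obj (coalg_cat C F)"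
        using un_coalg_of[of "fst y" "snd y"] by (intro image_eqI[of _ _ "(fst y, coalg_of y)"]) auto
    qed (use comp_Obj in fastforce)
  qed simp
  moreover have "bij_betw (far (comparison \<eta>)) (Arr (coalg_cat C F)) (Arr EM)"
  proof (intro bij_betw_imageI inj_onI)
    fix h k assume "h \<in> Arr (coalg_cat C F)" "k \<in> Arr (coalg_cat C F)"
      and eq: "far (comparison \<eta>) h = far (comparison \<eta>) k"
    then have "h \<in> hom (coalg_cat C F) (Src (coalg_cat C F) h) (Tgt (coalg_cat C F) h)"
      "k \<in> hom (coalg_cat C F) (Src (coalg_cat C F) k) (Tgt (coalg_cat C F) k)"
      by (auto simp: hom_def)
    then obtain a b f a' b' f' where "h = (a, b, f)" "k = (a', b', f')" "chom a b f" "chom a' b' f'"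
      unfolding coalg_hom by blast
    then show "h = k" using eq inj[of a a'] inj[of b b'] by (auto simp: chom_def)
  next
    show "far (comparison \<eta>) ` Arr (coalg_cat C F) = Arr EM"
    proof (intro set_eqI iffI)
      fix h assume "h \<in> far (comparison \<eta>) ` Arr (coalg_cat C F)"
      then show "h \<in> Arr EM"
        using \<open>is_functor (coalg_cat C F) EM (comparison \<eta>)\<close> by (auto simp: is_functor_def hom_def)
    next
      fix h assume "h \<in> Arr EM"
      then obtain a b f where h: "h = (a, b, f)" "a \<in> Obj EM" "b \<in> Obj EM" "f \<in> hom C (fst a) (fst b)"
        "Cmp C (snd b) f = Cmp C (far G f) (snd a)" unfolding EM_Arr EM_hom by blast
      define a' where "a' = (fst a, coalg_of a)"
      define b' where "b' = (fst b, coalg_of b)"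
      have a': "a' \<in> Obj (coalg_cat C F)" "un a' = snd a" "fst a' = fst a"
        using un_coalg_of[of "fst a" "snd a"] h by (auto simp: a'_def)
      have b': "b' \<in> Obj (coalg_cat C F)" "un b' = snd b" "fst b' = fst b"
        using un_coalg_of[of "fst b" "snd b"] h by (auto simp: b'_def)
      have "chom a' b' f" using comp_hom[OF a'(1) b'(1)] h a' b' by simp
      then have "(a', b', f) \<in> hom (coalg_cat C F) a' b'" by (simp add: coalg_hom)
      then have "(a', b', f) \<in> Arr (coalg_cat C F)" by (simp add: hom_def)
      moreover have "h = far (comparison \<eta>) (a', b', f)" using h a' b' by simp
      ultimately show "h \<in> far (comparison \<eta>) ` Arr (coalg_cat C F)" by blast
    qed
  qed
  ultimately show ?thesis by (simp add: cat_iso_def)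
qed

end

section \<open>The Lawvere theory\<close>

lemma subst_in_terms:
  assumes "t \<in> terms \<Sigma> n" "\<And>i. i < n \<Longrightarrow> s i \<in> terms \<Sigma> m"
  shows "subst s t \<in> terms \<Sigma> m"
  using assms(1) by induction (auto intro!: terms.intros assms(2))

lemma subst_subst: "subst s (subst r t) = subst (\<lambda>i. subst s (r i)) t"
  by (induction t) auto

lemma subst_Var: "subst Var t = t"
  by (induction t) (auto simp: map_idI)

lemma subst_cong: "(\<And>v. v \<in> vars t \<Longrightarrow> s v = r v) \<Longrightarrow> subst s t = subst r t"
  by (induction t) auto

lemma terms_vars: "t \<in> terms \<Sigma> n \<Longrightarrow> vars t \<subseteq> {..<n}"
  by (induction rule: terms.induct) auto

lemma terms_mono: "t \<in> terms \<Sigma> n \<Longrightarrow> n \<le> m \<Longrightarrow> t \<in> terms \<Sigma> m"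
  by (induction rule: terms.induct) (auto intro: terms.intros)

lemma subst_nth_cong:
  "t \<in> terms \<Sigma> n \<Longrightarrow> (\<And>i. i < n \<Longrightarrow> s i = r i) \<Longrightarrow> subst s t = subst r t"
  by (rule subst_cong) (use terms_vars in blast)

lemma law_length: "f \<in> law \<Sigma> n m \<Longrightarrow> length f = m"
  by (simp add: law_def)

lemma law_nth: "f \<in> law \<Sigma> n m \<Longrightarrow> i < m \<Longrightarrow> f ! i \<in> terms \<Sigma> n"
  by (auto simp: law_def)

lemma law_id_law: "law_id n \<in> law \<Sigma> n n"
  by (auto simp: law_def law_id_def intro: terms.intros)

lemma law_comp_law:
  assumes "f \<in> law \<Sigma> n m" "g \<in> law \<Sigma> m k"
  shows "law_comp g f \<in> law \<Sigma> n k"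
  using assms by (auto simp: law_def law_comp_def intro!: subst_in_terms[of _ _ m])

lemma law_plus_law:
  assumes "f \<in> law \<Sigma> n m"
  shows "law_plus n k f \<in> law \<Sigma> (n + k) (m + k)"
  using assms by (auto simp: law_def law_plus_def intro: terms_mono terms.intros)

lemma law_plus_id: "law_plus n k (law_id n) = law_id (n + k)"
  unfolding law_plus_def law_id_def map_append[symmetric] by (simp only: upt_add_eq_append[of 0, simplified])

lemma law_plus_comp:
  assumes "f \<in> law \<Sigma> n m" "g \<in> law \<Sigma> m l"
  shows "law_plus n k (law_comp g f) = law_comp (law_plus m k g) (law_plus n k f)"
proof -
  have "subst ((!) f) t = subst ((!) (law_plus n k f)) t" if "t \<in> set g" for t
    using assms that by (intro subst_nth_cong[of _ \<Sigma> m]) (auto simp: law_def law_plus_def nth_append)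
  moreover have "map Var [n..<n + k] = map (subst ((!) (law_plus n k f))) (map Var [m..<m + k])"
  proof (rule nth_equalityI)
    fix i assume "i < length (map Var [n..<n + k] :: 'a trm list)"
    then have "i < k" by simp
    then show "map Var [n..<n + k] ! i = map (subst ((!) (law_plus n k f))) (map Var [m..<m + k]) ! i"
      using law_length[OF assms(1)] by (simp add: law_plus_def nth_append)
  qed simp
  ultimately have "map (subst ((!) f)) g @ map Var [n..<n + k] =
      map (subst ((!) (law_plus n k f))) g @ map (subst ((!) (law_plus n k f))) (map Var [m..<m + k])"
    by (metis (no_types, lifting) map_cong)
  then show ?thesis by (simp only: law_comp_def law_plus_def[of n k "map _ _"] law_plus_def[of m] map_append)
qed

section \<open>Injections\<close>

lemma J_law: "i \<in> injs n m \<Longrightarrow> J i \<in> law \<Sigma> m n"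
  by (auto simp: injs_def J_def law_def intro!: terms.intros)

lemma J_upt: "J [0..<n] = law_id n"
  by (simp add: J_def law_id_def)

lemma upt_injs: "n \<le> m \<Longrightarrow> [0..<n] \<in> injs n m"
  by (auto simp: injs_def)

lemma inj_comp_injs: "i \<in> injs n m \<Longrightarrow> j \<in> injs m l \<Longrightarrow> inj_comp j i \<in> injs n l"
  by (auto simp: injs_def inj_comp_def distinct_map inj_on_def)
    (metis lessThan_iff nth_eq_iff_index_eq subsetD, metis lessThan_iff nth_mem subsetD)

lemma inj_comp_assoc: "i \<in> injs n m \<Longrightarrow> j \<in> injs m l \<Longrightarrow>
  inj_comp (inj_comp k j) i = inj_comp k (inj_comp j i)"
  by (auto simp: injs_def inj_comp_def)

lemma inj_id_comp: "i \<in> injs n m \<Longrightarrow> inj_comp [0..<m] i = i"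
  by (auto simp: injs_def inj_comp_def intro!: map_idI)

lemma J_comp: "i \<in> injs n m \<Longrightarrow> j \<in> injs m l \<Longrightarrow> J (inj_comp j i) = law_comp (J i) (J j)"
  by (auto simp: injs_def inj_comp_def J_def law_comp_def)

lemma injs_le: "i \<in> injs n m \<Longrightarrow> n \<le> m"
  unfolding injs_def using card_mono[of "{..<m}" "set i"] by (auto simp: distinct_card)

text \<open>Listing the values of \<open>i\<close> and then the remaining numbers below
  \<open>m\<close> gives a permutation \<open>r\<close> that extends \<open>i\<close>;
  \<open>s\<close> is its inverse. Every injection is thus an inclusion up to a permutation of its
  target.\<close>

lemma injs_normalize:
  assumes "i \<in> injs n m"
  obtains s r where "s \<in> injs m m" "r \<in> injs m m" "inj_comp s i = [0..<n]"
    "inj_comp r [0..<n] = i" "inj_comp s r = [0..<m]" "inj_comp r s = [0..<m]"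
proof -
  define r where "r = i @ filter (\<lambda>x. x \<notin> set i) [0..<m]"
  have set_r: "set r = {..<m}" and dr: "distinct r"
    using assms by (auto simp: r_def injs_def)
  then have len: "length r = m" by (metis card_lessThan distinct_card)
  have r: "r \<in> injs m m" using set_r dr len by (simp add: injs_def)
  have bij: "bij_betw ((!) r) {..<m} {..<m}"
    by (rule bij_betw_nth[OF dr]) (simp_all add: len set_r)
  define s where "s = map (the_inv_into {..<m} ((!) r)) [0..<m]"
  have inv: "the_inv_into {..<m} ((!) r) (r ! x) = x" if "x < m" for x
    using the_inv_into_f_f[OF bij_betw_imp_inj_on[OF bij]] that by simp
  have inv2: "r ! the_inv_into {..<m} ((!) r) x = x" if "x < m" for x
    using f_the_inv_into_f_bij_betw[OF bij] that by simp
  have binv: "bij_betw (the_inv_into {..<m} ((!) r)) {..<m} {..<m}"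
    by (rule bij_betw_the_inv_into[OF bij])
  have s: "s \<in> injs m m" using binv
    by (auto simp: s_def injs_def distinct_map bij_betw_def lessThan_atLeast0)
  have sr: "inj_comp s r = [0..<m]"
  proof (rule nth_equalityI)
    fix i assume "i < length (inj_comp s r)"
    then have "i < m" "r ! i < m" using len set_r nth_mem[of i r] by (auto simp: inj_comp_def)
    then show "inj_comp s r ! i = [0..<m] ! i" using inv len by (simp add: inj_comp_def s_def)
  qed (simp add: inj_comp_def len)
  have rs: "inj_comp r s = [0..<m]"
    using inv2 by (auto simp: inj_comp_def s_def intro!: nth_equalityI)
  have ri: "inj_comp r [0..<n] = i"
    using assms by (auto simp: inj_comp_def r_def injs_def nth_append intro!: nth_equalityI)
  have "inj_comp s i = inj_comp s (inj_comp r [0..<n])" by (simp add: ri)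
  also have "\<dots> = inj_comp (inj_comp s r) [0..<n]"
    using inj_comp_assoc[OF upt_injs[OF injs_le[OF assms]] r] by simp
  also have "\<dots> = [0..<n]" unfolding sr using injs_le[OF assms] by (auto simp: inj_comp_def intro!: nth_equalityI)
  finally show thesis using that s r ri sr rs by blast
qed

text \<open>After composition with permutations both injections are the inclusion of
  \<open>m\<close>, and the two targets are glued along it.\<close>

lemma injs_amalgamate:
  assumes "u \<in> injs m N" "v \<in> injs m N'"
  obtains M w w' where "w \<in> injs N M" "w' \<in> injs N' M" "inj_comp w u = inj_comp w' v"
proof -
  obtain s where s: "s \<in> injs N N" "inj_comp s u = [0..<m]" using injs_normalize[OF assms(1)] by metis
  obtain r where r: "r \<in> injs N' N'" "inj_comp r v = [0..<m]" using injs_normalize[OF assms(2)] by metis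
  \<comment> \<open>Any sufficiently large target will do, so no pushout is formed:
    \<open>z'\<close> keeps the numbers below \<open>m\<close> and sends every other
    \<open>x\<close> to \<open>N + x\<close>, beyond the range of \<open>z\<close>.\<close>
  define M where "M = N + N'"
  define z where "z = [0..<N]"
  define z' where "z' = [0..<m] @ map (\<lambda>x. N + x) [m..<N']"
  have le: "m \<le> N" "m \<le> N'" using assms injs_le by auto
  have z: "z \<in> injs N M" by (simp add: z_def M_def upt_injs)
  have z': "z' \<in> injs N' M" using le by (auto simp: z'_def M_def injs_def distinct_map)
  have "inj_comp (inj_comp z s) u = inj_comp z (inj_comp s u)"
    using inj_comp_assoc[OF assms(1) s(1)] .
  also have "\<dots> = inj_comp z' (inj_comp r v)" unfolding s r
    using le by (auto simp: inj_comp_def z_def z'_def nth_append)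
  also have "\<dots> = inj_comp (inj_comp z' r) v" using inj_comp_assoc[OF assms(2) r(1)] by simp
  finally show thesis using that inj_comp_injs[OF s(1) z] inj_comp_injs[OF r(1) z'] by blast
qed

text \<open>\<open>shift n w\<close> is the injection $n + w : n + k \to n + K$ for $w : k \to K$.\<close>

definition shift :: "nat \<Rightarrow> nat list \<Rightarrow> nat list" where
  "shift n w = [0..<n] @ map ((+) n) w"

lemma shift_injs: "w \<in> injs k K \<Longrightarrow> shift n w \<in> injs (n + k) (n + K)"
  by (auto simp: shift_def injs_def distinct_map)

lemma shift_comp: "w \<in> injs k K \<Longrightarrow> v \<in> injs K L \<Longrightarrow>
  inj_comp (shift n v) (shift n w) = shift n (inj_comp v w)"
  by (auto simp: shift_def injs_def inj_comp_def nth_append intro!: nth_equalityI)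

lemma shift_upt: "shift n [0..<k] = [0..<n + k]"
  by (auto simp: shift_def intro!: nth_equalityI simp: nth_append)

lemma shift_incl: "inj_comp (shift n w) [0..<n] = [0..<n]"
  by (auto simp: shift_def inj_comp_def nth_append intro!: nth_equalityI)

text \<open>An injection that fixes the first \<open>n\<close> numbers can only inject the remaining
  ones among themselves. Morphisms between inclusions in the coslice \<open>n/Inj\<close> are
  therefore given by injections \<open>w : k -> K\<close>.\<close>

lemma injs_shift:
  assumes "u \<in> injs (n + k) N" "inj_comp u [0..<n] = [0..<n]"
  obtains K w where "N = n + K" "w \<in> injs k K" "u = shift n w"
proof -
  have N: "n + k \<le> N" using assms injs_le by blast
  have un: "u ! i = i" if "i < n" for i
    using assms that unfolding inj_comp_def by (metis add_0 diff_zero length_upt nth_map nth_upt)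
  have d: "distinct u" "length u = n + k" "\<And>x. x \<in> set u \<Longrightarrow> x < N" using assms by (auto simp: injs_def)
  \<comment> \<open>Values below \<open>n\<close> are already taken, by the fixed numbers.\<close>
  have ge: "n \<le> u ! (n + i)" if "i < k" for i
  proof (rule ccontr)
    assume "\<not> n \<le> u ! (n + i)"
    then have "u ! (u ! (n + i)) = u ! (n + i)" using un by simp
    then show False using d that \<open>\<not> n \<le> u ! (n + i)\<close> by (simp add: nth_eq_iff_index_eq)
  qed
  define w where "w = map (\<lambda>i. u ! (n + i) - n) [0..<k]"
  have "u = shift n w"
  proof (rule nth_equalityI)
    fix i assume "i < length u"
    then show "u ! i = shift n w ! i" using un ge[of "i - n"] d(2) by (auto simp: shift_def w_def nth_append)
  qed (simp add: shift_def w_def d(2))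
  moreover have "w \<in> injs k (N - n)"
  proof -
    have "u ! (n + i) < N" if "i < k" for i using d that by simp
    moreover have "inj_on (\<lambda>i. u ! (n + i) - n) {0..<k}"
    proof (rule inj_onI)
      fix i j assume "i \<in> {0..<k}" "j \<in> {0..<k}" "u ! (n + i) - n = u ! (n + j) - n"
      then have "u ! (n + i) = u ! (n + j)" using ge[of i] ge[of j] by auto
      then show "i = j" using d \<open>i \<in> _\<close> \<open>j \<in> _\<close> by (simp add: nth_eq_iff_index_eq)
    qed
    ultimately show ?thesis using ge
      by (auto simp: w_def injs_def distinct_map dest!: spec) (metis ge less_diff_conv2 less_imp_le diff_less_mono)
  qed
  ultimately show thesis using that[of "N - n" w] N by simp
qed

lemma J_shift: "J (shift n w) = law_id n @ map (\<lambda>x. Var (n + x)) w"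
  by (simp add: J_def shift_def law_id_def)

lemma law_plus_J: "law_plus n k (J i) = J (i @ [n..<n + k])"
  by (simp add: law_plus_def J_def)

lemma injs_plus: "i \<in> injs m n \<Longrightarrow> i @ [n..<n + k] \<in> injs (m + k) (n + k)"
  by (auto simp: injs_def)

text \<open>Both sides are \<open>f @ map (\<lambda>x. Var (n + x)) w\<close>.\<close>

lemma law_plus_shift:
  assumes "f \<in> law \<Sigma> n m" "w \<in> injs k K"
  shows "law_comp (J (shift m w)) (law_plus n K f) = law_comp (law_plus n k f) (J (shift n w))"
proof -
  have "subst ((!) (J (shift n w))) t = t" if "t \<in> set f" for t
  proof -
    have "t \<in> terms \<Sigma> n" using assms that by (auto simp: law_def)
    then have "subst ((!) (J (shift n w))) t = subst Var t"
      by (rule subst_nth_cong) (simp add: J_shift law_id_def nth_append)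
    then show ?thesis by (simp add: subst_Var)
  qed
  then have "law_comp (law_plus n k f) (J (shift n w)) = f @ map (\<lambda>x. Var (n + x)) w"
    using assms(2) by (auto simp: law_comp_def law_plus_def J_shift injs_def law_id_def nth_append
        map_idI intro!: nth_equalityI)
  moreover have "law_comp (J (shift m w)) (law_plus n K f) = f @ map (\<lambda>x. Var (n + x)) w"
    using assms by (auto simp: law_comp_def law_plus_def J_shift injs_def law_id_def law_def nth_append
        intro!: nth_equalityI)
  ultimately show ?thesis by simp
qed

section \<open>Presheaves and lax transformations\<close>

lemma presheaf_le_pts: "presheaf \<Sigma> H \<Longrightarrow> (x, y) \<in> le (ob H n) \<Longrightarrow> x \<in> pts (ob H n) \<and> y \<in> pts (ob H n)"
  and presheaf_refl: "presheaf \<Sigma> H \<Longrightarrow> x \<in> pts (ob H n) \<Longrightarrow> (x, x) \<in> le (ob H n)"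
  and presheaf_trans: "presheaf \<Sigma> H \<Longrightarrow> (x, y) \<in> le (ob H n) \<Longrightarrow> (y, z) \<in> le (ob H n) \<Longrightarrow> (x, z) \<in> le (ob H n)"
  unfolding presheaf_def preorder_on_def refl_on_def trans_def by blast+

lemma presheaf_monotone:
  "presheaf \<Sigma> H \<Longrightarrow> f \<in> law \<Sigma> n m \<Longrightarrow> monotone_map (ob H m) (ob H n) (act H n f)"
  unfolding presheaf_def by blast

lemma presheaf_act: "presheaf \<Sigma> H \<Longrightarrow> f \<in> law \<Sigma> n m \<Longrightarrow> x \<in> pts (ob H m) \<Longrightarrow> act H n f x \<in> pts (ob H n)"
  and presheaf_act_le: "presheaf \<Sigma> H \<Longrightarrow> f \<in> law \<Sigma> n m \<Longrightarrow> (x, y) \<in> le (ob H m) \<Longrightarrow> (act H n f x, act H n f y) \<in> le (ob H n)"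
  using presheaf_monotone[of \<Sigma> H f n m] unfolding monotone_map_def by auto

lemma presheaf_id: "presheaf \<Sigma> H \<Longrightarrow> x \<in> pts (ob H n) \<Longrightarrow> act H n (law_id n) x = x"
  unfolding presheaf_def by blast

lemma presheaf_comp: "presheaf \<Sigma> H \<Longrightarrow> f \<in> law \<Sigma> n m \<Longrightarrow> g \<in> law \<Sigma> m k \<Longrightarrow> x \<in> pts (ob H k) \<Longrightarrow>
    act H n (law_comp g f) x = act H n f (act H m g x)"
  unfolding presheaf_def by blast

lemma presheaf_J_comp: "presheaf \<Sigma> H \<Longrightarrow> i \<in> injs n m \<Longrightarrow> j \<in> injs m l \<Longrightarrow> x \<in> pts (ob H n) \<Longrightarrow>
    act H l (J j) (act H m (J i) x) = act H l (J (inj_comp j i)) x"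
  by (simp add: presheaf_comp[OF _ J_law J_law] J_comp)

text \<open>\<open>f\<close> acts on the given variables and \<open>w\<close> on the added ones, so
  the two actions commute. This makes the action by \<open>f + k\<close> compatible with the
  identifications in the colimit.\<close>

lemma presheaf_exchange:
  assumes H: "presheaf \<Sigma> H" and f: "f \<in> law \<Sigma> n m" and w: "w \<in> injs k K" and a: "a \<in> pts (ob H (m + k))"
  shows "act H (n + K) (J (shift n w)) (act H (n + k) (law_plus n k f) a) =
    act H (n + K) (law_plus n K f) (act H (m + K) (J (shift m w)) a)"
  using presheaf_comp[OF H J_law[OF shift_injs[OF w]] law_plus_law[OF f] a]
    presheaf_comp[OF H law_plus_law[OF f] J_law[OF shift_injs[OF w]] a] law_plus_shift[OF f w] by metis

lemma presheafI:
  assumes "\<And>n x. x \<in> pts (X n) \<Longrightarrow> (x, x) \<in> le (X n)"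
    "\<And>n x y. (x, y) \<in> le (X n) \<Longrightarrow> x \<in> pts (X n) \<and> y \<in> pts (X n)"
    "\<And>n x y z. (x, y) \<in> le (X n) \<Longrightarrow> (y, z) \<in> le (X n) \<Longrightarrow> (x, z) \<in> le (X n)"
    "\<And>n m f x. f \<in> law \<Sigma> n m \<Longrightarrow> x \<in> pts (X m) \<Longrightarrow> \<phi> n f x \<in> pts (X n)"
    "\<And>n m f x y. f \<in> law \<Sigma> n m \<Longrightarrow> (x, y) \<in> le (X m) \<Longrightarrow> (\<phi> n f x, \<phi> n f y) \<in> le (X n)"
    "\<And>n x. x \<in> pts (X n) \<Longrightarrow> \<phi> n (law_id n) x = x"
    "\<And>n m k f g x. f \<in> law \<Sigma> n m \<Longrightarrow> g \<in> law \<Sigma> m k \<Longrightarrow> x \<in> pts (X k) \<Longrightarrow>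
       \<phi> n (law_comp g f) x = \<phi> n f (\<phi> m g x)"
  shows "presheaf \<Sigma> \<lparr>ob = X, act = act_on \<Sigma> X \<phi>\<rparr>"
proof -
  have a: "act_on \<Sigma> X \<phi> n f = restrict (\<phi> n f) (pts (X m))" if "f \<in> law \<Sigma> n m" for n m f
    using that law_length[OF that] by (simp add: act_on_def)
  have p: "preorder_on (pts (X n)) (le (X n))" for n
    unfolding preorder_on_def refl_on_def trans_def
    using assms(1)[where n = n] assms(2)[where n = n] assms(3)[where n = n] by (auto 0 3)
  have c: "act_on \<Sigma> X \<phi> n (law_comp g f) x = act_on \<Sigma> X \<phi> n f (act_on \<Sigma> X \<phi> m g x)"
    if "f \<in> law \<Sigma> n m" "g \<in> law \<Sigma> m k" "x \<in> pts (X k)" for n m k f g x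
    using that assms(4,7) by (simp add: a[OF that(1)] a[OF that(2)] a[OF law_comp_law[OF that(1,2)]])
  have i: "act_on \<Sigma> X \<phi> n (law_id n) x = x" if "x \<in> pts (X n)" for n x
    using that by (simp add: a[OF law_id_law] assms(6))
  have u: "act_on \<Sigma> X \<phi> n f = (\<lambda>_. undefined)" if "f \<notin> law \<Sigma> n (length f)" for n f
    using that by (simp add: act_on_def)
  have m: "monotone_map (X m) (X n) (act_on \<Sigma> X \<phi> n f)" if "f \<in> law \<Sigma> n m" for f n m
    unfolding monotone_map_def a[OF that] using assms(2,4,5) that by fastforce
  show ?thesis
    unfolding presheaf_def using p m c i u by simp
qed

lemma act_on_eq: "f \<in> law \<Sigma> n m \<Longrightarrow> x \<in> pts (X m) \<Longrightarrow> act_on \<Sigma> X \<phi> n f x = \<phi> n f x"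
  using law_length[of f \<Sigma> n m] by (simp add: act_on_def)

lemma lax_src: "lax_inj \<Sigma> \<alpha> \<Longrightarrow> presheaf \<Sigma> (src \<alpha>)"
  and lax_tgt: "lax_inj \<Sigma> \<alpha> \<Longrightarrow> presheaf \<Sigma> (tgt \<alpha>)"
  by (auto simp: lax_inj_def)

lemma lax_pts: "lax_inj \<Sigma> \<alpha> \<Longrightarrow> x \<in> pts (ob (src \<alpha>) n) \<Longrightarrow> cmpt \<alpha> n x \<in> pts (ob (tgt \<alpha>) n)"
  and lax_mono: "lax_inj \<Sigma> \<alpha> \<Longrightarrow> (x, y) \<in> le (ob (src \<alpha>) n) \<Longrightarrow> (cmpt \<alpha> n x, cmpt \<alpha> n y) \<in> le (ob (tgt \<alpha>) n)"
  and lax_ext: "lax_inj \<Sigma> \<alpha> \<Longrightarrow> cmpt \<alpha> n \<in> extensional (pts (ob (src \<alpha>) n))"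
  unfolding lax_inj_def monotone_map_def PiE_def by auto

lemma lax_lax: "lax_inj \<Sigma> \<alpha> \<Longrightarrow> f \<in> law \<Sigma> n m \<Longrightarrow> x \<in> pts (ob (src \<alpha>) m) \<Longrightarrow>
    (act (tgt \<alpha>) n f (cmpt \<alpha> m x), cmpt \<alpha> n (act (src \<alpha>) n f x)) \<in> le (ob (tgt \<alpha>) n)"
  and lax_strict: "lax_inj \<Sigma> \<alpha> \<Longrightarrow> i \<in> injs m n \<Longrightarrow> x \<in> pts (ob (src \<alpha>) m) \<Longrightarrow>
    act (tgt \<alpha>) n (J i) (cmpt \<alpha> m x) = cmpt \<alpha> n (act (src \<alpha>) n (J i) x)"
  unfolding lax_inj_def by blast+

text \<open>Cutting the components down to the points gives the extensional functions that
  \<open>monotone_map\<close> demands, so that equality of arrows can be checked on points.\<close>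

definition mk_lax :: "('f, 'u) psh \<Rightarrow> ('f, 'u) psh \<Rightarrow> (nat \<Rightarrow> 'u \<Rightarrow> 'u) \<Rightarrow> ('f, 'u) lax" where
  "mk_lax H K g = \<lparr>src = H, tgt = K, cmpt = (\<lambda>n. \<lambda>x\<in>pts (ob H n). g n x)\<rparr>"

lemma mk_lax_simps [simp]: "src (mk_lax H K g) = H" "tgt (mk_lax H K g) = K"
  "x \<in> pts (ob H n) \<Longrightarrow> cmpt (mk_lax H K g) n x = g n x"
  by (auto simp: mk_lax_def)

lemma lax_mk_lax:
  assumes H: "presheaf \<Sigma> H" and K: "presheaf \<Sigma> K"
    and p: "\<And>n x. x \<in> pts (ob H n) \<Longrightarrow> g n x \<in> pts (ob K n)"
    and m: "\<And>n x y. (x, y) \<in> le (ob H n) \<Longrightarrow> (g n x, g n y) \<in> le (ob K n)"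
    and l: "\<And>n m f x. f \<in> law \<Sigma> n m \<Longrightarrow> x \<in> pts (ob H m) \<Longrightarrow> (act K n f (g m x), g n (act H n f x)) \<in> le (ob K n)"
    and s: "\<And>n m i x. i \<in> injs m n \<Longrightarrow> x \<in> pts (ob H m) \<Longrightarrow> act K n (J i) (g m x) = g n (act H n (J i) x)"
  shows "lax_inj \<Sigma> (mk_lax H K g)"
proof -
  have "monotone_map (ob H n) (ob K n) (\<lambda>x\<in>pts (ob H n). g n x)" for n
    unfolding monotone_map_def using p m presheaf_le_pts[OF H] by fastforce
  moreover have "act H n f x \<in> pts (ob H n)" if "f \<in> law \<Sigma> n m" "x \<in> pts (ob H m)" for n m f x
    using presheaf_act[OF H that] .
  moreover have "act H n (J i) x \<in> pts (ob H n)" if "i \<in> injs m n" "x \<in> pts (ob H m)" for n m i x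
    using presheaf_act[OF H J_law[OF that(1)] that(2)] .
  ultimately show ?thesis unfolding lax_inj_def mk_lax_def using H K l s by simp
qed

lemma lax_eqI:
  assumes "lax_inj \<Sigma> \<alpha>" "lax_inj \<Sigma> \<beta>" "src \<alpha> = src \<beta>" "tgt \<alpha> = tgt \<beta>"
    "\<And>n x. x \<in> pts (ob (src \<alpha>) n) \<Longrightarrow> cmpt \<alpha> n x = cmpt \<beta> n x"
  shows "\<alpha> = \<beta>"
proof -
  have "cmpt \<alpha> n = cmpt \<beta> n" for n
    using extensionalityI[OF lax_ext[OF assms(1)] lax_ext[OF assms(2), of n, folded assms(3)]] assms(5) by blast
  with assms(3,4) show ?thesis by (intro lax.equality) auto
qed

lemma Lax_simps [simp]: "Obj (Lax_Inj \<Sigma>) = {H. presheaf \<Sigma> H}" "Arr (Lax_Inj \<Sigma>) = {\<alpha>. lax_inj \<Sigma> \<alpha>}"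
  "Src (Lax_Inj \<Sigma>) = src" "Tgt (Lax_Inj \<Sigma>) = tgt" "Ide (Lax_Inj \<Sigma>) H = mk_lax H H (\<lambda>n x. x)"
  "Cmp (Lax_Inj \<Sigma>) \<beta> \<alpha> = mk_lax (src \<alpha>) (tgt \<beta>) (\<lambda>n x. cmpt \<beta> n (cmpt \<alpha> n x))"
  by (auto simp: Lax_Inj_def mk_lax_def)

lemma Lax_hom: "\<alpha> \<in> hom (Lax_Inj \<Sigma>) H K \<longleftrightarrow> lax_inj \<Sigma> \<alpha> \<and> src \<alpha> = H \<and> tgt \<alpha> = K"
  by (auto simp: hom_def)

lemma lax_Ide: "presheaf \<Sigma> H \<Longrightarrow> lax_inj \<Sigma> (mk_lax H H (\<lambda>n x. x))"
  by (rule lax_mk_lax) (auto intro: presheaf_refl presheaf_act)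

lemma lax_Cmp:
  assumes a: "lax_inj \<Sigma> \<alpha>" and b: "lax_inj \<Sigma> \<beta>" and e: "src \<beta> = tgt \<alpha>"
  shows "lax_inj \<Sigma> (mk_lax (src \<alpha>) (tgt \<beta>) (\<lambda>n x. cmpt \<beta> n (cmpt \<alpha> n x)))"
proof (rule lax_mk_lax[OF lax_src[OF a] lax_tgt[OF b]])
  fix n m f x assume f: "f \<in> law \<Sigma> n m" and x: "x \<in> pts (ob (src \<alpha>) m)"
  show "(act (tgt \<beta>) n f (cmpt \<beta> m (cmpt \<alpha> m x)), cmpt \<beta> n (cmpt \<alpha> n (act (src \<alpha>) n f x))) \<in> le (ob (tgt \<beta>) n)"
    by (rule presheaf_trans[OF lax_tgt[OF b] lax_lax[OF b f] lax_mono[OF b]])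
      (use lax_pts[OF a x] lax_lax[OF a f x] in \<open>simp_all add: e\<close>)
next
  fix n m i x assume i: "i \<in> injs m n" and x: "x \<in> pts (ob (src \<alpha>) m)"
  show "act (tgt \<beta>) n (J i) (cmpt \<beta> m (cmpt \<alpha> m x)) = cmpt \<beta> n (cmpt \<alpha> n (act (src \<alpha>) n (J i) x))"
    using lax_strict[OF b i] lax_pts[OF a x] lax_strict[OF a i x] by (simp add: e)
qed (use lax_pts[OF a] lax_pts[OF b] lax_mono[OF a] lax_mono[OF b] e in auto)

lemma Lax_category: "category (Lax_Inj \<Sigma>)"
  unfolding category_def
proof (intro conjI ballI impI)
  fix \<alpha> assume "\<alpha> \<in> Arr (Lax_Inj \<Sigma>)"
  then have a: "lax_inj \<Sigma> \<alpha>" by simp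
  then show "Src (Lax_Inj \<Sigma>) \<alpha> \<in> Obj (Lax_Inj \<Sigma>)" "Tgt (Lax_Inj \<Sigma>) \<alpha> \<in> Obj (Lax_Inj \<Sigma>)"
    using lax_src lax_tgt by auto
  have i: "lax_inj \<Sigma> (mk_lax (src \<alpha>) (src \<alpha>) (\<lambda>n x. x))" "lax_inj \<Sigma> (mk_lax (tgt \<alpha>) (tgt \<alpha>) (\<lambda>n x. x))"
    using lax_Ide[OF lax_src[OF a]] lax_Ide[OF lax_tgt[OF a]] .
  show "Cmp (Lax_Inj \<Sigma>) \<alpha> (Ide (Lax_Inj \<Sigma>) (Src (Lax_Inj \<Sigma>) \<alpha>)) = \<alpha>"
    using lax_Cmp[OF i(1) a] by (intro lax_eqI[OF _ a]) auto
  show "Cmp (Lax_Inj \<Sigma>) (Ide (Lax_Inj \<Sigma>) (Tgt (Lax_Inj \<Sigma>) \<alpha>)) \<alpha> = \<alpha>"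
    using lax_Cmp[OF a i(2)] lax_pts[OF a] by (intro lax_eqI[OF _ a]) auto
  fix \<beta> assume "\<beta> \<in> Arr (Lax_Inj \<Sigma>)" and ab: "Src (Lax_Inj \<Sigma>) \<beta> = Tgt (Lax_Inj \<Sigma>) \<alpha>"
  then have b: "lax_inj \<Sigma> \<beta>" "src \<beta> = tgt \<alpha>" by auto
  show "Cmp (Lax_Inj \<Sigma>) \<beta> \<alpha> \<in> hom (Lax_Inj \<Sigma>) (Src (Lax_Inj \<Sigma>) \<alpha>) (Tgt (Lax_Inj \<Sigma>) \<beta>)"
    using lax_Cmp[OF a b] by (simp add: Lax_hom)
  fix \<gamma> assume "\<gamma> \<in> Arr (Lax_Inj \<Sigma>)" "Src (Lax_Inj \<Sigma>) \<gamma> = Tgt (Lax_Inj \<Sigma>) \<beta>"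
  then show "Cmp (Lax_Inj \<Sigma>) \<gamma> (Cmp (Lax_Inj \<Sigma>) \<beta> \<alpha>) = Cmp (Lax_Inj \<Sigma>) (Cmp (Lax_Inj \<Sigma>) \<gamma> \<beta>) \<alpha>"
    using lax_pts[OF a] b(2) by (auto simp: mk_lax_def fun_eq_iff)
qed (use lax_Ide in \<open>auto simp: Lax_hom\<close>)

text \<open>Turns functoriality into conditions on the pointwise action \<open>M\<close>; used for
  \<integral> and for finite subsets.\<close>

lemma Lax_functorI:
  assumes far: "\<And>\<alpha>. far F \<alpha> = mk_lax (fob F (src \<alpha>)) (fob F (tgt \<alpha>)) (M \<alpha>)"
    and ps: "\<And>H. presheaf \<Sigma> H \<Longrightarrow> presheaf \<Sigma> (fob F H)"
    and p: "\<And>\<alpha> n x. lax_inj \<Sigma> \<alpha> \<Longrightarrow> x \<in> pts (ob (fob F (src \<alpha>)) n) \<Longrightarrow> M \<alpha> n x \<in> pts (ob (fob F (tgt \<alpha>)) n)"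
    and m: "\<And>\<alpha> n x y. lax_inj \<Sigma> \<alpha> \<Longrightarrow> (x, y) \<in> le (ob (fob F (src \<alpha>)) n) \<Longrightarrow>
      (M \<alpha> n x, M \<alpha> n y) \<in> le (ob (fob F (tgt \<alpha>)) n)"
    and l: "\<And>\<alpha> n m f x. lax_inj \<Sigma> \<alpha> \<Longrightarrow> f \<in> law \<Sigma> n m \<Longrightarrow> x \<in> pts (ob (fob F (src \<alpha>)) m) \<Longrightarrow>
      (act (fob F (tgt \<alpha>)) n f (M \<alpha> m x), M \<alpha> n (act (fob F (src \<alpha>)) n f x)) \<in> le (ob (fob F (tgt \<alpha>)) n)"
    and s: "\<And>\<alpha> n m i x. lax_inj \<Sigma> \<alpha> \<Longrightarrow> i \<in> injs m n \<Longrightarrow> x \<in> pts (ob (fob F (src \<alpha>)) m) \<Longrightarrow>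
      act (fob F (tgt \<alpha>)) n (J i) (M \<alpha> m x) = M \<alpha> n (act (fob F (src \<alpha>)) n (J i) x)"
    and i: "\<And>H n x. presheaf \<Sigma> H \<Longrightarrow> x \<in> pts (ob (fob F H) n) \<Longrightarrow> M (mk_lax H H (\<lambda>n x. x)) n x = x"
    and c: "\<And>\<alpha> \<beta> n x. lax_inj \<Sigma> \<alpha> \<Longrightarrow> lax_inj \<Sigma> \<beta> \<Longrightarrow> src \<beta> = tgt \<alpha> \<Longrightarrow> x \<in> pts (ob (fob F (src \<alpha>)) n) \<Longrightarrow>
      M (mk_lax (src \<alpha>) (tgt \<beta>) (\<lambda>n x. cmpt \<beta> n (cmpt \<alpha> n x))) n x = M \<beta> n (M \<alpha> n x)"
  shows "is_functor (Lax_Inj \<Sigma>) (Lax_Inj \<Sigma>) F"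
proof -
  have lax: "lax_inj \<Sigma> (far F \<alpha>)" if "lax_inj \<Sigma> \<alpha>" for \<alpha>
    unfolding far by (rule lax_mk_lax) (use that ps[OF lax_src[OF that]] ps[OF lax_tgt[OF that]] p m l s in auto)
  show ?thesis
  proof (rule functorI[OF Lax_category Lax_category])
    fix H :: "('a, 'b) psh" assume "H \<in> Obj (Lax_Inj \<Sigma>)"
    then have H: "presheaf \<Sigma> H" by simp
    show "far F (Ide (Lax_Inj \<Sigma>) H) = Ide (Lax_Inj \<Sigma>) (fob F H)"
      by (rule lax_eqI[OF lax]) (use lax_Ide[OF H] lax_Ide[OF ps[OF H]] in \<open>auto simp: far i[OF H]\<close>)
  next
    fix \<alpha> \<beta> :: "('a, 'b) lax" and H K L assume "\<alpha> \<in> hom (Lax_Inj \<Sigma>) H K" "\<beta> \<in> hom (Lax_Inj \<Sigma>) K L"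
    then have ab: "lax_inj \<Sigma> \<alpha>" "lax_inj \<Sigma> \<beta>" "src \<beta> = tgt \<alpha>" by (auto simp: Lax_hom)
    show "far F (Cmp (Lax_Inj \<Sigma>) \<beta> \<alpha>) = Cmp (Lax_Inj \<Sigma>) (far F \<beta>) (far F \<alpha>)"
      by (rule lax_eqI[OF lax]) (use lax_Cmp[OF ab] lax_Cmp[OF lax[OF ab(1)] lax[OF ab(2)]] ab(3)
        in \<open>auto simp: far c[OF ab] p[OF ab(1)]\<close>)
  qed (auto simp: ps Lax_hom lax, auto simp: far)
qed

text \<open>\<open>b\<close> selects between equality (\<open>True\<close>) and the order (\<open>False\<close>); what follows treats both at once.\<close>

definition XR :: "('f, 'u) psh \<Rightarrow> bool \<Rightarrow> nat \<Rightarrow> 'u \<Rightarrow> 'u \<Rightarrow> bool" where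
  "XR H b n x y \<longleftrightarrow> x \<in> pts (ob H n) \<and> y \<in> pts (ob H n) \<and> (if b then x = y else (x, y) \<in> le (ob H n))"

lemma XR_refl: "presheaf \<Sigma> H \<Longrightarrow> x \<in> pts (ob H n) \<Longrightarrow> XR H b n x x"
  by (simp add: XR_def presheaf_refl)

lemma XR_trans: "presheaf \<Sigma> H \<Longrightarrow> XR H b n x y \<Longrightarrow> XR H b n y z \<Longrightarrow> XR H b n x z"
  by (auto simp: XR_def intro: presheaf_trans split: if_splits)

lemma XR_act: "presheaf \<Sigma> H \<Longrightarrow> f \<in> law \<Sigma> n m \<Longrightarrow> XR H b m x y \<Longrightarrow> XR H b n (act H n f x) (act H n f y)"
  by (auto simp: XR_def presheaf_act presheaf_act_le split: if_splits)

lemma XR_weak: "presheaf \<Sigma> H \<Longrightarrow> XR H True n x y \<Longrightarrow> XR H b n x y"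
  by (auto simp: XR_def presheaf_refl)

lemma XR_False: "presheaf \<Sigma> H \<Longrightarrow> XR H False n x y \<longleftrightarrow> (x, y) \<in> le (ob H n)"
  by (auto simp: XR_def dest: presheaf_le_pts)

lemma XR_lax: "lax_inj \<Sigma> \<alpha> \<Longrightarrow> XR (src \<alpha>) b n x y \<Longrightarrow> XR (tgt \<alpha>) b n (cmpt \<alpha> n x) (cmpt \<alpha> n y)"
  by (auto simp: XR_def lax_pts lax_mono split: if_splits)

section \<open>The colimit over injections\<close>

text \<open>A one-step form of the zigzag relation \<open>colim_eq\<close>: a single further
  injection on each side makes the two elements agree.\<close>

definition colim_rel :: "('f, 'e univ) psh \<Rightarrow> nat \<Rightarrow> ('e univ \<times> 'e univ) set" where
  "colim_rel H n = {(Cop m i a, Cop m' i' a') | m i a m' i' a'. i \<in> injs n m \<and> i' \<in> injs n m' \<and>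
     a \<in> pts (ob H m) \<and> a' \<in> pts (ob H m') \<and>
     (\<exists>N. \<exists>u\<in>injs m N. \<exists>u'\<in>injs m' N. inj_comp u i = inj_comp u' i' \<and> act H N (J u) a = act H N (J u') a')}"

text \<open>The two cospans share their middle element; amalgamating the injections out of it leaves
  one cospan.\<close>

lemma colim_rel_trans:
  assumes H: "presheaf \<Sigma> H"
  shows "trans (colim_rel H n)"
proof (rule transI)
  fix x y z assume "(x, y) \<in> colim_rel H n" "(y, z) \<in> colim_rel H n"
  then obtain m i a m' i' a' m'' i'' a'' N u u' N' v v' where *: "x = Cop m i a" "y = Cop m' i' a'" "z = Cop m'' i'' a''"
    "i \<in> injs n m" "i' \<in> injs n m'" "i'' \<in> injs n m''"
    "a \<in> pts (ob H m)" "a' \<in> pts (ob H m')" "a'' \<in> pts (ob H m'')"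
    "u \<in> injs m N" "u' \<in> injs m' N" "inj_comp u i = inj_comp u' i'" "act H N (J u) a = act H N (J u') a'"
    "v \<in> injs m' N'" "v' \<in> injs m'' N'" "inj_comp v i' = inj_comp v' i''" "act H N' (J v) a' = act H N' (J v') a''"
    unfolding colim_rel_def by blast
  obtain M w w' where w: "w \<in> injs N M" "w' \<in> injs N' M" "inj_comp w u' = inj_comp w' v"
    using injs_amalgamate[OF *(11) *(14)] .
  have 1: "inj_comp (inj_comp w u) i = inj_comp (inj_comp w' v') i''"
    using inj_comp_assoc[OF *(4) *(10)] inj_comp_assoc[OF *(5) *(11)] inj_comp_assoc[OF *(5) *(14)]
      inj_comp_assoc[OF *(6) *(15)] *(12) *(16) w(3) by metis
  have 2: "act H M (J (inj_comp w u)) a = act H M (J (inj_comp w' v')) a''"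
    using presheaf_J_comp[OF H *(10) w(1) *(7)] presheaf_J_comp[OF H *(11) w(1) *(8)]
      presheaf_J_comp[OF H *(14) w(2) *(8)] presheaf_J_comp[OF H *(15) w(2) *(9)] *(13) *(17) w(3) by metis
  from 1 2 show "(x, z) \<in> colim_rel H n"
    unfolding colim_rel_def using * inj_comp_injs[OF *(10) w(1)] inj_comp_injs[OF *(15) w(2)] by blast
qed

lemma colim_step_rel:
  assumes H: "presheaf \<Sigma> H" and s: "(x, y) \<in> colim_step H n"
  shows "(x, y) \<in> colim_rel H n" "(y, x) \<in> colim_rel H n"
proof -
  obtain m i a m' j where *: "x = Cop m i a" "y = Cop m' (inj_comp j i) (act H m' (J j) a)"
    "i \<in> injs n m" "j \<in> injs m m'" "a \<in> pts (ob H m)"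
    using s by (auto simp: colim_step_def)
  have "inj_comp j i = inj_comp [0..<m'] (inj_comp j i)"
    using inj_id_comp[OF inj_comp_injs[OF *(3,4)]] by simp
  moreover have a: "act H m' (J j) a \<in> pts (ob H m')" using presheaf_act[OF H J_law[OF *(4)] *(5)] .
  then have "act H m' (J j) a = act H m' (J [0..<m']) (act H m' (J j) a)"
    using presheaf_id[OF H] by (simp add: J_upt)
  moreover have "[0..<m'] \<in> injs m' m'" by (simp add: upt_injs)
  ultimately show "(x, y) \<in> colim_rel H n" "(y, x) \<in> colim_rel H n"
    unfolding colim_rel_def mem_Collect_eq
    using * inj_comp_injs[OF *(3,4)] a by metis+
qed

lemma colim_eq_rel:
  assumes H: "presheaf \<Sigma> H" and i: "i \<in> injs n m" "i' \<in> injs n m'" and a: "a \<in> pts (ob H m)" "a' \<in> pts (ob H m')"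
  shows "(Cop m i a, Cop m' i' a') \<in> colim_eq H n \<longleftrightarrow>
    (\<exists>N. \<exists>u\<in>injs m N. \<exists>u'\<in>injs m' N. inj_comp u i = inj_comp u' i' \<and> act H N (J u) a = act H N (J u') a')"
    (is "?L \<longleftrightarrow> ?R")
proof
  assume ?L
  then have "(Cop m i a, Cop m' i' a') \<in> (colim_rel H n)\<^sup>*"
    unfolding colim_eq_def using colim_step_rel[OF H]
    by (elim rtrancl_mono[THEN subsetD, rotated]) auto
  then consider "Cop m i a = Cop m' i' a'" | "(Cop m i a, Cop m' i' a') \<in> colim_rel H n"
    using colim_rel_trans[OF H] by (auto simp: rtrancl_eq_or_trancl trancl_id)
  then show ?R
  proof cases
    \<comment> \<open>The empty zigzag is the cospan of two identities.\<close>
    case 1 then show ?thesis using upt_injs[of m m] by auto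
  next
    case 2 then show ?thesis by (auto simp: colim_rel_def)
  qed
next
  assume ?R
  then obtain N u u' where u: "u \<in> injs m N" "u' \<in> injs m' N" "inj_comp u i = inj_comp u' i'"
    "act H N (J u) a = act H N (J u') a'" by blast
  have "(Cop m i a, Cop N (inj_comp u i) (act H N (J u) a)) \<in> colim_step H n"
    using i a u unfolding colim_step_def by blast
  moreover have "(Cop m' i' a', Cop N (inj_comp u i) (act H N (J u) a)) \<in> colim_step H n"
    using i a u unfolding colim_step_def by blast
  ultimately show ?L
    unfolding colim_eq_def by (meson UnCI converseI converse_rtrancl_into_rtrancl r_into_rtrancl)
qed

text \<open>Related elements are related to the same elements, so the choice operator is applied to
  one and the same predicate.\<close>

lemma cls_eq_iff: "cls H n x = cls H n y \<longleftrightarrow> (x, y) \<in> colim_eq H n"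
proof
  have s: "sym (colim_eq H n)" and t: "trans (colim_eq H n)"
    unfolding colim_eq_def by (auto intro: sym_rtrancl sym_Un_converse trans_rtrancl)
  have c: "(x, cls H n x) \<in> colim_eq H n" for x
    unfolding cls_def by (rule someI[of _ x]) (simp add: colim_eq_def)
  show "(x, y) \<in> colim_eq H n" if "cls H n x = cls H n y"
    using c[of x] c[of y] that s t by (metis symD transD)
  show "cls H n x = cls H n y" if "(x, y) \<in> colim_eq H n"
  proof -
    have "(x, z) \<in> colim_eq H n \<longleftrightarrow> (y, z) \<in> colim_eq H n" for z
      using that s t by (meson symD transD)
    then show ?thesis by (simp add: cls_def)
  qed
qed

lemma cls_Cop_eq:
  assumes "presheaf \<Sigma> H" "i \<in> injs n m" "i' \<in> injs n m'" "a \<in> pts (ob H m)" "a' \<in> pts (ob H m')"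
  shows "cls H n (Cop m i a) = cls H n (Cop m' i' a') \<longleftrightarrow>
    (\<exists>N. \<exists>u\<in>injs m N. \<exists>u'\<in>injs m' N. inj_comp u i = inj_comp u' i' \<and> act H N (J u) a = act H N (J u') a')"
  unfolding cls_eq_iff by (rule colim_eq_rel[OF assms])

lemma cls_step:
  assumes "presheaf \<Sigma> H" "i \<in> injs n m" "u \<in> injs m N" "a \<in> pts (ob H m)"
  shows "cls H n (Cop m i a) = cls H n (Cop N (inj_comp u i) (act H N (J u) a))"
proof -
  have "(Cop m i a, Cop N (inj_comp u i) (act H N (J u) a)) \<in> colim_step H n"
    using assms unfolding colim_step_def by blast
  then show ?thesis unfolding cls_eq_iff colim_eq_def by blast
qed

text \<open>A pair \<open>(k, a)\<close> with \<open>a \<in> H(n + k)\<close> presents the element \<open>inc H n (k, a)\<close> of \<open>\<integral>H(n)\<close>.\<close>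

definition inc :: "('f, 'e univ) psh \<Rightarrow> nat \<Rightarrow> nat \<times> 'e univ \<Rightarrow> 'e univ" where
  "inc H n p = incl H n (n + fst p) (snd p)"

definition valid :: "('f, 'u) psh \<Rightarrow> nat \<Rightarrow> nat \<times> 'u \<Rightarrow> bool" where
  "valid H n p \<longleftrightarrow> snd p \<in> pts (ob H (n + fst p))"

text \<open>The lifting of a relation to the colimit, on presentations: \<open>p\<close> and
  \<open>q\<close> are compared after their added variables have been injected into common ones. The
  action \<open>A\<close> is a parameter because trees, which form a presheaf only after a quotient,
  are compared in the same way.\<close>

definition IR :: "(nat \<Rightarrow> 'f trm list \<Rightarrow> 'a \<Rightarrow> 'a) \<Rightarrow> (nat \<Rightarrow> 'a \<Rightarrow> 'a \<Rightarrow> bool) \<Rightarrow> nat \<Rightarrow> nat \<times> 'a \<Rightarrow> nat \<times> 'a \<Rightarrow> bool" where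
  "IR A Q n p q \<longleftrightarrow> (\<exists>K. \<exists>w\<in>injs (fst p) K. \<exists>w'\<in>injs (fst q) K.
     Q (n + K) (A (n + K) (J (shift n w)) (snd p)) (A (n + K) (J (shift n w')) (snd q)))"

text \<open>What \<integral> does to a map \<open>f\<close>, seen on presentations: the added
  variables are left alone.\<close>

definition papp :: "(nat \<Rightarrow> 'f trm list \<Rightarrow> 'a \<Rightarrow> 'a) \<Rightarrow> nat \<Rightarrow> 'f trm list \<Rightarrow> nat \<times> 'a \<Rightarrow> nat \<times> 'a" where
  "papp A n f p = (fst p, A (n + fst p) (law_plus n (fst p) f) (snd p))"

definition pmap :: "(nat \<Rightarrow> 'a \<Rightarrow> 'b) \<Rightarrow> nat \<Rightarrow> nat \<times> 'a \<Rightarrow> nat \<times> 'b" where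
  "pmap g n p = (fst p, g (n + fst p) (snd p))"

lemma fst_papp [simp]: "fst (papp A n f p) = fst p" and fst_pmap [simp]: "fst (pmap g n p) = fst p"
  by (auto simp: papp_def pmap_def)

lemma IR_mono: "IR A Q n p q \<Longrightarrow> (\<And>m x y. Q m x y \<Longrightarrow> Q' m x y) \<Longrightarrow> IR A Q' n p q"
  unfolding IR_def by blast

lemma valid_papp: "presheaf \<Sigma> H \<Longrightarrow> f \<in> law \<Sigma> n m \<Longrightarrow> valid H m p \<Longrightarrow> valid H n (papp (act H) n f p)"
  by (simp add: valid_def papp_def presheaf_act[OF _ law_plus_law])

lemma valid_pmap: "lax_inj \<Sigma> \<alpha> \<Longrightarrow> valid (src \<alpha>) n p \<Longrightarrow> valid (tgt \<alpha>) n (pmap (cmpt \<alpha>) n p)"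
  by (simp add: valid_def pmap_def lax_pts)

text \<open>A permutation \<open>s\<close> straightens the index \<open>i\<close> to an inclusion.
  It does not depend on \<open>a\<close>, so two comparable elements of one summand are presented
  over the same \<open>k\<close>.\<close>

lemma cls_inc:
  assumes H: "presheaf \<Sigma> H" and i: "i \<in> injs n m"
  obtains k s where "m = n + k" "s \<in> injs m m"
    "\<And>a. a \<in> pts (ob H m) \<Longrightarrow> cls H n (Cop m i a) = inc H n (k, act H m (J s) a) \<and> valid H n (k, act H m (J s) a)"
proof -
  obtain s where s: "s \<in> injs m m" "inj_comp s i = [0..<n]" using injs_normalize[OF i] by metis
  have m: "m = n + (m - n)" using injs_le[OF i] by simp
  show thesis
    by (rule that[OF m s(1)]) (use cls_step[OF H i s(1)] m s(2) presheaf_act[OF H J_law[OF s(1)]]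
      in \<open>auto simp: inc_def incl_def valid_def\<close>)
qed

lemma Int_pts: "presheaf \<Sigma> H \<Longrightarrow> pts (Int_ob H n) = inc H n ` {p. valid H n p}"
proof (intro set_eqI iffI)
  fix x assume H: "presheaf \<Sigma> H" and "x \<in> pts (Int_ob H n)"
  then obtain m i a where *: "x = cls H n (Cop m i a)" "i \<in> injs n m" "a \<in> pts (ob H m)"
    by (auto simp: Int_ob_def)
  from cls_inc[OF H *(2)] *(3) show "x \<in> inc H n ` {p. valid H n p}" unfolding *(1) by blast
next
  fix x assume "x \<in> inc H n ` {p. valid H n p}"
  then show "x \<in> pts (Int_ob H n)" using upt_injs[of n] by (fastforce simp: Int_ob_def inc_def incl_def valid_def)
qed

lemma inc_eq:
  assumes H: "presheaf \<Sigma> H" and p: "valid H n p" and q: "valid H n q"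
  shows "inc H n p = inc H n q \<longleftrightarrow> IR (act H) (XR H True) n p q"
proof
  have i: "[0..<n] \<in> injs n (n + k)" for k by (simp add: upt_injs)
  note eq = cls_Cop_eq[OF H i i p[unfolded valid_def] q[unfolded valid_def], folded incl_def, folded inc_def]
  show "IR (act H) (XR H True) n p q" if e: "inc H n p = inc H n q"
  proof -
    obtain N u u' where u: "u \<in> injs (n + fst p) N" "u' \<in> injs (n + fst q) N"
      "inj_comp u [0..<n] = inj_comp u' [0..<n]" "act H N (J u) (snd p) = act H N (J u') (snd q)"
      using e[unfolded eq] by blast
    \<comment> \<open>The common composite need not be the inclusion; a permutation \<open>s\<close>
      makes it so, after which both legs fix the first \<open>n\<close> numbers and are
      shifts.\<close>
    have ui: "inj_comp u [0..<n] \<in> injs n N" using inj_comp_injs[OF i u(1)] .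
    obtain s where s: "s \<in> injs N N" "inj_comp s (inj_comp u [0..<n]) = [0..<n]"
      using injs_normalize[OF ui] by metis
    have su: "inj_comp s u \<in> injs (n + fst p) N" "inj_comp s u' \<in> injs (n + fst q) N"
      using inj_comp_injs u s by blast+
    have sn: "inj_comp (inj_comp s u) [0..<n] = [0..<n]" "inj_comp (inj_comp s u') [0..<n] = [0..<n]"
      using inj_comp_assoc[OF i u(1)] inj_comp_assoc[OF i u(2)] s u(3) by auto
    obtain K w where w: "N = n + K" "w \<in> injs (fst p) K" "inj_comp s u = shift n w"
      using injs_shift[OF su(1) sn(1)] .
    obtain K' w' where w': "N = n + K'" "w' \<in> injs (fst q) K'" "inj_comp s u' = shift n w'"
      using injs_shift[OF su(2) sn(2)] .
    have "act H N (J (inj_comp s u)) (snd p) = act H N (J (inj_comp s u')) (snd q)"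
      using presheaf_J_comp[OF H u(1) s(1), of "snd p"] presheaf_J_comp[OF H u(2) s(1), of "snd q"] p q u(4)
      by (simp add: valid_def)
    moreover have "act H N (J (inj_comp s u)) (snd p) \<in> pts (ob H N)"
      using presheaf_act[OF H J_law[OF su(1)]] p by (simp add: valid_def)
    moreover have "K' = K" using w(1) w'(1) by simp
    ultimately show ?thesis unfolding IR_def XR_def using w w' by (metis (no_types, lifting))
  qed
  show "inc H n p = inc H n q" if "IR (act H) (XR H True) n p q"
    unfolding eq using that shift_incl shift_injs unfolding IR_def XR_def by (metis (no_types, lifting))
qed

lemma IR_XR_refl: "presheaf \<Sigma> H \<Longrightarrow> valid H n p \<Longrightarrow> IR (act H) (XR H b) n p p"
  unfolding IR_def using upt_injs[of "fst p" "fst p"] by (force simp: shift_upt J_upt presheaf_id valid_def XR_refl)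

text \<open>Transitivity rests on the amalgamation of injections.\<close>

lemma IR_trans:
  assumes p: "IR A Q n p q" and q: "IR A Q' n q r"
    and Q: "\<And>x y z N. Q N x y \<Longrightarrow> Q' N y z \<Longrightarrow> Q'' N x z"
    and A: "\<And>x y N M i. i \<in> injs N M \<Longrightarrow> Q N x y \<Longrightarrow> Q M (A M (J i) x) (A M (J i) y)"
      "\<And>x y N M i. i \<in> injs N M \<Longrightarrow> Q' N x y \<Longrightarrow> Q' M (A M (J i) x) (A M (J i) y)"
    and comp: "\<And>i j N M s. s \<in> {p, q, r} \<Longrightarrow> i \<in> injs (n + fst s) N \<Longrightarrow> j \<in> injs N M \<Longrightarrow>
      A M (J j) (A N (J i) (snd s)) = A M (J (inj_comp j i)) (snd s)"
  shows "IR A Q'' n p r"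
proof -
  obtain K w w' where w: "w \<in> injs (fst p) K" "w' \<in> injs (fst q) K"
    "Q (n + K) (A (n + K) (J (shift n w)) (snd p)) (A (n + K) (J (shift n w')) (snd q))"
    using p unfolding IR_def by blast
  obtain L v v' where v: "v \<in> injs (fst q) L" "v' \<in> injs (fst r) L"
    "Q' (n + L) (A (n + L) (J (shift n v)) (snd q)) (A (n + L) (J (shift n v')) (snd r))"
    using q unfolding IR_def by blast
  obtain M z z' where z: "z \<in> injs K M" "z' \<in> injs L M" "inj_comp z w' = inj_comp z' v"
    using injs_amalgamate[OF w(2) v(1)] .
  have "Q (n + M) (A (n + M) (J (shift n (inj_comp z w))) (snd p)) (A (n + M) (J (shift n (inj_comp z w'))) (snd q))"
    using A(1)[OF shift_injs[OF z(1)] w(3)] comp[OF _ shift_injs[OF w(1)] shift_injs[OF z(1)]]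
      comp[OF _ shift_injs[OF w(2)] shift_injs[OF z(1)]] shift_comp[OF w(1) z(1)] shift_comp[OF w(2) z(1)] by simp
  moreover have "Q' (n + M) (A (n + M) (J (shift n (inj_comp z' v))) (snd q)) (A (n + M) (J (shift n (inj_comp z' v'))) (snd r))"
    using A(2)[OF shift_injs[OF z(2)] v(3)] comp[OF _ shift_injs[OF v(1)] shift_injs[OF z(2)]]
      comp[OF _ shift_injs[OF v(2)] shift_injs[OF z(2)]] shift_comp[OF v(1) z(2)] shift_comp[OF v(2) z(2)] by simp
  ultimately have "Q'' (n + M) (A (n + M) (J (shift n (inj_comp z w))) (snd p)) (A (n + M) (J (shift n (inj_comp z' v'))) (snd r))"
    using Q z(3) by metis
  then show ?thesis unfolding IR_def using inj_comp_injs[OF w(1) z(1)] inj_comp_injs[OF v(2) z(2)] by blast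
qed

lemma IR_XR_trans:
  assumes "presheaf \<Sigma> H" "valid H n p" "valid H n q" "valid H n r"
    "IR (act H) (XR H b) n p q" "IR (act H) (XR H b) n q r"
  shows "IR (act H) (XR H b) n p r"
  using assms(5,6)
proof (rule IR_trans)
  show "XR H b N x z" if "XR H b N x y" "XR H b N y z" for x y z N using XR_trans[OF assms(1) that] .
  show "XR H b M (act H M (J i) x) (act H M (J i) y)" "XR H b M (act H M (J i) x) (act H M (J i) y)"
    if "i \<in> injs N M" "XR H b N x y" for i N M x y
    using XR_act[OF assms(1) J_law that(2)] that(1) by auto
  show "act H M (J j) (act H N (J i) (snd s)) = act H M (J (inj_comp j i)) (snd s)"
    if "s \<in> {p, q, r}" "i \<in> injs (n + fst s) N" "j \<in> injs N M" for s i j N M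
    using presheaf_J_comp[OF assms(1) that(2,3)] that(1) assms(2-4) by (auto simp: valid_def)
qed

text \<open>The order of the colimit is generated by pairs inside one summand. \<open>gen\<close>
  restates one generating step on presentations, and transitivity of \<open>IR\<close> absorbs the
  transitive closure.\<close>

lemma inc_le:
  assumes H: "presheaf \<Sigma> H" and p: "valid H n p" and q: "valid H n q"
  shows "(inc H n p, inc H n q) \<in> le (Int_ob H n) \<longleftrightarrow> IR (act H) (XR H False) n p q"
proof
  let ?G = "{(cls H n (Cop m i a), cls H n (Cop m i b)) | m i a b. i \<in> injs n m \<and> (a, b) \<in> le (ob H m)}"
  have le: "le (Int_ob H n) = ?G\<^sup>+" by (simp add: Int_ob_def)
  have gen: "\<exists>q. valid H n q \<and> z = inc H n q \<and> IR (act H) (XR H False) n p q"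
    if yz: "(inc H n p, z) \<in> ?G" and p: "valid H n p" for p z
  proof -
    obtain m i a b where *: "inc H n p = cls H n (Cop m i a)" "z = cls H n (Cop m i b)" "i \<in> injs n m" "(a, b) \<in> le (ob H m)"
      using yz by blast
    have ab: "a \<in> pts (ob H m)" "b \<in> pts (ob H m)" using presheaf_le_pts[OF H *(4)] by auto
    obtain k s where s: "m = n + k" "s \<in> injs m m"
      "\<And>a. a \<in> pts (ob H m) \<Longrightarrow> cls H n (Cop m i a) = inc H n (k, act H m (J s) a) \<and> valid H n (k, act H m (J s) a)"
      by (rule cls_inc[OF H *(3)]) blast
    let ?a = "(k, act H m (J s) a)" and ?b = "(k, act H m (J s) b)"
    have "XR H False (n + k) (snd ?a) (snd ?b)"
      using presheaf_act_le[OF H J_law[OF s(2)] *(4)] s(1) by (simp add: XR_False[OF H])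
    then have ab': "IR (act H) (XR H False) n ?a ?b"
      unfolding IR_def using upt_injs[of k k] presheaf_act[OF H J_law[OF s(2)]] ab s(1)
      by (intro exI[of _ k] bexI[of _ "[0..<k]"]) (auto simp: shift_upt J_upt presheaf_id[OF H])
    have "IR (act H) (XR H True) n p ?a" using inc_eq[OF H p, of ?a] s(3)[OF ab(1)] *(1) by auto
    then have "IR (act H) (XR H False) n p ?a" by (rule IR_mono) (rule XR_weak[OF H])
    then show ?thesis
      using IR_XR_trans[OF H p _ _ _ ab'] s(3)[OF ab(1)] s(3)[OF ab(2)] *(2) by blast
  qed
  have "\<exists>q. valid H n q \<and> y = inc H n q \<and> IR (act H) (XR H False) n p q"
    if "(inc H n p, y) \<in> ?G\<^sup>+" "valid H n p" for p y using that
  proof (induction rule: trancl_induct)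
    case (base y)
    then show ?case using gen by blast
  next
    case (step y z)
    then obtain q where q: "valid H n q" "y = inc H n q" "IR (act H) (XR H False) n p q" by blast
    then obtain r where "valid H n r" "z = inc H n r" "IR (act H) (XR H False) n q r"
      using gen[of q z] step.hyps(2) by blast
    then show ?case using IR_XR_trans[OF H step.prems q(1) _ q(3)] by blast
  qed
  note ind = this
  show "IR (act H) (XR H False) n p q" if pq: "(inc H n p, inc H n q) \<in> le (Int_ob H n)"
  proof -
    \<comment> \<open>The induction ends in the right element but possibly with another presentation
      \<open>q'\<close> of it; equality of the two, weakened to the order, bridges the gap.\<close>
    obtain q' where q': "valid H n q'" "inc H n q = inc H n q'" "IR (act H) (XR H False) n p q'"
      using ind[OF pq[unfolded le] p] by blast
    have "IR (act H) (XR H True) n q' q" using inc_eq[OF H q'(1) q] q'(2) by simp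
    then have "IR (act H) (XR H False) n q' q" by (rule IR_mono) (rule XR_weak[OF H])
    with q' show ?thesis using IR_XR_trans[OF H p q'(1) q] by blast
  qed
  show "(inc H n p, inc H n q) \<in> le (Int_ob H n)" if "IR (act H) (XR H False) n p q"
  proof -
    obtain K w w' where w: "w \<in> injs (fst p) K" "w' \<in> injs (fst q) K"
      "(act H (n + K) (J (shift n w)) (snd p), act H (n + K) (J (shift n w')) (snd q)) \<in> le (ob H (n + K))"
      using \<open>IR _ _ _ _ _\<close> unfolding IR_def XR_False[OF H] by blast
    have i: "[0..<n] \<in> injs n (n + k)" for k by (simp add: upt_injs)
    have "inc H n p = cls H n (Cop (n + K) [0..<n] (act H (n + K) (J (shift n w)) (snd p)))"
      "inc H n q = cls H n (Cop (n + K) [0..<n] (act H (n + K) (J (shift n w')) (snd q)))"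
      using cls_step[OF H i shift_injs[OF w(1)]] cls_step[OF H i shift_injs[OF w(2)]] p q
      by (auto simp: inc_def incl_def valid_def shift_incl)
    then have "(inc H n p, inc H n q) \<in> ?G" using w(3) i by blast
    then show ?thesis unfolding le by blast
  qed
qed

lemma Int_le_ex: "presheaf \<Sigma> H \<Longrightarrow> (x, y) \<in> le (Int_ob H n) \<Longrightarrow> x \<in> pts (Int_ob H n) \<and> y \<in> pts (Int_ob H n)"
proof -
  assume H: "presheaf \<Sigma> H" and xy: "(x, y) \<in> le (Int_ob H n)"
  have "{(cls H n (Cop m i a), cls H n (Cop m i b)) | m i a b. i \<in> injs n m \<and> (a, b) \<in> le (ob H m)}
      \<subseteq> pts (Int_ob H n) \<times> pts (Int_ob H n)"
    using presheaf_le_pts[OF H] by (fastforce simp: Int_ob_def)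
  from trancl_subset_Sigma[OF this] xy show ?thesis by (auto simp: Int_ob_def)
qed

lemma IR_papp:
  assumes "presheaf \<Sigma> H" "f \<in> law \<Sigma> n m" "valid H m p" "valid H m q" "IR (act H) (XR H b) m p q"
  shows "IR (act H) (XR H b) n (papp (act H) n f p) (papp (act H) n f q)"
proof -
  obtain K w w' where w: "w \<in> injs (fst p) K" "w' \<in> injs (fst q) K"
    "XR H b (m + K) (act H (m + K) (J (shift m w)) (snd p)) (act H (m + K) (J (shift m w')) (snd q))"
    using assms(5) unfolding IR_def by blast
  show ?thesis unfolding IR_def
    using XR_act[OF assms(1) law_plus_law[OF assms(2)] w(3)] w(1,2)
      presheaf_exchange[OF assms(1,2) w(1)] presheaf_exchange[OF assms(1,2) w(2)] assms(3,4)
    by (intro exI[of _ K] bexI[of _ w] bexI[of _ w']) (auto simp: papp_def valid_def)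
qed

text \<open>\<open>Int_act\<close> is a definite description over all presentations; that the result
  does not depend on the presentation is \<open>IR_papp\<close> for equality.\<close>

lemma Int_act_inc:
  assumes H: "presheaf \<Sigma> H" and f: "f \<in> law \<Sigma> n m" and p: "valid H m p"
  shows "Int_act H n f (inc H m p) = inc H n (papp (act H) n f p)"
  unfolding Int_act_def law_length[OF f]
proof (rule the_equality)
  show "\<exists>k. \<exists>a\<in>pts (ob H (m + k)). inc H m p = incl H m (m + k) a \<and>
      inc H n (papp (act H) n f p) = incl H n (n + k) (act H (n + k) (law_plus n k f) a)"
    using p by (intro exI[of _ "fst p"] bexI[of _ "snd p"]) (auto simp: inc_def papp_def valid_def)
next
  fix d assume "\<exists>k. \<exists>a\<in>pts (ob H (m + k)). inc H m p = incl H m (m + k) a \<and>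
      d = incl H n (n + k) (act H (n + k) (law_plus n k f) a)"
  then obtain k a where a: "valid H m (k, a)" "inc H m (k, a) = inc H m p" "d = inc H n (papp (act H) n f (k, a))"
    by (auto simp: inc_def papp_def valid_def)
  then show "d = inc H n (papp (act H) n f p)"
    using IR_papp[OF H f a(1) p, of True] inc_eq[OF H a(1) p]
      inc_eq[OF H valid_papp[OF H f a(1)] valid_papp[OF H f p]] by simp
qed

text \<open>Independence of the presentation rests on strict naturality for injections; laxness
  alone would only yield inequalities.\<close>

lemma Int_map_inc:
  assumes \<alpha>: "lax_inj \<Sigma> \<alpha>" and p: "valid (src \<alpha>) n p"
  shows "Int_map \<alpha> n (inc (src \<alpha>) n p) = inc (tgt \<alpha>) n (pmap (cmpt \<alpha>) n p)"
  unfolding Int_map_def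
proof (rule the_equality)
  show "\<exists>m. \<exists>i\<in>injs n m. \<exists>a\<in>pts (ob (src \<alpha>) m). inc (src \<alpha>) n p = cls (src \<alpha>) n (Cop m i a) \<and>
      inc (tgt \<alpha>) n (pmap (cmpt \<alpha>) n p) = cls (tgt \<alpha>) n (Cop m i (cmpt \<alpha> m a))"
    using p upt_injs[of n] by (intro exI[of _ "n + fst p"] bexI[of _ "[0..<n]"] bexI[of _ "snd p"])
      (auto simp: inc_def incl_def pmap_def valid_def)
next
  fix d assume "\<exists>m. \<exists>i\<in>injs n m. \<exists>a\<in>pts (ob (src \<alpha>) m). inc (src \<alpha>) n p = cls (src \<alpha>) n (Cop m i a) \<and>
      d = cls (tgt \<alpha>) n (Cop m i (cmpt \<alpha> m a))"
  then obtain m i a where a: "i \<in> injs n m" "a \<in> pts (ob (src \<alpha>) m)"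
    "cls (src \<alpha>) n (Cop m i a) = inc (src \<alpha>) n p" "d = cls (tgt \<alpha>) n (Cop m i (cmpt \<alpha> m a))" by auto
  have i: "[0..<n] \<in> injs n (n + fst p)" by (simp add: upt_injs)
  have p': "snd p \<in> pts (ob (src \<alpha>) (n + fst p))" using p by (simp add: valid_def)
  obtain N u u' where u: "u \<in> injs m N" "u' \<in> injs (n + fst p) N" "inj_comp u i = inj_comp u' [0..<n]"
    "act (src \<alpha>) N (J u) a = act (src \<alpha>) N (J u') (snd p)"
    using a(3) cls_Cop_eq[OF lax_src[OF \<alpha>] a(1) i a(2) p'] unfolding inc_def incl_def by auto
  have "act (tgt \<alpha>) N (J u) (cmpt \<alpha> m a) = act (tgt \<alpha>) N (J u') (cmpt \<alpha> (n + fst p) (snd p))"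
    using lax_strict[OF \<alpha> u(1) a(2)] lax_strict[OF \<alpha> u(2) p'] u(4) by simp
  then show "d = inc (tgt \<alpha>) n (pmap (cmpt \<alpha>) n p)"
    unfolding a(4) inc_def incl_def fst_pmap
    using cls_Cop_eq[OF lax_tgt[OF \<alpha>] a(1) i lax_pts[OF \<alpha> a(2)] lax_pts[OF \<alpha> p']] u(1-3)
    unfolding pmap_def by auto
qed

lemma Int_simps [simp]: "ob (Int_psh \<Sigma> H) = Int_ob H" "fob (IntF \<Sigma>) H = Int_psh \<Sigma> H"
  by (auto simp: Int_psh_def IntF_def)

lemma XR_inc:
  assumes "presheaf \<Sigma> H" "valid H n p" "valid H n q"
  shows "XR (Int_psh \<Sigma> H) b n (inc H n p) (inc H n q) \<longleftrightarrow> IR (act H) (XR H b) n p q"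
  using inc_eq[OF assms] inc_le[OF assms] assms(2,3) unfolding XR_def[of "Int_psh \<Sigma> H"]
  by (cases b) (auto simp: Int_pts[OF assms(1)])

lemma act_inc:
  assumes "presheaf \<Sigma> H" "f \<in> law \<Sigma> n m" "valid H m p"
  shows "act (Int_psh \<Sigma> H) n f (inc H m p) = inc H n (papp (act H) n f p)"
  using Int_act_inc[OF assms] assms(3)
  by (simp add: Int_psh_def act_on_eq[OF assms(2)] Int_pts[OF assms(1)])

lemma papp_id: "presheaf \<Sigma> H \<Longrightarrow> valid H n p \<Longrightarrow> papp (act H) n (law_id n) p = p"
  by (simp add: papp_def law_plus_id presheaf_id valid_def)

lemma papp_comp: "presheaf \<Sigma> H \<Longrightarrow> f \<in> law \<Sigma> n m \<Longrightarrow> g \<in> law \<Sigma> m k \<Longrightarrow> valid H k p \<Longrightarrow>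
    papp (act H) n (law_comp g f) p = papp (act H) n f (papp (act H) m g p)"
  by (simp add: papp_def valid_def law_plus_comp presheaf_comp[OF _ law_plus_law law_plus_law])

lemma Int_presheaf:
  assumes H: "presheaf \<Sigma> H"
  shows "presheaf \<Sigma> (Int_psh \<Sigma> H)"
  unfolding Int_psh_def
proof (rule presheafI)
  fix n x y z assume xy: "(x, y) \<in> le (Int_ob H n)"
  then show xyp: "x \<in> pts (Int_ob H n) \<and> y \<in> pts (Int_ob H n)" by (rule Int_le_ex[OF H])
  assume "(y, z) \<in> le (Int_ob H n)"
  then show "(x, z) \<in> le (Int_ob H n)" using xy by (simp add: Int_ob_def)
next
  fix n m f x assume f: "f \<in> law \<Sigma> n m" and "x \<in> pts (Int_ob H m)"
  then obtain p where p: "valid H m p" "x = inc H m p" by (auto simp: Int_pts[OF H])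
  then show "Int_act H n f x \<in> pts (Int_ob H n)"
    using Int_act_inc[OF H f p(1)] valid_papp[OF H f p(1)] by (simp add: Int_pts[OF H])
next
  fix n m f x y assume f: "f \<in> law \<Sigma> n m" and xy: "(x, y) \<in> le (Int_ob H m)"
  with Int_le_ex[OF H] obtain p q where p: "valid H m p" "x = inc H m p" "valid H m q" "y = inc H m q"
    by (force simp: Int_pts[OF H])
  show "(Int_act H n f x, Int_act H n f y) \<in> le (Int_ob H n)"
    using xy IR_papp[OF H f p(1,3), of False] inc_le[OF H p(1,3)]
      inc_le[OF H valid_papp[OF H f p(1)] valid_papp[OF H f p(3)]]
    by (simp add: p(2,4) Int_act_inc[OF H f p(1)] Int_act_inc[OF H f p(3)])
next
  fix n x assume "x \<in> pts (Int_ob H n)"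
  then obtain p where p: "valid H n p" "x = inc H n p" by (auto simp: Int_pts[OF H])
  then show "Int_act H n (law_id n) x = x"
    by (simp add: Int_act_inc[OF H law_id_law p(1)] papp_id[OF H])
  show "(x, x) \<in> le (Int_ob H n)"
    using inc_le[OF H p(1) p(1)] IR_XR_refl[OF H p(1)] p(2) by simp
next
  fix n m k f g x assume f: "f \<in> law \<Sigma> n m" and g: "g \<in> law \<Sigma> m k" and "x \<in> pts (Int_ob H k)"
  then obtain p where p: "valid H k p" "x = inc H k p" by (auto simp: Int_pts[OF H])
  then show "Int_act H n (law_comp g f) x = Int_act H n f (Int_act H m g x)"
    using Int_act_inc[OF H law_comp_law[OF f g] p(1)] Int_act_inc[OF H g p(1)]
      Int_act_inc[OF H f valid_papp[OF H g p(1)]] papp_comp[OF H f g p(1)] by simp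
qed

lemma IR_pmap:
  assumes "lax_inj \<Sigma> \<alpha>" "valid (src \<alpha>) n p" "valid (src \<alpha>) n q" "IR (act (src \<alpha>)) (XR (src \<alpha>) b) n p q"
  shows "IR (act (tgt \<alpha>)) (XR (tgt \<alpha>) b) n (pmap (cmpt \<alpha>) n p) (pmap (cmpt \<alpha>) n q)"
proof -
  obtain K w w' where w: "w \<in> injs (fst p) K" "w' \<in> injs (fst q) K"
    "XR (src \<alpha>) b (n + K) (act (src \<alpha>) (n + K) (J (shift n w)) (snd p)) (act (src \<alpha>) (n + K) (J (shift n w')) (snd q))"
    using assms(4) unfolding IR_def by blast
  show ?thesis unfolding IR_def
    using XR_lax[OF assms(1) w(3)] w(1,2) lax_strict[OF assms(1) shift_injs[OF w(1)]]
      lax_strict[OF assms(1) shift_injs[OF w(2)]] assms(2,3)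
    by (intro exI[of _ K] bexI[of _ w] bexI[of _ w']) (auto simp: pmap_def valid_def)
qed

lemma pmap_papp_lax:
  assumes "lax_inj \<Sigma> \<alpha>" "f \<in> law \<Sigma> n m" "valid (src \<alpha>) m p"
  shows "IR (act (tgt \<alpha>)) (XR (tgt \<alpha>) False) n (papp (act (tgt \<alpha>)) n f (pmap (cmpt \<alpha>) m p))
    (pmap (cmpt \<alpha>) n (papp (act (src \<alpha>)) n f p))"
proof -
  let ?k = "fst p"
  have "(snd (papp (act (tgt \<alpha>)) n f (pmap (cmpt \<alpha>) m p)), snd (pmap (cmpt \<alpha>) n (papp (act (src \<alpha>)) n f p)))
    \<in> le (ob (tgt \<alpha>) (n + ?k))"
    using lax_lax[OF assms(1) law_plus_law[OF assms(2)]] assms(3) by (simp add: papp_def pmap_def valid_def)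
  then show ?thesis
    unfolding IR_def using upt_injs[of ?k ?k] presheaf_le_pts[OF lax_tgt[OF assms(1)]]
    by (intro exI[of _ ?k] bexI[of _ "[0..<?k]"])
      (auto simp: shift_upt J_upt presheaf_id[OF lax_tgt[OF assms(1)]] XR_False[OF lax_tgt[OF assms(1)]])
qed

lemma pmap_papp_J:
  assumes "lax_inj \<Sigma> \<alpha>" "i \<in> injs m n" "valid (src \<alpha>) m p"
  shows "papp (act (tgt \<alpha>)) n (J i) (pmap (cmpt \<alpha>) m p) = pmap (cmpt \<alpha>) n (papp (act (src \<alpha>)) n (J i) p)"
  using lax_strict[OF assms(1) injs_plus[OF assms(2)]] assms(3)
  by (simp add: papp_def pmap_def valid_def law_plus_J)

lemma Int_functor: "is_functor (Lax_Inj \<Sigma>) (Lax_Inj \<Sigma>) (IntF \<Sigma>)"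
proof (rule Lax_functorI[where M = Int_map])
  fix \<alpha> :: "('a, 'b univ) lax"
  show "far (IntF \<Sigma>) \<alpha> = mk_lax (fob (IntF \<Sigma>) (src \<alpha>)) (fob (IntF \<Sigma>) (tgt \<alpha>)) (Int_map \<alpha>)"
    by (simp add: IntF_def mk_lax_def Int_psh_def restrict_def)
  assume \<alpha>: "lax_inj \<Sigma> \<alpha>"
  note S = lax_src[OF \<alpha>] and T = lax_tgt[OF \<alpha>]
  {
    fix n x assume "x \<in> pts (ob (fob (IntF \<Sigma>) (src \<alpha>)) n)"
    then obtain p where p: "valid (src \<alpha>) n p" "x = inc (src \<alpha>) n p" by (auto simp: Int_pts[OF S])
    show "Int_map \<alpha> n x \<in> pts (ob (fob (IntF \<Sigma>) (tgt \<alpha>)) n)"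
      using Int_map_inc[OF \<alpha> p(1)] valid_pmap[OF \<alpha> p(1)] by (simp add: p(2) Int_pts[OF T])
    fix \<beta> assume \<beta>: "lax_inj \<Sigma> \<beta>" "src \<beta> = tgt \<alpha>"
    have "Int_map (mk_lax (src \<alpha>) (tgt \<beta>) (\<lambda>n x. cmpt \<beta> n (cmpt \<alpha> n x))) n x =
      inc (tgt \<beta>) n (pmap (cmpt (mk_lax (src \<alpha>) (tgt \<beta>) (\<lambda>n x. cmpt \<beta> n (cmpt \<alpha> n x)))) n p)"
      using Int_map_inc[OF lax_Cmp[OF \<alpha> \<beta>], of n p] p by simp
    also have "\<dots> = inc (tgt \<beta>) n (pmap (cmpt \<beta>) n (pmap (cmpt \<alpha>) n p))"
      using p by (simp add: pmap_def valid_def)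
    also have "\<dots> = Int_map \<beta> n (Int_map \<alpha> n x)"
      using Int_map_inc[OF \<alpha> p(1)] Int_map_inc[OF \<beta>(1), of n "pmap (cmpt \<alpha>) n p"] valid_pmap[OF \<alpha> p(1)]
      by (simp add: p(2) \<beta>(2))
    finally show "Int_map (mk_lax (src \<alpha>) (tgt \<beta>) (\<lambda>n x. cmpt \<beta> n (cmpt \<alpha> n x))) n x = Int_map \<beta> n (Int_map \<alpha> n x)" .
  next
    fix n x y assume xy: "(x, y) \<in> le (ob (fob (IntF \<Sigma>) (src \<alpha>)) n)"
    with Int_le_ex[OF S] obtain p q where p: "valid (src \<alpha>) n p" "x = inc (src \<alpha>) n p" "valid (src \<alpha>) n q" "y = inc (src \<alpha>) n q"
      by (force simp: Int_pts[OF S])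
    show "(Int_map \<alpha> n x, Int_map \<alpha> n y) \<in> le (ob (fob (IntF \<Sigma>) (tgt \<alpha>)) n)"
      using xy IR_pmap[OF \<alpha> p(1,3), of False] inc_le[OF S p(1,3)]
        inc_le[OF T valid_pmap[OF \<alpha> p(1)] valid_pmap[OF \<alpha> p(3)]]
      by (simp add: p(2,4) Int_map_inc[OF \<alpha> p(1)] Int_map_inc[OF \<alpha> p(3)])
  next
    fix n m f x assume f: "f \<in> law \<Sigma> n m" and "x \<in> pts (ob (fob (IntF \<Sigma>) (src \<alpha>)) m)"
    then obtain p where p: "valid (src \<alpha>) m p" "x = inc (src \<alpha>) m p" by (auto simp: Int_pts[OF S])
    show "(act (fob (IntF \<Sigma>) (tgt \<alpha>)) n f (Int_map \<alpha> m x), Int_map \<alpha> n (act (fob (IntF \<Sigma>) (src \<alpha>)) n f x))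
      \<in> le (ob (fob (IntF \<Sigma>) (tgt \<alpha>)) n)"
      using pmap_papp_lax[OF \<alpha> f p(1)] inc_le[OF T valid_papp[OF T f valid_pmap[OF \<alpha> p(1)]] valid_pmap[OF \<alpha> valid_papp[OF S f p(1)]]]
      by (simp add: p(2) Int_map_inc[OF \<alpha> p(1)] act_inc[OF T f valid_pmap[OF \<alpha> p(1)]]
          act_inc[OF S f p(1)] Int_map_inc[OF \<alpha> valid_papp[OF S f p(1)]])
  next
    fix n m i x assume i: "i \<in> injs m n" and "x \<in> pts (ob (fob (IntF \<Sigma>) (src \<alpha>)) m)"
    then obtain p where p: "valid (src \<alpha>) m p" "x = inc (src \<alpha>) m p" by (auto simp: Int_pts[OF S])
    note f = J_law[OF i]
    show "act (fob (IntF \<Sigma>) (tgt \<alpha>)) n (J i) (Int_map \<alpha> m x) = Int_map \<alpha> n (act (fob (IntF \<Sigma>) (src \<alpha>)) n (J i) x)"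
      using pmap_papp_J[OF \<alpha> i p(1)]
      by (simp add: p(2) Int_map_inc[OF \<alpha> p(1)] act_inc[OF T f valid_pmap[OF \<alpha> p(1)]]
          act_inc[OF S f p(1)] Int_map_inc[OF \<alpha> valid_papp[OF S f p(1)]])
  }
next
  fix H :: "('a, 'b univ) psh" and n x
  assume H: "presheaf \<Sigma> H"
  show "presheaf \<Sigma> (fob (IntF \<Sigma>) H)" using Int_presheaf[OF H] by simp
  assume "x \<in> pts (ob (fob (IntF \<Sigma>) H) n)"
  then obtain p where p: "valid H n p" "x = inc H n p" by (auto simp: Int_pts[OF H])
  then show "Int_map (mk_lax H H (\<lambda>n x. x)) n x = x"
    using Int_map_inc[OF lax_Ide[OF H], of n p] by (simp add: pmap_def valid_def)
qed

section \<open>Finite subsets\<close>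

text \<open>Relation lifting for finite subsets: two-sided when \<open>b\<close> holds, as for
  equality of sets, and one-sided otherwise, as in the order of \<open>Pf\<close>.\<close>

definition PR :: "bool \<Rightarrow> ('a \<Rightarrow> 'b \<Rightarrow> bool) \<Rightarrow> 'a set \<Rightarrow> 'b set \<Rightarrow> bool" where
  "PR b Q A B \<longleftrightarrow> (\<forall>x\<in>A. \<exists>y\<in>B. Q x y) \<and> (b \<longrightarrow> (\<forall>y\<in>B. \<exists>x\<in>A. Q x y))"

lemma PR_mono [mono]: "(\<And>x y. Q x y \<longrightarrow> Q' x y) \<Longrightarrow> PR b Q A B \<longrightarrow> PR b Q' A B"
  unfolding PR_def by blast

lemma PR_mono_mem: "PR b Q A B \<Longrightarrow> (\<And>x y. x \<in> A \<Longrightarrow> y \<in> B \<Longrightarrow> Q x y \<Longrightarrow> Q' x y) \<Longrightarrow> PR b Q' A B"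
  unfolding PR_def by blast

lemma PR_cong: "(\<And>x y. x \<in> A \<Longrightarrow> y \<in> B \<Longrightarrow> Q x y \<longleftrightarrow> Q' x y) \<Longrightarrow> PR b Q A B \<longleftrightarrow> PR b Q' A B"
  unfolding PR_def by blast

lemma PR_refl: "(\<And>x. x \<in> A \<Longrightarrow> Q x x) \<Longrightarrow> PR b Q A A"
  unfolding PR_def by blast

lemma PR_sym: "PR True Q A B \<Longrightarrow> (\<And>x y. Q x y \<Longrightarrow> Q' y x) \<Longrightarrow> PR True Q' B A"
  unfolding PR_def by blast

lemma PR_weak: "PR True Q A B \<Longrightarrow> PR b Q A B"
  unfolding PR_def by blast

lemma PR_trans: "PR b Q A B \<Longrightarrow> PR b Q' B C \<Longrightarrow>
  (\<And>x y z. x \<in> A \<Longrightarrow> y \<in> B \<Longrightarrow> z \<in> C \<Longrightarrow> Q x y \<Longrightarrow> Q' y z \<Longrightarrow> Q'' x z) \<Longrightarrow> PR b Q'' A C"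
  unfolding PR_def by (intro conjI impI ballI) (blast+)

lemma PR_image: "PR b Q (f ` A) (g ` B) \<longleftrightarrow> PR b (\<lambda>x y. Q (f x) (g y)) A B"
  unfolding PR_def by auto

lemma fin_fset': "fin (fset B) = Fin B"
  by (simp add: fin_def fset_inverse)

lemma fin_inject: "finite A \<Longrightarrow> finite B \<Longrightarrow> fin A = fin B \<longleftrightarrow> A = B"
  by (auto simp: fin_def Abs_fset_inject)

lemma Pf_pts: "pts (Pf X) = {fin A | A. finite A \<and> A \<subseteq> pts X}"
proof (intro set_eqI iffI)
  fix x assume "x \<in> pts (Pf X)"
  then obtain A where "x = Fin A" "fset A \<subseteq> pts X" by (auto simp: Pf_def)
  then show "x \<in> {fin A | A. finite A \<and> A \<subseteq> pts X}" by (auto simp: fin_fset'[symmetric])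
next
  fix x assume "x \<in> {fin A | A. finite A \<and> A \<subseteq> pts X}"
  then obtain A where A: "x = fin A" "finite A" "A \<subseteq> pts X" by auto
  then show "x \<in> pts (Pf X)" by (auto simp: Pf_def fin_def Abs_fset_inverse)
qed

lemma Pf_le:
  assumes "finite A" "A \<subseteq> pts X" "finite B" "B \<subseteq> pts X"
  shows "(fin A, fin B) \<in> le (Pf X) \<longleftrightarrow> (\<forall>a\<in>A. \<exists>b\<in>B. (a, b) \<in> le X)"
proof -
  obtain A' B' where "fset A' = A" "fset B' = B" using assms(1,3) by (metis Abs_fset_inverse mem_Collect_eq)
  then have "A = fset A'" "B = fset B'" by auto
  then show ?thesis using assms by (auto simp: Pf_def fin_fset')
qed

lemma Pf_le_ex: "(x, y) \<in> le (Pf X) \<Longrightarrow> x \<in> pts (Pf X) \<and> y \<in> pts (Pf X)"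
  by (auto simp: Pf_def)

lemma Pf_map_fin: "finite A \<Longrightarrow> Pf_map g (fin A) = fin (g ` A)"
  by (auto simp: Pf_map_def fin_def fset_inject[symmetric] Abs_fset_inverse)

lemma Pf_simps [simp]: "ob (Pf_psh \<Sigma> H) n = Pf (ob H n)" "fob (PfF \<Sigma>) H = Pf_psh \<Sigma> H"
  by (auto simp: Pf_psh_def PfF_def)

lemma XR_Pf:
  assumes "finite A" "A \<subseteq> pts (ob H n)" "finite B" "B \<subseteq> pts (ob H n)"
  shows "XR (Pf_psh \<Sigma> H) b n (fin A) (fin B) \<longleftrightarrow> PR b (XR H b n) A B"
proof (cases b)
  case True
  have "A = B \<longleftrightarrow> PR True (XR H True n) A B"
    using assms(2,4) unfolding PR_def XR_def by auto
  then show ?thesis using True assms by (auto simp: XR_def[of "Pf_psh \<Sigma> H"] Pf_pts fin_inject)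
next
  case False
  have "(\<forall>a\<in>A. \<exists>b\<in>B. (a, b) \<in> le (ob H n)) \<longleftrightarrow> PR False (XR H False n) A B"
    using assms(2,4) unfolding PR_def XR_def by auto blast
  then show ?thesis using False assms Pf_le[OF assms] by (auto simp: XR_def[of "Pf_psh \<Sigma> H"] Pf_pts)
qed

lemma act_Pf:
  assumes "f \<in> law \<Sigma> n m" "finite A" "A \<subseteq> pts (ob H m)"
  shows "act (Pf_psh \<Sigma> H) n f (fin A) = fin (act H n f ` A)"
proof -
  have "fin A \<in> pts (Pf (ob H m))" using assms(2,3) by (auto simp: Pf_pts)
  then show ?thesis using assms(2) by (simp add: Pf_psh_def act_on_eq[OF assms(1)] Pf_map_fin)
qed

lemma Pf_presheaf:
  assumes H: "presheaf \<Sigma> H"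
  shows "presheaf \<Sigma> (Pf_psh \<Sigma> H)"
  unfolding Pf_psh_def
proof (rule presheafI)
  fix n x y z assume xy: "(x, y) \<in> le (Pf (ob H n))"
  then show "x \<in> pts (Pf (ob H n)) \<and> y \<in> pts (Pf (ob H n))" by (rule Pf_le_ex)
  assume yz: "(y, z) \<in> le (Pf (ob H n))"
  obtain A B C where *: "x = fin A" "finite A" "A \<subseteq> pts (ob H n)" "y = fin B" "finite B" "B \<subseteq> pts (ob H n)"
    "z = fin C" "finite C" "C \<subseteq> pts (ob H n)"
    using Pf_le_ex[OF xy] Pf_le_ex[OF yz] by (auto simp: Pf_pts)
  show "(x, z) \<in> le (Pf (ob H n))"
    using xy yz * by (simp add: Pf_le) (meson presheaf_trans[OF H])
next
  fix n x assume "x \<in> pts (Pf (ob H n))"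
  then obtain A where *: "x = fin A" "finite A" "A \<subseteq> pts (ob H n)" by (auto simp: Pf_pts)
  then show "(x, x) \<in> le (Pf (ob H n))" using presheaf_refl[OF H] by (simp add: Pf_le) blast
  have "act H n (law_id n) ` A = A" using * presheaf_id[OF H] by (force simp: image_iff)
  then show "Pf_map (act H n (law_id n)) x = x" by (simp add: * Pf_map_fin)
next
  fix n m f x assume f: "f \<in> law \<Sigma> n m" and "x \<in> pts (Pf (ob H m))"
  then obtain A where *: "x = fin A" "finite A" "A \<subseteq> pts (ob H m)" by (auto simp: Pf_pts)
  then have "act H n f ` A \<subseteq> pts (ob H n)" using presheaf_act[OF H f] by auto
  then show "Pf_map (act H n f) x \<in> pts (Pf (ob H n))"
    unfolding Pf_pts using * by (auto simp: Pf_map_fin)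
next
  fix n m f x y assume f: "f \<in> law \<Sigma> n m" and xy: "(x, y) \<in> le (Pf (ob H m))"
  then obtain A B where *: "x = fin A" "finite A" "A \<subseteq> pts (ob H m)" "y = fin B" "finite B" "B \<subseteq> pts (ob H m)"
    using Pf_le_ex[OF xy] by (auto simp: Pf_pts)
  then have "act H n f ` A \<subseteq> pts (ob H n)" "act H n f ` B \<subseteq> pts (ob H n)"
    using presheaf_act[OF H f] by auto
  then show "(Pf_map (act H n f) x, Pf_map (act H n f) y) \<in> le (Pf (ob H n))"
    using xy * by (simp add: Pf_map_fin Pf_le) (metis presheaf_act_le[OF H f])
next
  fix n m k f g x assume f: "f \<in> law \<Sigma> n m" and g: "g \<in> law \<Sigma> m k" and "x \<in> pts (Pf (ob H k))"
  then obtain A where *: "x = fin A" "finite A" "A \<subseteq> pts (ob H k)" by (auto simp: Pf_pts)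
  then have "act H n (law_comp g f) ` A = act H n f ` act H m g ` A"
    using presheaf_comp[OF H f g] by (force simp: image_iff)
  then show "Pf_map (act H n (law_comp g f)) x = Pf_map (act H n f) (Pf_map (act H m g) x)"
    by (simp add: * Pf_map_fin)
qed

lemma Pf_functor: "is_functor (Lax_Inj \<Sigma>) (Lax_Inj \<Sigma>) (PfF \<Sigma>)"
proof (rule Lax_functorI[where M = "\<lambda>\<alpha> n. Pf_map (cmpt \<alpha> n)"])
  fix \<alpha> :: "('a, 'b univ) lax"
  show "far (PfF \<Sigma>) \<alpha> = mk_lax (fob (PfF \<Sigma>) (src \<alpha>)) (fob (PfF \<Sigma>) (tgt \<alpha>)) (\<lambda>n. Pf_map (cmpt \<alpha> n))"
    by (simp add: PfF_def mk_lax_def Pf_psh_def restrict_def)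
  assume \<alpha>: "lax_inj \<Sigma> \<alpha>"
  note S = lax_src[OF \<alpha>] and T = lax_tgt[OF \<alpha>]
  have im: "cmpt \<alpha> n ` A \<subseteq> pts (ob (tgt \<alpha>) n)" if "A \<subseteq> pts (ob (src \<alpha>) n)" for n A
    using lax_pts[OF \<alpha>] that by auto
  {
    fix n x assume "x \<in> pts (ob (fob (PfF \<Sigma>) (src \<alpha>)) n)"
    then obtain A where *: "x = fin A" "finite A" "A \<subseteq> pts (ob (src \<alpha>) n)" by (auto simp: Pf_pts)
    then show "Pf_map (cmpt \<alpha> n) x \<in> pts (ob (fob (PfF \<Sigma>) (tgt \<alpha>)) n)"
      using im[OF *(3)] finite_imageI[OF *(2)] by (simp add: Pf_pts Pf_map_fin) blast
    fix \<beta> assume \<beta>: "lax_inj \<Sigma> \<beta>" "src \<beta> = tgt \<alpha>"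
    have "cmpt (mk_lax (src \<alpha>) (tgt \<beta>) (\<lambda>n x. cmpt \<beta> n (cmpt \<alpha> n x))) n ` A = cmpt \<beta> n ` cmpt \<alpha> n ` A"
      using *(3) by (force simp: image_iff)
    then show "Pf_map (cmpt (mk_lax (src \<alpha>) (tgt \<beta>) (\<lambda>n x. cmpt \<beta> n (cmpt \<alpha> n x))) n) x =
      Pf_map (cmpt \<beta> n) (Pf_map (cmpt \<alpha> n) x)"
      by (simp add: * Pf_map_fin)
  next
    fix n x y assume "(x, y) \<in> le (ob (fob (PfF \<Sigma>) (src \<alpha>)) n)"
    then have xy: "(x, y) \<in> le (Pf (ob (src \<alpha>) n))" by simp
    then obtain A B where *: "x = fin A" "finite A" "A \<subseteq> pts (ob (src \<alpha>) n)" "y = fin B" "finite B" "B \<subseteq> pts (ob (src \<alpha>) n)"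
      using Pf_le_ex[OF xy] by (auto simp: Pf_pts)
    then show "(Pf_map (cmpt \<alpha> n) x, Pf_map (cmpt \<alpha> n) y) \<in> le (ob (fob (PfF \<Sigma>) (tgt \<alpha>)) n)"
      using xy im[OF *(3)] im[OF *(6)] by (simp add: Pf_map_fin Pf_le) (metis lax_mono[OF \<alpha>])
  next
    fix n m f x assume f: "f \<in> law \<Sigma> n m" and "x \<in> pts (ob (fob (PfF \<Sigma>) (src \<alpha>)) m)"
    then obtain A where *: "x = fin A" "finite A" "A \<subseteq> pts (ob (src \<alpha>) m)" by (auto simp: Pf_pts)
    have A: "act (src \<alpha>) n f ` A \<subseteq> pts (ob (src \<alpha>) n)" "act (tgt \<alpha>) n f ` cmpt \<alpha> m ` A \<subseteq> pts (ob (tgt \<alpha>) n)"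
      using *(3) presheaf_act[OF S f] presheaf_act[OF T f] lax_pts[OF \<alpha>] by auto
    then show "(act (fob (PfF \<Sigma>) (tgt \<alpha>)) n f (Pf_map (cmpt \<alpha> m) x), Pf_map (cmpt \<alpha> n) (act (fob (PfF \<Sigma>) (src \<alpha>)) n f x))
      \<in> le (ob (fob (PfF \<Sigma>) (tgt \<alpha>)) n)"
      using * im[OF A(1)] im[OF *(3)] by (simp add: Pf_map_fin Pf_le act_Pf[OF f]) (meson lax_lax[OF \<alpha> f] subsetD)
  next
    fix n m i x assume i: "i \<in> injs m n" and "x \<in> pts (ob (fob (PfF \<Sigma>) (src \<alpha>)) m)"
    then obtain A where *: "x = fin A" "finite A" "A \<subseteq> pts (ob (src \<alpha>) m)" by (auto simp: Pf_pts)
    note f = J_law[OF i]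
    have "act (tgt \<alpha>) n (J i) ` cmpt \<alpha> m ` A = cmpt \<alpha> n ` act (src \<alpha>) n (J i) ` A"
      using *(3) lax_strict[OF \<alpha> i] by (force simp: image_iff)
    then show "act (fob (PfF \<Sigma>) (tgt \<alpha>)) n (J i) (Pf_map (cmpt \<alpha> m) x) = Pf_map (cmpt \<alpha> n) (act (fob (PfF \<Sigma>) (src \<alpha>)) n (J i) x)"
      using * im[OF *(3)] by (simp add: Pf_map_fin act_Pf[OF f])
  }
next
  fix H :: "('a, 'b univ) psh" and n x
  assume H: "presheaf \<Sigma> H"
  show "presheaf \<Sigma> (fob (PfF \<Sigma>) H)" using Pf_presheaf[OF H] by simp
  assume "x \<in> pts (ob (fob (PfF \<Sigma>) H) n)"
  then obtain A where *: "x = fin A" "finite A" "A \<subseteq> pts (ob H n)" by (auto simp: Pf_pts)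
  then have "cmpt (mk_lax H H (\<lambda>n x. x)) n ` A = A" by (force simp: image_iff)
  then show "Pf_map (cmpt (mk_lax H H (\<lambda>n x. x)) n) x = x" by (simp add: * Pf_map_fin)
qed

theorem PfPfInt_functor: "is_functor (Lax_Inj \<Sigma>) (Lax_Inj \<Sigma>) (PfPfInt \<Sigma>)"
  unfolding PfPfInt_def by (rule functor_fcomp[OF functor_fcomp[OF Int_functor Pf_functor] Pf_functor])

section \<open>The composite functor, computed on presentations\<close>

definition enc :: "('f, 'e univ) psh \<Rightarrow> nat \<Rightarrow> (nat \<times> 'e univ) set set \<Rightarrow> 'e univ" where
  "enc H n Z = fin ((\<lambda>S. fin (inc H n ` S)) ` Z)"

definition good :: "('f, 'u) psh \<Rightarrow> nat \<Rightarrow> (nat \<times> 'u) set set \<Rightarrow> bool" where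
  "good H n Z \<longleftrightarrow> finite Z \<and> (\<forall>S\<in>Z. finite S \<and> (\<forall>p\<in>S. valid H n p))"

lemma F_ob: "fob (PfPfInt \<Sigma>) H = Pf_psh \<Sigma> (Pf_psh \<Sigma> (Int_psh \<Sigma> H))"
  by (simp add: PfPfInt_def)

lemma F_presheaf: "presheaf \<Sigma> H \<Longrightarrow> presheaf \<Sigma> (fob (PfPfInt \<Sigma>) H)"
  by (simp add: F_ob Pf_presheaf Int_presheaf)

lemma good_inc:
  assumes "presheaf \<Sigma> H" "good H n Z"
  shows "S \<in> Z \<Longrightarrow> finite (inc H n ` S) \<and> inc H n ` S \<subseteq> pts (Int_ob H n)"
    and "finite ((\<lambda>S. fin (inc H n ` S)) ` Z)" "(\<lambda>S. fin (inc H n ` S)) ` Z \<subseteq> pts (Pf (Int_ob H n))"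
proof -
  show *: "finite (inc H n ` S) \<and> inc H n ` S \<subseteq> pts (Int_ob H n)" if "S \<in> Z" for S
    using assms that by (auto simp: good_def Int_pts)
  show "finite ((\<lambda>S. fin (inc H n ` S)) ` Z)" using assms by (simp add: good_def)
  show "(\<lambda>S. fin (inc H n ` S)) ` Z \<subseteq> pts (Pf (Int_ob H n))" using * by (auto simp: Pf_pts)
qed

text \<open>\<open>enc\<close> reaches the whole of the composite, since a presentation can be
  chosen for every element of the finite sets involved. Later arguments can thus work with
  presentations instead of classes.\<close>

lemma F_pts:
  assumes H: "presheaf \<Sigma> H"
  shows "pts (ob (fob (PfPfInt \<Sigma>) H) n) = enc H n ` {Z. good H n Z}"
proof (intro set_eqI iffI)
  fix x assume "x \<in> pts (ob (fob (PfPfInt \<Sigma>) H) n)"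
  then obtain A where A: "x = fin A" "finite A" "A \<subseteq> pts (Pf (Int_ob H n))" by (auto simp: F_ob Pf_pts)
  have "\<exists>S. finite S \<and> (\<forall>p\<in>S. valid H n p) \<and> a = fin (inc H n ` S)" if "a \<in> A" for a
  proof -
    obtain B where B: "a = fin B" "finite B" "B \<subseteq> inc H n ` {p. valid H n p}"
      using subsetD[OF A(3) \<open>a \<in> A\<close>] by (auto simp: Pf_pts Int_pts[OF H])
    then obtain S where "S \<subseteq> {p. valid H n p}" "finite S" "B = inc H n ` S"
      by (meson finite_subset_image)
    then show ?thesis using B(1) by blast
  qed
  then obtain g where g: "\<And>a. a \<in> A \<Longrightarrow> finite (g a) \<and> (\<forall>p\<in>g a. valid H n p) \<and> a = fin (inc H n ` g a)" by metis
  have "(\<lambda>S. fin (inc H n ` S)) ` g ` A = A" using g by (force simp: image_iff)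
  then have "x = enc H n (g ` A)" by (simp add: enc_def A(1))
  moreover have "good H n (g ` A)" using g A(2) by (auto simp: good_def)
  ultimately show "x \<in> enc H n ` {Z. good H n Z}" by blast
next
  fix x assume "x \<in> enc H n ` {Z. good H n Z}"
  then obtain Z where Z: "good H n Z" "x = fin ((\<lambda>S. fin (inc H n ` S)) ` Z)" by (auto simp: enc_def)
  show "x \<in> pts (ob (fob (PfPfInt \<Sigma>) H) n)"
    using good_inc(2,3)[OF H Z(1)] unfolding Z(2) F_ob Pf_simps Int_simps Pf_pts[of "Pf _"] by blast
qed

text \<open>The relation lifting of the composite functor. It turns equalities and inequalities in
  the codomain of a coalgebra into a matching of children, which is the form in which
  \<open>brel\<close> compares trees.\<close>

lemma F_XR:
  assumes H: "presheaf \<Sigma> H" and Z: "good H n Z" "good H n Z'"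
  shows "XR (fob (PfPfInt \<Sigma>) H) b n (enc H n Z) (enc H n Z') \<longleftrightarrow> PR b (PR b (IR (act H) (XR H b) n)) Z Z'"
proof -
  note g = good_inc[OF H Z(1)] and g' = good_inc[OF H Z(2)]
  have "XR (fob (PfPfInt \<Sigma>) H) b n (enc H n Z) (enc H n Z') \<longleftrightarrow>
    PR b (XR (Pf_psh \<Sigma> (Int_psh \<Sigma> H)) b n) ((\<lambda>S. fin (inc H n ` S)) ` Z) ((\<lambda>S. fin (inc H n ` S)) ` Z')"
    unfolding F_ob enc_def by (rule XR_Pf) (use g g' in auto)
  also have "\<dots> \<longleftrightarrow> PR b (\<lambda>S S'. XR (Pf_psh \<Sigma> (Int_psh \<Sigma> H)) b n (fin (inc H n ` S)) (fin (inc H n ` S'))) Z Z'"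
    by (rule PR_image)
  also have "\<dots> \<longleftrightarrow> PR b (PR b (IR (act H) (XR H b) n)) Z Z'"
  proof (rule PR_cong)
    fix S S' assume S: "S \<in> Z" "S' \<in> Z'"
    have "XR (Pf_psh \<Sigma> (Int_psh \<Sigma> H)) b n (fin (inc H n ` S)) (fin (inc H n ` S')) \<longleftrightarrow>
      PR b (XR (Int_psh \<Sigma> H) b n) (inc H n ` S) (inc H n ` S')"
      by (rule XR_Pf) (use g(1)[OF S(1)] g'(1)[OF S(2)] in auto)
    also have "\<dots> \<longleftrightarrow> PR b (IR (act H) (XR H b) n) S S'"
      unfolding PR_image by (rule PR_cong) (use S Z XR_inc[OF H] in \<open>auto simp: good_def\<close>)
    finally show "XR (Pf_psh \<Sigma> (Int_psh \<Sigma> H)) b n (fin (inc H n ` S)) (fin (inc H n ` S')) \<longleftrightarrow>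
      PR b (IR (act H) (XR H b) n) S S'" .
  qed
  finally show ?thesis .
qed

lemma enc_in: "presheaf \<Sigma> H \<Longrightarrow> good H n Z \<Longrightarrow> enc H n Z \<in> pts (ob (fob (PfPfInt \<Sigma>) H) n)"
  by (simp add: F_pts)

lemma enc_eq:
  assumes "presheaf \<Sigma> H" "good H n Z" "good H n Z'"
  shows "enc H n Z = enc H n Z' \<longleftrightarrow> PR True (PR True (IR (act H) (XR H True) n)) Z Z'"
  using F_XR[OF assms, of True] enc_in[OF assms(1,2)] enc_in[OF assms(1,3)] by (simp add: XR_def)

lemma good_papp: "presheaf \<Sigma> H \<Longrightarrow> f \<in> law \<Sigma> n m \<Longrightarrow> good H m Z \<Longrightarrow> good H n ((`) (papp (act H) n f) ` Z)"
  by (auto simp: good_def valid_papp)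

lemma good_pmap: "lax_inj \<Sigma> \<alpha> \<Longrightarrow> good (src \<alpha>) n Z \<Longrightarrow> good (tgt \<alpha>) n ((`) (pmap (cmpt \<alpha>) n) ` Z)"
  by (auto simp: good_def valid_pmap)

lemma enc_image:
  assumes "\<And>S p. S \<in> Z \<Longrightarrow> p \<in> S \<Longrightarrow> g (inc H m p) = inc K n (h p)"
  shows "(\<lambda>S. fin (g ` S)) ` (\<lambda>S. inc H m ` S) ` Z = (\<lambda>S. fin (inc K n ` S)) ` (`) h ` Z"
proof -
  have "g ` inc H m ` S = inc K n ` h ` S" if "S \<in> Z" for S
    using assms[OF that] by (force simp: image_iff)
  then show ?thesis by (auto simp: image_image intro!: image_cong)
qed

lemma F_act:
  assumes H: "presheaf \<Sigma> H" and f: "f \<in> law \<Sigma> n m" and Z: "good H m Z"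
  shows "act (fob (PfPfInt \<Sigma>) H) n f (enc H m Z) = enc H n ((`) (papp (act H) n f) ` Z)"
proof -
  note g = good_inc[OF H Z]
  have "act (Pf_psh \<Sigma> (Int_psh \<Sigma> H)) n f (fin (inc H m ` S)) = fin (act (Int_psh \<Sigma> H) n f ` inc H m ` S)"
    if "S \<in> Z" for S by (rule act_Pf[OF f]) (use g(1)[OF that] in auto)
  then have "act (Pf_psh \<Sigma> (Int_psh \<Sigma> H)) n f ` (\<lambda>S. fin (inc H m ` S)) ` Z =
    (\<lambda>S. fin (act (Int_psh \<Sigma> H) n f ` S)) ` (\<lambda>S. inc H m ` S) ` Z"
    by (simp add: image_image)
  also have "\<dots> = (\<lambda>S. fin (inc H n ` S)) ` (`) (papp (act H) n f) ` Z"
    by (rule enc_image) (use Z act_inc[OF H f] in \<open>auto simp: good_def\<close>)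
  finally show ?thesis
    unfolding F_ob enc_def using act_Pf[OF f, of "(\<lambda>S. fin (inc H m ` S)) ` Z" "Pf_psh \<Sigma> (Int_psh \<Sigma> H)"] g by simp
qed

lemma F_far:
  assumes \<alpha>: "lax_inj \<Sigma> \<alpha>" and Z: "good (src \<alpha>) n Z"
  shows "cmpt (far (PfPfInt \<Sigma>) \<alpha>) n (enc (src \<alpha>) n Z) = enc (tgt \<alpha>) n ((`) (pmap (cmpt \<alpha>) n) ` Z)"
proof -
  note H = lax_src[OF \<alpha>]
  note g = good_inc[OF H Z]
  let ?\<beta> = "far (PfF \<Sigma>) (far (IntF \<Sigma>) \<alpha>)"
  have "cmpt ?\<beta> n (fin (inc (src \<alpha>) n ` S)) = fin (cmpt (far (IntF \<Sigma>) \<alpha>) n ` inc (src \<alpha>) n ` S)" if "S \<in> Z" for S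
    using g(1)[OF that] by (auto simp: PfF_def IntF_def Pf_map_fin Pf_pts)
  then have "cmpt ?\<beta> n ` (\<lambda>S. fin (inc (src \<alpha>) n ` S)) ` Z =
    (\<lambda>S. fin (cmpt (far (IntF \<Sigma>) \<alpha>) n ` S)) ` (\<lambda>S. inc (src \<alpha>) n ` S) ` Z"
    by (simp add: image_image)
  also have "\<dots> = (\<lambda>S. fin (inc (tgt \<alpha>) n ` S)) ` (`) (pmap (cmpt \<alpha>) n) ` Z"
    by (rule enc_image) (use Z Int_map_inc[OF \<alpha>] in \<open>auto simp: good_def IntF_def Int_pts[OF H]\<close>)
  finally have "cmpt ?\<beta> n ` (\<lambda>S. fin (inc (src \<alpha>) n ` S)) ` Z = (\<lambda>S. fin (inc (tgt \<alpha>) n ` S)) ` (`) (pmap (cmpt \<alpha>) n) ` Z" .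
  moreover have "cmpt (far (PfPfInt \<Sigma>) \<alpha>) n (enc (src \<alpha>) n Z) = Pf_map (cmpt ?\<beta> n) (enc (src \<alpha>) n Z)"
    using enc_in[OF H Z] by (simp add: F_ob PfPfInt_def PfF_def IntF_def)
  ultimately show ?thesis using g(2) by (simp add: enc_def Pf_map_fin)
qed

section \<open>Trees\<close>

text \<open>The number at a child counts its added variables. Children are lists rather than finite
  sets so that each node has an address, by which a tree can be coded as a sequence;
  \<open>chs\<close> forgets the order.\<close>

codatatype 'u tr = Nd (rt: 'u) (ch: "(nat \<times> 'u tr) list list")

primcorec unf :: "('s \<Rightarrow> 'u) \<Rightarrow> ('s \<Rightarrow> (nat \<times> 's) list list) \<Rightarrow> 's \<Rightarrow> 'u tr" where
  "unf g c s = Nd (g s) (map (map (map_prod id (unf g c))) (c s))"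

definition chs :: "'u tr \<Rightarrow> (nat \<times> 'u tr) set set" where
  "chs t = set ` set (ch t)"

lemma tr_coinduct:
  assumes "Q s t" and "\<And>s t. Q s t \<Longrightarrow> rt s = rt t \<and>
    list_all2 (list_all2 (\<lambda>p q. fst p = fst q \<and> Q (snd p) (snd q))) (ch s) (ch t)"
  shows "s = t"
  using assms(1)
proof (coinduction arbitrary: s t)
  case Eq_tr
  from assms(2)[OF this] show ?case
    by (auto elim!: list_all2_mono simp: rel_prod_sel)
qed

text \<open>Corecursion on triples, since \<open>n\<close> and \<open>f\<close> change on the way
  down: below a child with \<open>k\<close> added variables the map is \<open>f + k\<close> and the
  context is \<open>n + k\<close>.\<close>

definition tact :: "('f, 'u) psh \<Rightarrow> nat \<Rightarrow> 'f trm list \<Rightarrow> 'u tr \<Rightarrow> 'u tr" where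
  "tact H n f t = unf (\<lambda>(n, f, t). act H n f (rt t))
     (\<lambda>(n, f, t). map (map (\<lambda>p. (fst p, n + fst p, law_plus n (fst p) f, snd p))) (ch t)) (n, f, t)"

lemma rt_tact [simp]: "rt (tact H n f t) = act H n f (rt t)"
  by (simp add: tact_def)

lemma ch_tact: "ch (tact H n f t) = map (map (papp (tact H) n f)) (ch t)"
  by (simp add: tact_def papp_def map_prod_def)

lemma chs_tact: "chs (tact H n f t) = (`) (papp (tact H) n f) ` chs t"
  by (simp add: chs_def ch_tact image_image)

coinductive wft :: "('f, 'u) psh \<Rightarrow> nat \<Rightarrow> 'u tr \<Rightarrow> bool" for H where
  "rt t \<in> pts (ob H n) \<Longrightarrow> \<forall>S\<in>chs t. \<forall>p\<in>S. wft H (n + fst p) (snd p) \<Longrightarrow> wft H n t"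

lemma wft_rt: "wft H n t \<Longrightarrow> rt t \<in> pts (ob H n)"
  and wft_chs: "wft H n t \<Longrightarrow> S \<in> chs t \<Longrightarrow> p \<in> S \<Longrightarrow> wft H (n + fst p) (snd p)"
  by (auto elim: wft.cases)

lemma wft_ch: "wft H n t \<Longrightarrow> l \<in> set (ch t) \<Longrightarrow> p \<in> set l \<Longrightarrow> wft H (n + fst p) (snd p)"
  by (rule wft_chs) (auto simp: chs_def)

definition sub :: "'u tr \<Rightarrow> (nat \<times> nat) list \<Rightarrow> 'u tr" where
  "sub = foldl (\<lambda>t ij. snd (ch t ! fst ij ! snd ij))"

text \<open>\<open>Cop\<close> serves as an injective pairing of the root with a number; that number
  codes the lengths of the child lists and the counts of added variables.\<close>

definition lab :: "'e univ tr \<Rightarrow> 'e univ" where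
  "lab t = Cop (to_nat (map (map fst) (ch t))) [] (rt t)"

definition tree_code :: "'e univ tr \<Rightarrow> 'e univ" where
  "tree_code t = Seq (\<lambda>i. lab (sub t (from_nat i)))"

lemma lab_eq: "lab s = lab t \<longleftrightarrow> map (map fst) (ch s) = map (map fst) (ch t) \<and> rt s = rt t"
  by (auto simp: lab_def)

text \<open>The labels at all addresses determine the tree. An address may leave the tree and then
  denotes an unspecified subtree, which is harmless: the label of a node fixes which indices are
  genuine children.\<close>

lemma inj_tree_code: "inj tree_code"
proof (rule injI)
  fix s t :: "'e univ tr" assume "tree_code s = tree_code t"
  then have "lab (sub s p) = lab (sub t p)" for p
    unfolding tree_code_def by (metis from_nat_to_nat univ.inject(4))
  then have "\<forall>p. lab (sub s p) = lab (sub t p)" by blast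
  then show "s = t"
  proof (rule tr_coinduct[where Q = "\<lambda>s t. \<forall>p. lab (sub s p) = lab (sub t p)"])
    fix s t :: "'e univ tr" assume "\<forall>p. lab (sub s p) = lab (sub t p)"
    then have p: "lab (sub s p) = lab (sub t p)" for p by blast
    from p[of "[]"] have e: "map (map fst) (ch s) = map (map fst) (ch t)" "rt s = rt t"
      by (auto simp: sub_def lab_eq)
    then have l: "length (ch s) = length (ch t)" by (metis length_map)
    have l2: "map fst (ch s ! i) = map fst (ch t ! i)" if "i < length (ch s)" for i
      using e(1) l that by (metis nth_map)
    then have l3: "length (ch s ! i) = length (ch t ! i)" if "i < length (ch s)" for i
      using that by (metis length_map)
    have "fst (ch s ! i ! j) = fst (ch t ! i ! j)" if "i < length (ch s)" "j < length (ch s ! i)" for i j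
      using l2 l3 that by (metis nth_map)
    moreover have "lab (sub (snd (ch s ! i ! j)) q) = lab (sub (snd (ch t ! i ! j)) q)" for i j q
      using p[of "(i, j) # q"] by (simp add: sub_def)
    ultimately show "rt s = rt t \<and> list_all2 (list_all2 (\<lambda>p r. fst p = fst r \<and>
        (\<forall>q. lab (sub (snd p) q) = lab (sub (snd r) q)))) (ch s) (ch t)"
      using e(2) l l3 by (auto simp: list_all2_conv_all_nth)
  qed
qed

section \<open>Bisimilarity and similarity of trees\<close>

lemma IR_sym: "IR A Q n p q \<Longrightarrow> (\<And>m x y. Q m x y \<Longrightarrow> Q' m y x) \<Longrightarrow> IR A Q' n q p"
  unfolding IR_def by blast

lemma IR_mono' [mono]: "(\<And>m x y. Q m x y \<longrightarrow> Q' m x y) \<Longrightarrow> IR A Q n p q \<longrightarrow> IR A Q' n p q"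
  using IR_mono by metis

text \<open>\<open>brel H True\<close> is bisimilarity, with children compared as elements of the colimit;
  \<open>brel H False\<close> is the similarity preorder.\<close>

coinductive brel :: "('f, 'u) psh \<Rightarrow> bool \<Rightarrow> nat \<Rightarrow> 'u tr \<Rightarrow> 'u tr \<Rightarrow> bool" for H b where
  "wft H n s \<Longrightarrow> wft H n t \<Longrightarrow> XR H b n (rt s) (rt t) \<Longrightarrow>
     PR b (PR b (IR (tact H) (brel H b) n)) (chs s) (chs t) \<Longrightarrow> brel H b n s t"

lemma brel_coinduct:
  assumes "Q n s t" and "\<And>n s t. Q n s t \<Longrightarrow> wft H n s \<and> wft H n t \<and> XR H b n (rt s) (rt t) \<and>
    PR b (PR b (IR (tact H) Q n)) (chs s) (chs t)"
  shows "brel H b n s t"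
  using assms(1)
proof (coinduction arbitrary: n s t)
  case brel
  have "PR b (PR b (IR (tact H) (\<lambda>m x y. (\<exists>n s t. m = n \<and> x = s \<and> y = t \<and> Q n s t) \<or> brel H b m x y) n)) (chs s) (chs t)"
    using assms(2)[OF brel] by (auto elim!: PR_mono_mem IR_mono)
  then show ?case using assms(2)[OF brel] by simp
qed

lemma brel_wft: "brel H b n s t \<Longrightarrow> wft H n s \<and> wft H n t"
  and brel_rt: "brel H b n s t \<Longrightarrow> XR H b n (rt s) (rt t)"
  and brel_chs: "brel H b n s t \<Longrightarrow> PR b (PR b (IR (tact H) (brel H b) n)) (chs s) (chs t)"
  by (auto elim: brel.cases)

locale base_psh =
  fixes \<Sigma> :: "'f sig" and X :: "('f, 'e univ) psh"
  assumes X: "presheaf \<Sigma> X"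
begin

lemma wft_tact:
  assumes "f \<in> law \<Sigma> n m" "wft X m t"
  shows "wft X n (tact X n f t)"
  using assms
proof (coinduction arbitrary: n m f t)
  case wft
  then show ?case
    using presheaf_act[OF X wft(1) wft_rt[OF wft(2)]] wft_chs[OF wft(2)] law_plus_law[OF wft(1)]
    by (fastforce simp: chs_tact papp_def)
qed

lemma tact_id: "wft X n t \<Longrightarrow> tact X n (law_id n) t = t"
proof (rule tr_coinduct[where Q = "\<lambda>s t. \<exists>n. s = tact X n (law_id n) t \<and> wft X n t"], blast)
  fix s t assume "\<exists>n. s = tact X n (law_id n) t \<and> wft X n t"
  then obtain n where *: "s = tact X n (law_id n) t" "wft X n t" by blast
  then show "rt s = rt t \<and> list_all2 (list_all2 (\<lambda>p q. fst p = fst q \<and>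
      (\<exists>n. snd p = tact X n (law_id n) (snd q) \<and> wft X n (snd q)))) (ch s) (ch t)"
    using wft_ch[OF *(2)] presheaf_id[OF X wft_rt[OF *(2)]]
    by (fastforce simp: ch_tact list.rel_map list_all2_same papp_def law_plus_id)
qed

lemma tact_comp:
  "f \<in> law \<Sigma> n m \<Longrightarrow> g \<in> law \<Sigma> m k \<Longrightarrow> wft X k t \<Longrightarrow> tact X n (law_comp g f) t = tact X n f (tact X m g t)"
proof (rule tr_coinduct[where Q = "\<lambda>s u. \<exists>n m k f g t. s = tact X n (law_comp g f) t \<and>
     u = tact X n f (tact X m g t) \<and> f \<in> law \<Sigma> n m \<and> g \<in> law \<Sigma> m k \<and> wft X k t"], blast)
  fix s u assume "\<exists>n m k f g t. s = tact X n (law_comp g f) t \<and>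
     u = tact X n f (tact X m g t) \<and> f \<in> law \<Sigma> n m \<and> g \<in> law \<Sigma> m k \<and> wft X k t"
  then obtain n m k f g t where *: "s = tact X n (law_comp g f) t" "u = tact X n f (tact X m g t)"
    "f \<in> law \<Sigma> n m" "g \<in> law \<Sigma> m k" "wft X k t" by blast
  have "rt s = rt u" using presheaf_comp[OF X *(3,4) wft_rt[OF *(5)]] by (simp add: *)
  moreover have "list_all2 (list_all2 (\<lambda>p q. fst p = fst q \<and> (\<exists>n m k f g t. snd p = tact X n (law_comp g f) t \<and>
     snd q = tact X n f (tact X m g t) \<and> f \<in> law \<Sigma> n m \<and> g \<in> law \<Sigma> m k \<and> wft X k t))) (ch s) (ch u)"
    unfolding * ch_tact list.rel_map list_all2_same
  proof (intro ballI conjI)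
    fix l p assume "l \<in> set (ch t)" "p \<in> set l"
    then have "wft X (k + fst p) (snd p)" by (rule wft_ch[OF *(5)])
    then show "\<exists>n' m' k' f' g' t'. snd (papp (tact X) n (law_comp g f) p) = tact X n' (law_comp g' f') t' \<and>
        snd (papp (tact X) n f (papp (tact X) m g p)) = tact X n' f' (tact X m' g' t') \<and>
        f' \<in> law \<Sigma> n' m' \<and> g' \<in> law \<Sigma> m' k' \<and> wft X k' t'"
      using law_plus_comp[OF *(3,4), of "fst p"] law_plus_law[OF *(3), of "fst p"] law_plus_law[OF *(4), of "fst p"]
      unfolding papp_def fst_conv snd_conv by metis
  qed simp
  ultimately show "rt s = rt u \<and> list_all2 (list_all2 (\<lambda>p q. fst p = fst q \<and> (\<exists>n m k f g t. snd p = tact X n (law_comp g f) t \<and>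
     snd q = tact X n f (tact X m g t) \<and> f \<in> law \<Sigma> n m \<and> g \<in> law \<Sigma> m k \<and> wft X k t))) (ch s) (ch u)" by simp
qed

lemma tact_J_comp: "i \<in> injs n m \<Longrightarrow> j \<in> injs m l \<Longrightarrow> wft X n t \<Longrightarrow>
    tact X l (J j) (tact X m (J i) t) = tact X l (J (inj_comp j i)) t"
  by (simp add: tact_comp[OF J_law J_law] J_comp)

lemma tact_exchange:
  assumes f: "f \<in> law \<Sigma> n m" and w: "w \<in> injs k K" and a: "wft X (m + k) a"
  shows "tact X (n + K) (J (shift n w)) (tact X (n + k) (law_plus n k f) a) =
    tact X (n + K) (law_plus n K f) (tact X (m + K) (J (shift m w)) a)"
  using tact_comp[OF J_law[OF shift_injs[OF w]] law_plus_law[OF f] a]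
    tact_comp[OF law_plus_law[OF f] J_law[OF shift_injs[OF w]] a] law_plus_shift[OF f w] by metis

lemma brel_refl: "wft X n t \<Longrightarrow> brel X b n t t"
proof (rule brel_coinduct[where Q = "\<lambda>n s t. s = t \<and> wft X n t"], simp)
  fix n s t assume *: "s = t \<and> wft X n t"
  have "IR (tact X) (\<lambda>n s t. s = t \<and> wft X n t) n p p" if "S \<in> chs t" "p \<in> S" for S p
    unfolding IR_def using wft_chs[OF _ that] * upt_injs[of "fst p" "fst p"] by (force simp: shift_upt J_upt tact_id)
  then show "wft X n s \<and> wft X n t \<and> XR X b n (rt s) (rt t) \<and>
    PR b (PR b (IR (tact X) (\<lambda>n s t. s = t \<and> wft X n t) n)) (chs s) (chs t)"
    using * XR_refl[OF X wft_rt] by (auto intro!: PR_refl)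
qed

text \<open>The images of related pairs under maps \<open>f\<close> form a bisimulation: by
  \<open>tact_exchange\<close> the injections that compare two children pass through the action of
  \<open>f\<close>, which leaves the map \<open>f + K\<close> acting on a related pair.\<close>

lemma brel_tact:
  assumes "f \<in> law \<Sigma> n m" "brel X b m s t"
  shows "brel X b n (tact X n f s) (tact X n f t)"
proof -
  let ?Q = "\<lambda>n s t. \<exists>m f s' t'. f \<in> law \<Sigma> n m \<and> brel X b m s' t' \<and> s = tact X n f s' \<and> t = tact X n f t'"
  have "?Q n (tact X n f s) (tact X n f t)" using assms by blast
  then show ?thesis
  proof (rule brel_coinduct[where Q = ?Q])
    fix n s t assume "?Q n s t"
    then obtain m f s' t' where *: "f \<in> law \<Sigma> n m" "brel X b m s' t'" "s = tact X n f s'" "t = tact X n f t'" by blast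
    note w = brel_wft[OF *(2), THEN conjunct1] brel_wft[OF *(2), THEN conjunct2]
    have "IR (tact X) ?Q n (papp (tact X) n f p) (papp (tact X) n f q)"
      if S: "S \<in> chs s'" "p \<in> S" and U: "U \<in> chs t'" "q \<in> U" and pq: "IR (tact X) (brel X b) m p q" for S U p q
    proof -
      obtain K z z' where z: "z \<in> injs (fst p) K" "z' \<in> injs (fst q) K"
        "brel X b (m + K) (tact X (m + K) (J (shift m z)) (snd p)) (tact X (m + K) (J (shift m z')) (snd q))"
        using pq unfolding IR_def by blast
      have "?Q (n + K) (tact X (n + K) (J (shift n z)) (snd (papp (tact X) n f p)))
          (tact X (n + K) (J (shift n z')) (snd (papp (tact X) n f q)))"
        using z(3) law_plus_law[OF *(1), of K] tact_exchange[OF *(1) z(1) wft_chs[OF w(1) S]]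
          tact_exchange[OF *(1) z(2) wft_chs[OF w(2) U]]
        unfolding papp_def fst_conv snd_conv by blast
      then show ?thesis unfolding IR_def fst_papp using z(1,2) by blast
    qed
    then have "PR b (PR b (IR (tact X) ?Q n)) (chs s) (chs t)"
      unfolding * chs_tact PR_image using brel_chs[OF *(2)] by (elim PR_mono_mem) blast
    then show "wft X n s \<and> wft X n t \<and> XR X b n (rt s) (rt t) \<and> PR b (PR b (IR (tact X) ?Q n)) (chs s) (chs t)"
      using wft_tact[OF *(1) w(1)] wft_tact[OF *(1) w(2)] XR_act[OF X *(1) brel_rt[OF *(2)]] by (simp add: *)
  qed
qed

text \<open>Composites of related pairs form a bisimulation, because comparisons of children compose
  by amalgamation (\<open>IR_trans\<close>) and \<open>brel\<close> is stable under
  injections.\<close>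

lemma brel_trans: "brel X b n s t \<Longrightarrow> brel X b n t u \<Longrightarrow> brel X b n s u"
proof -
  assume su: "brel X b n s t" "brel X b n t u"
  let ?Q = "\<lambda>n s u. \<exists>t. brel X b n s t \<and> brel X b n t u"
  have "?Q n s u" using su by blast
  then show ?thesis
  proof (rule brel_coinduct[where Q = ?Q])
    fix n s u assume "?Q n s u"
    then obtain t where *: "brel X b n s t" "brel X b n t u" by blast
    note w = brel_wft[OF *(1), THEN conjunct1] brel_wft[OF *(2), THEN conjunct1] brel_wft[OF *(2), THEN conjunct2]
    have "IR (tact X) ?Q n p r"
      if "S \<in> chs s" "p \<in> S" "V \<in> chs t" "q \<in> V" "W \<in> chs u" "r \<in> W"
        and pq: "IR (tact X) (brel X b) n p q" and qr: "IR (tact X) (brel X b) n q r" for S V W p q r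
      using pq qr
    proof (rule IR_trans)
      show "tact X M (J j) (tact X N (J i) (snd s')) = tact X M (J (inj_comp j i)) (snd s')"
        if "s' \<in> {p, q, r}" "i \<in> injs (n + fst s') N" "j \<in> injs N M" for i j N M s'
        using tact_J_comp[OF that(2,3)] that(1) wft_chs[OF w(1) \<open>S \<in> chs s\<close> \<open>p \<in> S\<close>]
          wft_chs[OF w(2) \<open>V \<in> chs t\<close> \<open>q \<in> V\<close>] wft_chs[OF w(3) \<open>W \<in> chs u\<close> \<open>r \<in> W\<close>] by auto
    qed (auto intro: brel_tact[OF J_law])
    then have "PR b (PR b (IR (tact X) ?Q n)) (chs s) (chs u)"
      by (intro PR_trans[OF brel_chs[OF *(1)] brel_chs[OF *(2)]]) (erule PR_trans, assumption, blast)
    then show "wft X n s \<and> wft X n u \<and> XR X b n (rt s) (rt u) \<and> PR b (PR b (IR (tact X) ?Q n)) (chs s) (chs u)"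
      using w XR_trans[OF X brel_rt[OF *(1)] brel_rt[OF *(2)]] by simp
  qed
qed

lemma brel_sym: "brel X True n s t \<Longrightarrow> brel X True n t s"
proof (rule brel_coinduct[where Q = "\<lambda>n s t. brel X True n t s"])
  fix n s t assume *: "brel X True n t s"
  have "PR True (PR True (IR (tact X) (\<lambda>n s t. brel X True n t s) n)) (chs s) (chs t)"
    by (rule PR_sym[OF brel_chs[OF *]], erule PR_sym, erule IR_sym)
  then show "wft X n s \<and> wft X n t \<and> XR X True n (rt s) (rt t) \<and>
    PR True (PR True (IR (tact X) (\<lambda>n s t. brel X True n t s) n)) (chs s) (chs t)"
    using brel_wft[OF *] brel_rt[OF *] by (auto simp: XR_def)
qed

lemma brel_weak: "brel X True n s t \<Longrightarrow> brel X b n s t"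
proof (rule brel_coinduct[where Q = "brel X True"])
  fix n s t assume *: "brel X True n s t"
  have "PR b (PR b (IR (tact X) (brel X True) n)) (chs s) (chs t)"
    by (rule PR_mono_mem[OF PR_weak[OF brel_chs[OF *]] PR_weak])
  then show "wft X n s \<and> wft X n t \<and> XR X b n (rt s) (rt t) \<and> PR b (PR b (IR (tact X) (brel X True) n)) (chs s) (chs t)"
    using brel_wft[OF *] XR_weak[OF X brel_rt[OF *]] by simp
qed

section \<open>The cofree coalgebra\<close>

text \<open>The quotient map at stage \<open>n\<close>, with values in the universe: a bisimilarity
  class is represented by the code of a chosen member. Accordingly \<open>rep (q n t)\<close> need
  not be \<open>t\<close>, only bisimilar to it (\<open>rep_q\<close>).\<close>

definition q :: "nat \<Rightarrow> 'e univ tr \<Rightarrow> 'e univ" where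
  "q n t = tree_code (SOME s. brel X True n t s)"

definition rep :: "'e univ \<Rightarrow> 'e univ tr" where
  "rep = inv tree_code"

definition Tob :: "nat \<Rightarrow> 'e univ proset" where
  "Tob n = \<lparr>pts = q n ` {t. wft X n t}, le = {(q n s, q n t) | s t. brel X False n s t}\<rparr>"

definition T :: "('f, 'e univ) psh" where
  "T = \<lparr>ob = Tob, act = act_on \<Sigma> Tob (\<lambda>n f x. q n (tact X n f (rep x)))\<rparr>"

lemma T_ob [simp]: "ob T = Tob" by (simp add: T_def)

lemma rep_q: "wft X n t \<Longrightarrow> brel X True n t (rep (q n t))"
  unfolding rep_def q_def inv_f_f[OF inj_tree_code] by (rule someI[of _ t]) (rule brel_refl)

lemma q_eq: "wft X n s \<Longrightarrow> wft X n t \<Longrightarrow> q n s = q n t \<longleftrightarrow> brel X True n s t"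
proof
  assume w: "wft X n s" "wft X n t"
  show "brel X True n s t" if "q n s = q n t"
    using rep_q[OF w(1)] rep_q[OF w(2)] that brel_trans brel_sym by metis
  show "q n s = q n t" if "brel X True n s t"
  proof -
    have "brel X True n s u \<longleftrightarrow> brel X True n t u" for u using that brel_trans brel_sym by metis
    then show ?thesis by (simp add: q_def)
  qed
qed

lemma XR_q:
  assumes w: "wft X n s" "wft X n t"
  shows "XR T b n (q n s) (q n t) \<longleftrightarrow> brel X b n s t"
proof (cases b)
  case True then show ?thesis using w q_eq[OF w] by (auto simp: XR_def Tob_def)
next
  case False
  have "brel X False n s t" if "q n s = q n s'" "q n t = q n t'" "brel X False n s' t'" for s' t'
    using q_eq[OF w(1), of s'] q_eq[OF _ w(2), of t'] that brel_wft[OF that(3)] brel_trans brel_weak by metis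
  then show ?thesis using False w by (auto simp: XR_def Tob_def)
qed

lemma T_pts: "x \<in> pts (Tob n) \<longleftrightarrow> (\<exists>t. wft X n t \<and> x = q n t)"
  by (auto simp: Tob_def)

lemma T_le: "(x, y) \<in> le (Tob n) \<longleftrightarrow> (\<exists>s t. brel X False n s t \<and> x = q n s \<and> y = q n t)"
  by (auto simp: Tob_def)

text \<open>The action on classes does not depend on the representative, since acting preserves
  bisimilarity.\<close>

lemma act_q_aux:
  assumes "f \<in> law \<Sigma> n m" "wft X m t"
  shows "q n (tact X n f (rep (q m t))) = q n (tact X n f t)"
  using brel_tact[OF assms(1) rep_q[OF assms(2)]] q_eq brel_wft by metis

lemma act_q:
  assumes "f \<in> law \<Sigma> n m" "wft X m t"
  shows "act T n f (q m t) = q n (tact X n f t)"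
proof -
  have "q m t \<in> pts (Tob m)" using assms(2) by (auto simp: T_pts)
  then show ?thesis using act_q_aux[OF assms] by (simp add: T_def act_on_eq[OF assms(1)])
qed

lemma T_presheaf: "presheaf \<Sigma> T"
  unfolding T_def
proof (rule presheafI)
  fix n x y z assume xy: "(x, y) \<in> le (Tob n)"
  then obtain s t where st: "brel X False n s t" "x = q n s" "y = q n t" by (auto simp: T_le)
  then show "x \<in> pts (Tob n) \<and> y \<in> pts (Tob n)" using brel_wft[OF st(1)] by (auto simp: T_pts)
  assume "(y, z) \<in> le (Tob n)"
  then obtain t' u where tu: "brel X False n t' u" "y = q n t'" "z = q n u" by (auto simp: T_le)
  have "brel X True n t t'" using st tu q_eq brel_wft by metis
  then have "brel X False n s u" using st(1) tu(1) brel_weak brel_trans by metis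
  then show "(x, z) \<in> le (Tob n)" using st tu by (auto simp: T_le)
next
  fix n m f x y assume f: "f \<in> law \<Sigma> n m" and xy: "(x, y) \<in> le (Tob m)"
  then obtain s t where st: "brel X False m s t" "x = q m s" "y = q m t" by (auto simp: T_le)
  then show "(q n (tact X n f (rep x)), q n (tact X n f (rep y))) \<in> le (Tob n)"
    using act_q_aux[OF f] brel_wft[OF st(1)] brel_tact[OF f st(1)] by (auto simp: T_le)
next
  fix n x assume "x \<in> pts (Tob n)"
  then obtain t where t: "wft X n t" "x = q n t" by (auto simp: T_pts)
  then show "(x, x) \<in> le (Tob n)" using brel_refl[OF t(1)] unfolding T_le by blast
  show "q n (tact X n (law_id n) (rep x)) = x" using act_q_aux[OF law_id_law t(1)] tact_id[OF t(1)] t(2) by simp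
next
  fix n m f x assume f: "f \<in> law \<Sigma> n m" and "x \<in> pts (Tob m)"
  then show "q n (tact X n f (rep x)) \<in> pts (Tob n)"
    using act_q_aux[OF f] wft_tact[OF f] by (auto simp: T_pts)
next
  fix n m k f g x assume f: "f \<in> law \<Sigma> n m" and g: "g \<in> law \<Sigma> m k" and "x \<in> pts (Tob k)"
  then obtain t where t: "wft X k t" "x = q k t" by (auto simp: T_pts)
  show "q n (tact X n (law_comp g f) (rep x)) = q n (tact X n f (rep (q m (tact X m g (rep x)))))"
    using act_q_aux[OF law_comp_law[OF f g] t(1)] act_q_aux[OF g t(1)] act_q_aux[OF f wft_tact[OF g t(1)]]
      tact_comp[OF f g t(1)] t(2) by simp
qed

lemma IR_q:
  assumes "wft X (n + fst p) (snd p)" "wft X (n + fst p') (snd p')"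
  shows "IR (act T) Q n (pmap q n p) (pmap q n p') \<longleftrightarrow> IR (tact X) (\<lambda>m s t. Q m (q m s) (q m t)) n p p'"
  unfolding IR_def fst_pmap using act_q[OF J_law[OF shift_injs] assms(1)] act_q[OF J_law[OF shift_injs] assms(2)]
  by (simp add: pmap_def)

definition qs :: "nat \<Rightarrow> 'e univ tr \<Rightarrow> (nat \<times> 'e univ) set set" where
  "qs n t = (`) (pmap q n) ` chs t"

lemma good_qs: "wft X n t \<Longrightarrow> good T n (qs n t)"
  using wft_chs by (fastforce simp: good_def qs_def chs_def valid_def pmap_def T_pts)

text \<open>The clause for children in \<open>brel\<close>, read in the quotient. From left to right
  it serves equality and order of structures; from right to left it makes the structure map well
  defined and monotone.\<close>

lemma XR_qs:
  assumes "wft X n s" "wft X n t"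
  shows "XR (fob (PfPfInt \<Sigma>) T) b n (enc T n (qs n s)) (enc T n (qs n t)) \<longleftrightarrow>
    PR b (PR b (IR (tact X) (brel X b) n)) (chs s) (chs t)"
  unfolding F_XR[OF T_presheaf good_qs[OF assms(1)] good_qs[OF assms(2)]]
  unfolding qs_def PR_image
proof (rule PR_cong, rule PR_cong)
  fix S U p p' assume S: "S \<in> chs s" "p \<in> S" and U: "U \<in> chs t" "p' \<in> U"
  note w = wft_chs[OF assms(1) S] wft_chs[OF assms(2) U]
  show "IR (act T) (XR T b) n (pmap q n p) (pmap q n p') \<longleftrightarrow> IR (tact X) (brel X b) n p p'"
    unfolding IR_q[OF w] unfolding IR_def
    using XR_q[OF wft_tact[OF J_law[OF shift_injs] w(1)] wft_tact[OF J_law[OF shift_injs] w(2)]] by blast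
qed

definition str :: "('f, 'e univ) lax" where
  "str = mk_lax T (fob (PfPfInt \<Sigma>) T) (\<lambda>n x. enc T n (qs n (rep x)))"

definition counit :: "('f, 'e univ) lax" where
  "counit = mk_lax T X (\<lambda>n x. rt (rep x))"

lemma str_aux: "wft X n t \<Longrightarrow> enc T n (qs n (rep (q n t))) = enc T n (qs n t)"
  using XR_qs[of n t "rep (q n t)" True] brel_wft[OF rep_q] brel_chs[OF rep_q] by (auto simp: XR_def)

lemma rt_rep: "wft X n t \<Longrightarrow> rt (rep (q n t)) = rt t"
  using brel_rt[OF rep_q] by (auto simp: XR_def)

lemma qs_tact:
  assumes "f \<in> law \<Sigma> n m" "wft X m t"
  shows "qs n (tact X n f t) = (`) (papp (act T) n f) ` qs m t"
proof -
  have "pmap q n ` papp (tact X) n f ` S = papp (act T) n f ` pmap q m ` S" if "S \<in> chs t" for S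
    using act_q[OF law_plus_law[OF assms(1)] wft_chs[OF assms(2) that]]
    by (force simp: image_iff pmap_def papp_def)
  then show ?thesis by (simp add: qs_def chs_tact image_image)
qed

text \<open>The action on trees is strict, so the structure map commutes with every map of the
  Lawvere theory and not merely with injections; \<open>act\<close> settles both the lax and the
  strict requirement.\<close>

lemma str_lax: "lax_inj \<Sigma> str"
proof -
  have act: "act (fob (PfPfInt \<Sigma>) T) n f (enc T m (qs m (rep x))) = enc T n (qs n (rep (act T n f x)))"
    if f: "f \<in> law \<Sigma> n m" and x: "x \<in> pts (ob T m)" for n m f x
  proof -
    obtain t where t: "wft X m t" "x = q m t" using x by (auto simp: T_pts)
    show ?thesis
      using F_act[OF T_presheaf f good_qs[OF t(1)]] act_q[OF f t(1)] str_aux[OF t(1)] str_aux[OF wft_tact[OF f t(1)]]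
        qs_tact[OF f t(1)] t(2) by simp
  qed
  have p: "enc T n (qs n (rep x)) \<in> pts (ob (fob (PfPfInt \<Sigma>) T) n)" if "x \<in> pts (ob T n)" for n x
    using that str_aux enc_in[OF T_presheaf good_qs] by (auto simp: T_pts)
  show ?thesis unfolding str_def
  proof (rule lax_mk_lax[OF T_presheaf F_presheaf[OF T_presheaf] p])
    fix n x y assume "(x, y) \<in> le (ob T n)"
    then obtain s t where st: "brel X False n s t" "x = q n s" "y = q n t" by (auto simp: T_le)
    note w = brel_wft[OF st(1), THEN conjunct1] brel_wft[OF st(1), THEN conjunct2]
    show "(enc T n (qs n (rep x)), enc T n (qs n (rep y))) \<in> le (ob (fob (PfPfInt \<Sigma>) T) n)"
      using XR_qs[OF w, of False] brel_chs[OF st(1)] str_aux[OF w(1)] str_aux[OF w(2)] st(2,3) by (simp add: XR_def)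
  next
    fix n m f x assume "f \<in> law \<Sigma> n m" "x \<in> pts (ob T m)"
    then show "(act (fob (PfPfInt \<Sigma>) T) n f (enc T m (qs m (rep x))), enc T n (qs n (rep (act T n f x))))
      \<in> le (ob (fob (PfPfInt \<Sigma>) T) n)"
      using act p presheaf_act[OF T_presheaf] presheaf_refl[OF F_presheaf[OF T_presheaf]] by simp
  qed (use act J_law in blast)+
qed

lemma counit_lax: "lax_inj \<Sigma> counit"
proof -
  have act: "act X n f (rt (rep x)) = rt (rep (act T n f x))"
    if f: "f \<in> law \<Sigma> n m" and x: "x \<in> pts (ob T m)" for n m f x
    using x rt_rep act_q[OF f] wft_tact[OF f] by (auto simp: T_pts)
  have p: "rt (rep x) \<in> pts (ob X n)" if "x \<in> pts (ob T n)" for n x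
    using that rt_rep wft_rt by (auto simp: T_pts)
  show ?thesis unfolding counit_def
  proof (rule lax_mk_lax[OF T_presheaf X p])
    fix n x y assume "(x, y) \<in> le (ob T n)"
    then obtain s t where st: "brel X False n s t" "x = q n s" "y = q n t" by (auto simp: T_le)
    show "(rt (rep x), rt (rep y)) \<in> le (ob X n)"
      using brel_rt[OF st(1)] rt_rep brel_wft[OF st(1)] st(2,3) by (simp add: XR_def)
  next
    fix n m f x assume "f \<in> law \<Sigma> n m" "x \<in> pts (ob T m)"
    then show "(act X n f (rt (rep x)), rt (rep (act T n f x))) \<in> le (ob X n)"
      using act p presheaf_act[OF T_presheaf] presheaf_refl[OF X] by simp
  qed (use act J_law in blast)+
qed

lemma str_simps [simp]: "src str = T" "tgt str = fob (PfPfInt \<Sigma>) T" "src counit = T" "tgt counit = X"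
  by (auto simp: str_def counit_def)

lemma str_q: "wft X n t \<Longrightarrow> cmpt str n (q n t) = enc T n (qs n t)"
proof -
  assume t: "wft X n t"
  then have "q n t \<in> pts (ob T n)" by (auto simp: T_pts)
  then show ?thesis using str_aux[OF t] by (simp add: str_def)
qed

lemma counit_q: "wft X n t \<Longrightarrow> cmpt counit n (q n t) = rt t"
proof -
  assume t: "wft X n t"
  then have "q n t \<in> pts (ob T n)" by (auto simp: T_pts)
  then show ?thesis using rt_rep[OF t] by (simp add: counit_def)
qed

text \<open>Coinduction for \<open>T\<close> that mentions no trees, only the counit and
  presentations of the structure. The presentations need not be those read off the trees, so the
  relation is used up to equality in the colimit, and \<open>inj\<close> carries it along the
  injections that compare them.\<close>

lemma T_coinduct:
  assumes "\<rho> n x y"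
    and \<rho>: "\<And>n x y. \<rho> n x y \<Longrightarrow> x \<in> pts (ob T n) \<and> y \<in> pts (ob T n) \<and> cmpt counit n x = cmpt counit n y \<and>
      (\<exists>Z Z'. good T n Z \<and> good T n Z' \<and> cmpt str n x = enc T n Z \<and> cmpt str n y = enc T n Z' \<and>
        PR True (PR True (\<lambda>p p'. fst p = fst p' \<and> \<rho> (n + fst p) (snd p) (snd p'))) Z Z')"
    and inj: "\<And>n m i x y. \<rho> n x y \<Longrightarrow> i \<in> injs n m \<Longrightarrow> \<rho> m (act T m (J i) x) (act T m (J i) y)"
  shows "x = y"
proof -
  let ?Q = "\<lambda>n s t. wft X n s \<and> wft X n t \<and> \<rho> n (q n s) (q n t)"
  have "brel X True n s t" if "?Q n s t" for n s t using that
  proof (rule brel_coinduct[where Q = ?Q])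
    fix n s t assume *: "?Q n s t"
    then have w: "wft X n s" "wft X n t" by auto
    obtain Z Z' where Z: "good T n Z" "good T n Z'" "cmpt str n (q n s) = enc T n Z" "cmpt str n (q n t) = enc T n Z'"
      "PR True (PR True (\<lambda>p p'. fst p = fst p' \<and> \<rho> (n + fst p) (snd p) (snd p'))) Z Z'"
      using \<rho> * by blast
    have s: "PR True (PR True (IR (act T) (XR T True) n)) (qs n s) Z"
      using enc_eq[OF T_presheaf good_qs[OF w(1)] Z(1)] Z(3) str_q[OF w(1)] by simp
    have t: "PR True (PR True (IR (act T) (XR T True) n)) Z' (qs n t)"
      using enc_eq[OF T_presheaf Z(2) good_qs[OF w(2)]] Z(4) str_q[OF w(2)] by simp
    have comp: "act T M (J j) (act T N (J i) (snd p)) = act T M (J (inj_comp j i)) (snd p)"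
      if "valid T n p" "i \<in> injs (n + fst p) N" "j \<in> injs N M" for i j N M p
      using presheaf_J_comp[OF T_presheaf that(2,3)] that(1) by (simp add: valid_def)
    \<comment> \<open>A matched pair \<open>z\<close>, \<open>z'\<close> is enclosed between two
      equalities in the colimit. The three compose because \<open>XR T True\<close> is equality,
      which \<rho> absorbs on either side.\<close>
    have "IR (act T) \<rho> n p r"
      if "valid T n p" "valid T n r" "valid T n z" "valid T n z'"
        and pz: "IR (act T) (XR T True) n p z" and zz: "fst z = fst z'" "\<rho> (n + fst z) (snd z) (snd z')"
        and zr: "IR (act T) (XR T True) n z' r" for p z z' r
    proof -
      have XT: "XR T True M (act T M (J i) x) (act T M (J i) y)" if "i \<in> injs N M" "XR T True N x y" for x y N M i
        using XR_act[OF T_presheaf J_law[OF that(1)] that(2)] .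
      have "IR (act T) \<rho> n z z'"
        unfolding IR_def using zz inj[OF zz(2) upt_injs, of "n + fst z"] upt_injs[of "fst z" "fst z"]
        by (intro exI[of _ "fst z"] bexI[of _ "[0..<fst z]"]) (auto simp: shift_upt)
      then have "IR (act T) \<rho> n z r"
        by (rule IR_trans[OF _ zr]) (use inj XT comp that in \<open>auto simp: XR_def\<close>)
      with pz show ?thesis
        by (rule IR_trans) (use inj XT comp that in \<open>auto simp: XR_def\<close>)
    qed
    note key = this
    have g: "valid T n p" if "good T n Y" "S \<in> Y" "p \<in> S" for p S Y using that by (auto simp: good_def)
    have "PR True (PR True (IR (act T) \<rho> n)) (qs n s) (qs n t)"
    proof (rule PR_trans[OF s PR_trans[OF Z(5) t]])
      fix S V W assume S: "S \<in> qs n s" "V \<in> Z" "W \<in> qs n t"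
        and SV: "PR True (IR (act T) (XR T True) n) S V"
        and "\<exists>V'\<in>Z'. PR True (\<lambda>p p'. fst p = fst p' \<and> \<rho> (n + fst p) (snd p) (snd p')) V V' \<and>
          PR True (IR (act T) (XR T True) n) V' W"
      then obtain V' where V': "V' \<in> Z'" "PR True (\<lambda>p p'. fst p = fst p' \<and> \<rho> (n + fst p) (snd p) (snd p')) V V'"
          "PR True (IR (act T) (XR T True) n) V' W" by blast
      show "PR True (IR (act T) \<rho> n) S W"
      proof (rule PR_trans[OF SV PR_trans[OF V'(2,3)]])
        fix p z r assume "p \<in> S" "z \<in> V" "r \<in> W" "IR (act T) (XR T True) n p z"
          "\<exists>z'\<in>V'. (fst z = fst z' \<and> \<rho> (n + fst z) (snd z) (snd z')) \<and> IR (act T) (XR T True) n z' r"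
        then show "IR (act T) \<rho> n p r"
          using key g[OF good_qs[OF w(1)] S(1)] g[OF Z(1) S(2)] g[OF Z(2) V'(1)] g[OF good_qs[OF w(2)] S(3)] by blast
      qed blast
    qed blast
    then have "PR True (PR True (\<lambda>p p'. IR (act T) \<rho> n (pmap q n p) (pmap q n p'))) (chs s) (chs t)"
      unfolding qs_def PR_image .
    then have "PR True (PR True (IR (tact X) ?Q n)) (chs s) (chs t)"
    proof (elim PR_mono_mem)
      fix S U p p' assume S: "S \<in> chs s" "p \<in> S" and U: "U \<in> chs t" "p' \<in> U"
        and IR: "IR (act T) \<rho> n (pmap q n p) (pmap q n p')"
      note wp = wft_chs[OF w(1) S] wft_chs[OF w(2) U]
      show "IR (tact X) ?Q n p p'" using IR[unfolded IR_q[OF wp]]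
        unfolding IR_def using wft_tact[OF J_law[OF shift_injs] wp(1)] wft_tact[OF J_law[OF shift_injs] wp(2)] by blast
    qed
    moreover have "XR X True n (rt s) (rt t)"
      using \<rho>[of n "q n s" "q n t"] * counit_q w wft_rt by (auto simp: XR_def)
    ultimately show "wft X n s \<and> wft X n t \<and> XR X True n (rt s) (rt t) \<and> PR True (PR True (IR (tact X) ?Q n)) (chs s) (chs t)"
      using w by simp
  qed
  then show ?thesis using \<rho>[OF assms(1)] assms(1) q_eq by (auto simp: T_pts)
qed

end

section \<open>The unfolding of a coalgebra into trees\<close>

locale coalg_over = base_psh +
  fixes c g
  assumes c: "lax_inj \<Sigma> c" "tgt c = fob (PfPfInt \<Sigma>) (src c)"
    and g: "lax_inj \<Sigma> g" "src g = src c" "tgt g = X"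
begin

abbreviation "Y \<equiv> src c"

lemma Y: "presheaf \<Sigma> Y" using lax_src[OF c(1)] .

text \<open>Corecursion needs ordered presentations of the children, while a coalgebra supplies only
  an element of the codomain. The presentations are chosen without regard to naturality;
  \<open>tree_brel_gen\<close> recovers it up to bisimilarity.\<close>

definition kids :: "nat \<Rightarrow> 'b univ \<Rightarrow> (nat \<times> 'b univ) list list" where
  "kids n x = (SOME l. good Y n (set ` set l) \<and> cmpt c n x = enc Y n (set ` set l))"

definition kidset :: "nat \<Rightarrow> 'b univ \<Rightarrow> (nat \<times> 'b univ) set set" where
  "kidset n x = set ` set (kids n x)"

lemma kidset:
  assumes "x \<in> pts (ob Y n)"
  shows "good Y n (kidset n x)" "cmpt c n x = enc Y n (kidset n x)"
proof -
  obtain Z where Z: "good Y n Z" "cmpt c n x = enc Y n Z"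
    using lax_pts[OF c(1) assms] by (auto simp: c(2) F_pts[OF Y])
  then have "\<forall>S\<in>Z. \<exists>l. set l = S" by (auto simp: good_def intro: finite_list)
  then obtain h where h: "\<forall>S\<in>Z. set (h S) = S" by metis
  obtain Zl where "set Zl = Z" using finite_list[of Z] Z(1) by (auto simp: good_def)
  then have "set ` set (map h Zl) = Z" using h by (force simp: image_image)
  then have "\<exists>l. good Y n (set ` set l) \<and> cmpt c n x = enc Y n (set ` set l)" using Z by metis
  from someI_ex[OF this] show "good Y n (kidset n x)" "cmpt c n x = enc Y n (kidset n x)"
    by (auto simp: kidset_def kids_def)
qed

definition tree :: "nat \<Rightarrow> 'b univ \<Rightarrow> 'b univ tr" where
  "tree n x = unf (\<lambda>(n, x). cmpt g n x) (\<lambda>(n, x). map (map (\<lambda>p. (fst p, n + fst p, snd p))) (kids n x)) (n, x)"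

lemma rt_tree [simp]: "rt (tree n x) = cmpt g n x"
  by (simp add: tree_def)

lemma chs_tree: "chs (tree n x) = (`) (pmap tree n) ` kidset n x"
  by (simp add: tree_def chs_def kidset_def image_image pmap_def)

lemma kidset_pts: "x \<in> pts (ob Y n) \<Longrightarrow> S \<in> kidset n x \<Longrightarrow> p \<in> S \<Longrightarrow> snd p \<in> pts (ob Y (n + fst p))"
  using kidset(1) by (auto simp: good_def valid_def)

lemma wft_tree: "x \<in> pts (ob Y n) \<Longrightarrow> wft X n (tree n x)"
proof (coinduction arbitrary: n x)
  case wft
  have "cmpt g n x \<in> pts (ob X n)" using lax_pts[OF g(1)] wft by (simp add: g)
  then show ?case using kidset_pts[OF wft] by (fastforce simp: chs_tree pmap_def)
qed

text \<open>Closing the bisimulation under actions on both sides absorbs the injections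
  by which elements of the colimit are compared.\<close>

lemma tree_brel_gen:
  assumes "f \<in> law \<Sigma> n m" "b \<Longrightarrow> \<exists>j\<in>injs m n. f = J j" "i \<in> injs m' n"
    "x \<in> pts (ob Y m)" "z \<in> pts (ob Y m')" "XR Y b n (act Y n f x) (act Y n (J i) z)"
  shows "brel X b n (tact X n f (tree m x)) (tact X n (J i) (tree m' z))"
proof -
  let ?Q = "\<lambda>n s t. \<exists>m f x m' i z. f \<in> law \<Sigma> n m \<and> (b \<longrightarrow> (\<exists>j\<in>injs m n. f = J j)) \<and> i \<in> injs m' n \<and>
    x \<in> pts (ob Y m) \<and> z \<in> pts (ob Y m') \<and> XR Y b n (act Y n f x) (act Y n (J i) z) \<and>
    s = tact X n f (tree m x) \<and> t = tact X n (J i) (tree m' z)"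
  have "?Q n (tact X n f (tree m x)) (tact X n (J i) (tree m' z))" using assms by blast
  then show ?thesis
  proof (rule brel_coinduct[where Q = ?Q])
    fix n s t assume "?Q n s t"
    then obtain m f x m' i z where *: "f \<in> law \<Sigma> n m" "b \<longrightarrow> (\<exists>j\<in>injs m n. f = J j)" "i \<in> injs m' n"
      "x \<in> pts (ob Y m)" "z \<in> pts (ob Y m')" "XR Y b n (act Y n f x) (act Y n (J i) z)"
      and st: "s = tact X n f (tree m x)" "t = tact X n (J i) (tree m' z)" by blast
    \<comment> \<open>Applied to \<open>g\<close> for the roots and to \<open>c\<close> for the
      children. On the left \<open>f\<close> passes \<alpha> laxly, or strictly if \<open>b\<close>
      holds; on the right \<open>J i\<close> always passes strictly, so that the two comparisons
      point in the same direction and compose.\<close>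
    have lax: "XR (tgt \<alpha>) b n (act (tgt \<alpha>) n f (cmpt \<alpha> m x)) (act (tgt \<alpha>) n (J i) (cmpt \<alpha> m' z))"
      if \<alpha>: "lax_inj \<Sigma> \<alpha>" "src \<alpha> = Y" for \<alpha>
    proof -
      note x = *(4)[folded \<alpha>(2)] and z = *(5)[folded \<alpha>(2)]
      have p: "act (tgt \<alpha>) n f (cmpt \<alpha> m x) \<in> pts (ob (tgt \<alpha>) n)"
        "cmpt \<alpha> n (act Y n f x) \<in> pts (ob (tgt \<alpha>) n)"
        using presheaf_act[OF lax_tgt[OF \<alpha>(1)] *(1) lax_pts[OF \<alpha>(1) x]]
          lax_pts[OF \<alpha>(1)] presheaf_act[OF lax_src[OF \<alpha>(1)] *(1) x] by (auto simp: \<alpha>(2))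
      have "XR (tgt \<alpha>) b n (act (tgt \<alpha>) n f (cmpt \<alpha> m x)) (cmpt \<alpha> n (act Y n f x))"
      proof (cases b)
        case True
        then obtain j where j: "j \<in> injs m n" "f = J j" using *(2) by blast
        show ?thesis using p lax_strict[OF \<alpha>(1) j(1) x] True by (simp add: XR_def j(2) \<alpha>(2))
      next
        case False
        then show ?thesis using p lax_lax[OF \<alpha>(1) *(1) x] by (simp add: XR_def \<alpha>(2))
      qed
      moreover have "XR (tgt \<alpha>) b n (cmpt \<alpha> n (act Y n f x)) (cmpt \<alpha> n (act Y n (J i) z))"
        using XR_lax[OF \<alpha>(1), of b n] *(6) by (simp add: \<alpha>(2))
      ultimately show ?thesis
        using XR_trans[OF lax_tgt[OF \<alpha>(1)]] lax_strict[OF \<alpha>(1) *(3) z] by (simp add: \<alpha>(2))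
    qed
    have rt: "XR X b n (rt s) (rt t)" using lax[OF g(1,2)] by (simp add: st g(3))
    note Ji = J_law[OF *(3)]
    have "XR (fob (PfPfInt \<Sigma>) Y) b n (enc Y n ((`) (papp (act Y) n f) ` kidset m x))
        (enc Y n ((`) (papp (act Y) n (J i)) ` kidset m' z))"
      using lax[OF c(1)] kidset(2)[OF *(4)] kidset(2)[OF *(5)] F_act[OF Y *(1) kidset(1)[OF *(4)]]
        F_act[OF Y Ji kidset(1)[OF *(5)]] by (simp add: c(2))
    then have "PR b (PR b (\<lambda>p r. IR (act Y) (XR Y b) n (papp (act Y) n f p) (papp (act Y) n (J i) r)))
        (kidset m x) (kidset m' z)"
      unfolding F_XR[OF Y good_papp[OF Y *(1) kidset(1)[OF *(4)]] good_papp[OF Y Ji kidset(1)[OF *(5)]]]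
        PR_image .
    then have "PR b (PR b (\<lambda>p r. IR (tact X) ?Q n (papp (tact X) n f (pmap tree m p)) (papp (tact X) n (J i) (pmap tree m' r))))
        (kidset m x) (kidset m' z)"
    proof (elim PR_mono_mem)
      fix S U p r assume S: "S \<in> kidset m x" "p \<in> S" and U: "U \<in> kidset m' z" "r \<in> U"
        and "IR (act Y) (XR Y b) n (papp (act Y) n f p) (papp (act Y) n (J i) r)"
      then obtain K w w' where w: "w \<in> injs (fst p) K" "w' \<in> injs (fst r) K"
        "XR Y b (n + K) (act Y (n + K) (J (shift n w)) (act Y (n + fst p) (law_plus n (fst p) f) (snd p)))
          (act Y (n + K) (J (shift n w')) (act Y (n + fst r) (law_plus n (fst r) (J i)) (snd r)))"
        unfolding IR_def papp_def by auto
      note p = kidset_pts[OF *(4) S] and r = kidset_pts[OF *(5) U]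
      define f' where "f' = law_comp (law_plus n (fst p) f) (J (shift n w))"
      define i' where "i' = inj_comp (shift n w') (i @ [n..<n + fst r])"
      note sw = shift_injs[OF w(1), of n] and sw' = shift_injs[OF w(2), of n]
      have f': "f' \<in> law \<Sigma> (n + K) (m + fst p)"
        unfolding f'_def by (rule law_comp_law[OF J_law[OF sw] law_plus_law[OF *(1)]])
      have i': "i' \<in> injs (m' + fst r) (n + K)"
        unfolding i'_def by (rule inj_comp_injs[OF injs_plus[OF *(3)] sw'])
      have ij: "J i' = law_comp (law_plus n (fst r) (J i)) (J (shift n w'))"
        unfolding i'_def law_plus_J by (rule J_comp[OF injs_plus[OF *(3)] sw'])
      \<comment> \<open>For equality the map on the left has to remain a renaming on the way down,
        as laxness would lose the equation.\<close>
      have b: "b \<longrightarrow> (\<exists>j\<in>injs (m + fst p) (n + K). f' = J j)"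
      proof
        assume b
        then obtain j where j: "j \<in> injs m n" "f = J j" using *(2) by blast
        have "f' = J (inj_comp (shift n w) (j @ [n..<n + fst p]))"
          unfolding f'_def j(2) law_plus_J by (rule J_comp[OF injs_plus[OF j(1)] sw, symmetric])
        then show "\<exists>j\<in>injs (m + fst p) (n + K). f' = J j" using inj_comp_injs[OF injs_plus[OF j(1)] sw] by blast
      qed
      have x: "XR Y b (n + K) (act Y (n + K) f' (snd p)) (act Y (n + K) (J i') (snd r))"
        using w(3) presheaf_comp[OF Y J_law[OF sw] law_plus_law[OF *(1)] p]
          presheaf_comp[OF Y J_law[OF sw'] law_plus_law[OF Ji] r] by (simp add: f'_def ij)
      have "tact X (n + K) (J (shift n w)) (snd (papp (tact X) n f (pmap tree m p))) = tact X (n + K) f' (tree (m + fst p) (snd p))"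
        "tact X (n + K) (J (shift n w')) (snd (papp (tact X) n (J i) (pmap tree m' r))) = tact X (n + K) (J i') (tree (m' + fst r) (snd r))"
        using tact_comp[OF J_law[OF sw] law_plus_law[OF *(1)] wft_tree[OF p]]
          tact_comp[OF J_law[OF sw'] law_plus_law[OF Ji] wft_tree[OF r]]
        by (simp_all add: f'_def ij papp_def pmap_def)
      then have "?Q (n + K) (tact X (n + K) (J (shift n w)) (snd (papp (tact X) n f (pmap tree m p))))
          (tact X (n + K) (J (shift n w')) (snd (papp (tact X) n (J i) (pmap tree m' r))))"
        using f' b i' p r x by blast
      then show "IR (tact X) ?Q n (papp (tact X) n f (pmap tree m p)) (papp (tact X) n (J i) (pmap tree m' r))"
        unfolding IR_def fst_papp fst_pmap using w(1,2) by blast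
    qed
    then have "PR b (PR b (IR (tact X) ?Q n)) (chs s) (chs t)"
      unfolding st chs_tact chs_tree PR_image .
    then show "wft X n s \<and> wft X n t \<and> XR X b n (rt s) (rt t) \<and> PR b (PR b (IR (tact X) ?Q n)) (chs s) (chs t)"
      using rt wft_tact[OF *(1) wft_tree[OF *(4)]] wft_tact[OF Ji wft_tree[OF *(5)]] by (simp add: st)
  qed
qed

lemma tree_brel:
  assumes "f \<in> law \<Sigma> n m" "b \<Longrightarrow> \<exists>j\<in>injs m n. f = J j"
    "x \<in> pts (ob Y m)" "XR Y b n (act Y n f x) z"
  shows "brel X b n (tact X n f (tree m x)) (tree n z)"
proof -
  have z: "z \<in> pts (ob Y n)" using assms(4) by (simp add: XR_def)
  have "XR Y b n (act Y n f x) (act Y n (J [0..<n]) z)" using assms(4) by (simp add: J_upt presheaf_id[OF Y z])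
  from tree_brel_gen[OF assms(1,2) upt_injs[OF order_refl] assms(3) z this]
  show ?thesis by (simp add: J_upt tact_id[OF wft_tree[OF z]])
qed

definition ana :: "('a, 'b univ) lax" where
  "ana = mk_lax Y T (\<lambda>n x. q n (tree n x))"

lemma ana_simps [simp]: "src ana = Y" "tgt ana = T" "x \<in> pts (ob Y n) \<Longrightarrow> cmpt ana n x = q n (tree n x)"
  by (auto simp: ana_def)

lemma ana_lax: "lax_inj \<Sigma> ana"
  unfolding ana_def
proof (rule lax_mk_lax[OF Y T_presheaf])
  \<comment> \<open>One comparison yields three conditions: the identity for \<open>f\<close> gives
    monotonicity, the order with \<open>z\<close> the image of \<open>x\<close> gives laxness, and
    equality with a renaming for \<open>f\<close> gives strictness.\<close>
  have br: "XR T b n (act T n f (q m (tree m x))) (q n (tree n z))"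
    if "f \<in> law \<Sigma> n m" "b \<Longrightarrow> \<exists>j\<in>injs m n. f = J j" "x \<in> pts (ob Y m)" "XR Y b n (act Y n f x) z" for b n m f x z
  proof -
    have "z \<in> pts (ob Y n)" using that(4) by (simp add: XR_def)
    then show ?thesis
      using XR_q[OF wft_tact[OF that(1) wft_tree[OF that(3)]] wft_tree] tree_brel[OF that]
        act_q[OF that(1) wft_tree[OF that(3)]] by simp
  qed
  show "q n (tree n x) \<in> pts (ob T n)" if "x \<in> pts (ob Y n)" for n x
    using wft_tree[OF that] by (auto simp: T_pts)
  show "(q n (tree n x), q n (tree n y)) \<in> le (ob T n)" if "(x, y) \<in> le (ob Y n)" for n x y
  proof -
    have x: "x \<in> pts (ob Y n)" using presheaf_le_pts[OF Y that] by simp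
    show ?thesis
      using br[OF law_id_law _ x, of False y] that presheaf_id[OF Y x] act_q[OF law_id_law wft_tree[OF x]]
        tact_id[OF wft_tree[OF x]] by (simp add: XR_False[OF Y] XR_False[OF T_presheaf])
  qed
  show "(act T n f (q m (tree m x)), q n (tree n (act Y n f x))) \<in> le (ob T n)"
    if "f \<in> law \<Sigma> n m" "x \<in> pts (ob Y m)" for n m f x
    using br[OF that(1) _ that(2) XR_refl[OF Y presheaf_act[OF Y that]], of False]
    by (simp add: XR_False[OF T_presheaf])
  show "act T n (J i) (q m (tree m x)) = q n (tree n (act Y n (J i) x))"
    if "i \<in> injs m n" "x \<in> pts (ob Y m)" for n m i x
    using br[OF J_law[OF that(1)] _ that(2) XR_refl[OF Y presheaf_act[OF Y J_law[OF that(1)] that(2)]], of True] that(1)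
    by (auto simp: XR_def)
qed

lemma ana_str:
  assumes x: "x \<in> pts (ob Y n)"
  shows "cmpt str n (cmpt ana n x) = cmpt (far (PfPfInt \<Sigma>) ana) n (cmpt c n x)"
proof -
  have "pmap q n ` pmap tree n ` S = pmap (cmpt ana) n ` S" if "S \<in> kidset n x" for S
    using kidset_pts[OF x that] by (force simp: image_iff pmap_def)
  then have "qs n (tree n x) = (`) (pmap (cmpt ana) n) ` kidset n x"
    by (simp add: qs_def chs_tree image_image)
  then show ?thesis
    using F_far[OF ana_lax, of n "kidset n x"] kidset[OF x] str_q[OF wft_tree[OF x]] x by simp
qed

lemma ana_counit: "x \<in> pts (ob Y n) \<Longrightarrow> cmpt counit n (cmpt ana n x) = cmpt g n x"
  using counit_q[OF wft_tree] by simp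

text \<open>Both maps send the chosen children of \<open>x\<close> to presentations of the children
  of its image. Pairs of values at a common argument are thus matched child by child, and
  \<open>T_coinduct\<close> applies.\<close>

lemma ana_unique:
  assumes h: "lax_inj \<Sigma> h" "src h = Y" "tgt h = T"
    "\<And>n x. x \<in> pts (ob Y n) \<Longrightarrow> cmpt str n (cmpt h n x) = cmpt (far (PfPfInt \<Sigma>) h) n (cmpt c n x)"
    "\<And>n x. x \<in> pts (ob Y n) \<Longrightarrow> cmpt counit n (cmpt h n x) = cmpt g n x"
  shows "h = ana"
proof (rule lax_eqI[OF h(1) ana_lax])
  fix n x assume "x \<in> pts (ob (src h) n)"
  then have x: "x \<in> pts (ob Y n)" by (simp add: h)
  show "cmpt h n x = cmpt ana n x"
  proof (rule T_coinduct[where \<rho> = "\<lambda>n u v. \<exists>x\<in>pts (ob Y n). u = cmpt h n x \<and> v = cmpt ana n x"])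
    show "\<exists>y\<in>pts (ob Y n). cmpt h n x = cmpt h n y \<and> cmpt ana n x = cmpt ana n y" using x by blast
  next
    fix n m i u v assume uv: "\<exists>x\<in>pts (ob Y n). u = cmpt h n x \<and> v = cmpt ana n x" and i: "i \<in> injs n m"
    then obtain x where x: "x \<in> pts (ob Y n)" "u = cmpt h n x" "v = cmpt ana n x" by blast
    have "act T m (J i) u = cmpt h m (act Y m (J i) x)"
      using lax_strict[OF h(1) i, of x] x by (simp add: h)
    moreover have "act T m (J i) v = cmpt ana m (act Y m (J i) x)"
      using lax_strict[OF ana_lax i, of x] x by (simp del: ana_simps(3))
    ultimately show "\<exists>x\<in>pts (ob Y m). act T m (J i) u = cmpt h m x \<and> act T m (J i) v = cmpt ana m x"
      using presheaf_act[OF Y J_law[OF i] x(1)] by blast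
  next
    fix n u v assume "\<exists>x\<in>pts (ob Y n). u = cmpt h n x \<and> v = cmpt ana n x"
    then obtain x where x: "x \<in> pts (ob Y n)" "u = cmpt h n x" "v = cmpt ana n x" by blast
    let ?Z = "(`) (pmap (cmpt h) n) ` kidset n x" and ?Z' = "(`) (pmap (cmpt ana) n) ` kidset n x"
    have "good T n ?Z" "good T n ?Z'"
      using good_pmap[OF h(1), of n "kidset n x"] good_pmap[OF ana_lax, of n "kidset n x"] kidset(1)[OF x(1)] h by auto
    moreover have "cmpt str n u = enc T n ?Z" "cmpt str n v = enc T n ?Z'"
      using F_far[OF h(1), of n "kidset n x"] F_far[OF ana_lax, of n "kidset n x"] kidset[OF x(1)]
        h(2,3) h(4)[OF x(1)] ana_str[OF x(1)] x by (simp_all del: ana_simps(3))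
    moreover have "PR True (PR True (\<lambda>p p'. fst p = fst p' \<and>
        (\<exists>x\<in>pts (ob Y (n + fst p)). snd p = cmpt h (n + fst p) x \<and> snd p' = cmpt ana (n + fst p) x))) ?Z ?Z'"
      unfolding PR_image by (intro PR_refl) (use kidset_pts[OF x(1)] in \<open>auto simp: pmap_def\<close>)
    moreover have "u \<in> pts (ob T n)" "v \<in> pts (ob T n)" "cmpt counit n u = cmpt counit n v"
      using lax_pts[OF h(1), of x n] lax_pts[OF ana_lax, of x n] h(5)[OF x(1)] ana_counit[OF x(1)] x h(2,3)
      by (simp_all del: ana_simps(3) T_ob)
    ultimately show "u \<in> pts (ob T n) \<and> v \<in> pts (ob T n) \<and> cmpt counit n u = cmpt counit n v \<and>
      (\<exists>Z Z'. good T n Z \<and> good T n Z' \<and> cmpt str n u = enc T n Z \<and> cmpt str n v = enc T n Z' \<and>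
        PR True (PR True (\<lambda>p p'. fst p = fst p' \<and>
          (\<exists>x\<in>pts (ob Y (n + fst p)). snd p = cmpt h (n + fst p) x \<and> snd p' = cmpt ana (n + fst p) x))) Z Z')"
      by blast
  qed
qed (simp_all add: h)

end

section \<open>Cofree coalgebras on all objects\<close>

lemma endo_Lax: "endo (Lax_Inj \<Sigma>) (PfPfInt \<Sigma>)"
  by unfold_locales (rule PfPfInt_functor)

lemma chom_Lax: "endo.chom (Lax_Inj \<Sigma>) (PfPfInt \<Sigma>) (H, x) (K, y) h \<longleftrightarrow>
  lax_inj \<Sigma> x \<and> src x = H \<and> tgt x = fob (PfPfInt \<Sigma>) H \<and> lax_inj \<Sigma> y \<and> src y = K \<and> tgt y = fob (PfPfInt \<Sigma>) K \<and>
  lax_inj \<Sigma> h \<and> src h = H \<and> tgt h = K \<and>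
  (\<forall>n. \<forall>a\<in>pts (ob H n). cmpt y n (cmpt h n a) = cmpt (far (PfPfInt \<Sigma>) h) n (cmpt x n a))"
proof -
  have far: "far (PfPfInt \<Sigma>) h \<in> hom (Lax_Inj \<Sigma>) (fob (PfPfInt \<Sigma>) H) (fob (PfPfInt \<Sigma>) K)"
    if "lax_inj \<Sigma> h" "src h = H" "tgt h = K"
    using far_hom[OF PfPfInt_functor, of h \<Sigma> H K] that by (simp add: Lax_hom)
  have "Cmp (Lax_Inj \<Sigma>) y h = Cmp (Lax_Inj \<Sigma>) (far (PfPfInt \<Sigma>) h) x \<longleftrightarrow>
      (\<forall>n. \<forall>a\<in>pts (ob H n). cmpt y n (cmpt h n a) = cmpt (far (PfPfInt \<Sigma>) h) n (cmpt x n a))"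
    if "src x = H" "src h = H" "tgt y = fob (PfPfInt \<Sigma>) K" "lax_inj \<Sigma> h" "tgt h = K"
    using far that by (auto simp: mk_lax_def Lax_hom fun_eq_iff restrict_def)
  then show ?thesis
    unfolding endo.chom_def[OF endo_Lax] endo.coalg_Obj[OF endo_Lax]
    by (auto simp: Lax_hom lax_src)
qed

lemma (in base_psh) cofree: "endo.cofree_on (Lax_Inj \<Sigma>) (PfPfInt \<Sigma>) X (T, str) counit"
  unfolding endo.cofree_on_def[OF endo_Lax]
proof (intro conjI ballI)
  show "(T, str) \<in> Obj (coalg_cat (Lax_Inj \<Sigma>) (PfPfInt \<Sigma>))"
    unfolding endo.coalg_Obj[OF endo_Lax] using str_lax T_presheaf by (simp add: Lax_hom)
  show "counit \<in> hom (Lax_Inj \<Sigma>) (fst (T, str)) X" using counit_lax by (simp add: Lax_hom)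
  fix a g assume a: "a \<in> Obj (coalg_cat (Lax_Inj \<Sigma>) (PfPfInt \<Sigma>))" and g: "g \<in> hom (Lax_Inj \<Sigma>) (fst a) X"
  obtain Y c where Y: "a = (Y, c)" by (cases a)
  with a have c: "lax_inj \<Sigma> c" "src c = Y" "tgt c = fob (PfPfInt \<Sigma>) Y"
    by (auto simp: endo.coalg_Obj[OF endo_Lax] Lax_hom)
  interpret A: coalg_over \<Sigma> X c g
    by unfold_locales (use c g Y in \<open>auto simp: Lax_hom\<close>)
  have g': "lax_inj \<Sigma> g" "src g = Y" "tgt g = X" using g Y by (auto simp: Lax_hom)
  have co: "Cmp (Lax_Inj \<Sigma>) counit h = g \<longleftrightarrow> (\<forall>n. \<forall>x\<in>pts (ob Y n). cmpt counit n (cmpt h n x) = cmpt g n x)"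
    if h: "lax_inj \<Sigma> h" "src h = Y" "tgt h = T" for h
  proof
    assume "Cmp (Lax_Inj \<Sigma>) counit h = g"
    then show "\<forall>n. \<forall>x\<in>pts (ob Y n). cmpt counit n (cmpt h n x) = cmpt g n x"
      using h by (auto simp: mk_lax_def)
  next
    assume *: "\<forall>n. \<forall>x\<in>pts (ob Y n). cmpt counit n (cmpt h n x) = cmpt g n x"
    show "Cmp (Lax_Inj \<Sigma>) counit h = g"
      using lax_Cmp[OF h(1) counit_lax] * h g' by (intro lax_eqI[OF _ g'(1)]) auto
  qed
  show "\<exists>!h. endo.chom (Lax_Inj \<Sigma>) (PfPfInt \<Sigma>) a (T, str) h \<and> Cmp (Lax_Inj \<Sigma>) counit h = g"
  proof (rule ex1I[of _ A.ana])
    show "endo.chom (Lax_Inj \<Sigma>) (PfPfInt \<Sigma>) a (T, str) A.ana \<and> Cmp (Lax_Inj \<Sigma>) counit A.ana = g"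
      unfolding Y chom_Lax using c str_lax A.ana_lax A.ana_str A.ana_counit co[OF A.ana_lax]
      by (simp del: A.ana_simps(3) Lax_simps)
  next
    fix h assume h: "endo.chom (Lax_Inj \<Sigma>) (PfPfInt \<Sigma>) a (T, str) h \<and> Cmp (Lax_Inj \<Sigma>) counit h = g"
    then have h': "lax_inj \<Sigma> h" "src h = Y" "tgt h = T" unfolding Y chom_Lax by auto
    show "h = A.ana"
      by (rule A.ana_unique) (use h h' co[OF h'] c(2) in \<open>auto simp: Y chom_Lax simp del: Lax_simps\<close>)
  qed
qed

theorem cofree_adjunction_ex: "\<exists>R \<eta> \<epsilon>. cofree_adjunction (Lax_Inj \<Sigma>) (PfPfInt \<Sigma>) R \<eta> \<epsilon>"
proof (rule endo.cofree_on_ex[OF endo_Lax])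
  fix X :: "('a, 'b univ) psh" assume "X \<in> Obj (Lax_Inj \<Sigma>)"
  then interpret base_psh \<Sigma> X by unfold_locales simp
  show "\<exists>t e. endo.cofree_on (Lax_Inj \<Sigma>) (PfPfInt \<Sigma>) X t e" using cofree by blast
qed

section \<open>Most general matchers\<close>

lemma subst_in_terms_vars: "t \<in> terms \<Sigma> m \<Longrightarrow> (\<And>v. v \<in> vars t \<Longrightarrow> s v \<in> terms \<Sigma> n) \<Longrightarrow> subst s t \<in> terms \<Sigma> n"
proof (induction rule: terms.induct)
  case (2 f ts)
  then show ?case by (fastforce intro!: terms.intros)
qed simp

lemma terms_Fun: "Fun f ts \<in> terms \<Sigma> n \<longleftrightarrow> (f, length ts) \<in> \<Sigma> \<and> (\<forall>t\<in>set ts. t \<in> terms \<Sigma> n)"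
  by (auto elim: terms.cases intro: terms.intros)

lemma subst_terms_vars: "subst s t \<in> terms \<Sigma> n \<Longrightarrow> v \<in> vars t \<Longrightarrow> s v \<in> terms \<Sigma> n"
  by (induction t) (auto simp: terms_Fun)

lemma subst_eq_vars: "subst s t = subst r t \<Longrightarrow> v \<in> vars t \<Longrightarrow> s v = r v"
  by (induction t) auto

lemma finite_vars: "finite (vars t)"
  by (induction t) auto

definition avars :: "('p, 'f) atm \<Rightarrow> nat set" where
  "avars A = (\<Union>t\<in>set (snd A). vars t)"

definition exvars :: "('p, 'f) clause \<Rightarrow> nat set" where
  "exvars c = clause_vars c - avars (fst c)"

lemma clause_vars_avars: "clause_vars c = (\<Union>A\<in>clause_atoms c. avars A)"
  by (simp add: clause_vars_def avars_def)

lemma finite_exvars: "finite (exvars c)"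
  by (auto simp: exvars_def clause_vars_def clause_atoms_def finite_vars)

lemma asubst_cong: "(\<And>v. v \<in> avars A \<Longrightarrow> s v = r v) \<Longrightarrow> asubst s A = asubst r A"
  by (auto simp: asubst_def avars_def intro!: subst_cong)

lemma asubst_eq_vars: "asubst s A = asubst r A \<Longrightarrow> v \<in> avars A \<Longrightarrow> s v = r v"
  by (auto simp: asubst_def avars_def dest: subst_eq_vars)

lemma asubst_asubst: "asubst s (asubst r A) = asubst (\<lambda>v. subst s (r v)) A"
  by (simp add: asubst_def subst_subst)

lemma asubst_terms:
  assumes "set (snd A) \<subseteq> terms \<Sigma> m" "\<And>i. i < m \<Longrightarrow> s i = r i"
  shows "asubst s A = asubst r A"
  using assms terms_vars by (intro asubst_cong) (fastforce simp: avars_def)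

text \<open>The most general matchers in normal form: the existential variables are numbered
  consecutively from \<open>n\<close>.\<close>

definition canonical :: "nat \<Rightarrow> nat \<Rightarrow> ('p, 'f) clause \<Rightarrow> ('p, 'f) atm \<Rightarrow> (nat \<Rightarrow> 'f trm) \<Rightarrow> bool" where
  "canonical n k c A \<theta> \<longleftrightarrow> asubst \<theta> (fst c) = A \<and>
     (\<exists>e. bij_betw e (exvars c) {..<k} \<and> (\<forall>v\<in>exvars c. \<theta> v = Var (n + e v)))"

text \<open>No unification is involved: a matcher is forced on the variables of the head and may be
  redefined on the others, of which there are finitely many.\<close>

lemma canonical_ex:
  assumes "asubst \<sigma> (fst c) = A"
  shows "\<exists>k \<theta>. canonical n k c A \<theta>"
proof -
  obtain e where e: "bij_betw e (exvars c) {..<card (exvars c)}"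
    using ex_bij_betw_finite_nat[OF finite_exvars[of c]] by (auto simp: lessThan_atLeast0)
  let ?\<theta> = "\<lambda>v. if v \<in> exvars c then Var (n + e v) else \<sigma> v"
  have "asubst ?\<theta> (fst c) = asubst \<sigma> (fst c)" by (rule asubst_cong) (simp add: exvars_def)
  then have "canonical n (card (exvars c)) c A ?\<theta>" using e assms by (auto simp: canonical_def)
  then show ?thesis by blast
qed

lemma canonical_vars:
  assumes "canonical n k c A \<theta>" "set (snd A) \<subseteq> terms \<Sigma> n"
  shows "v \<in> avars (fst c) \<Longrightarrow> \<theta> v \<in> terms \<Sigma> n" and "v \<in> clause_vars c \<Longrightarrow> \<theta> v \<in> terms \<Sigma> (n + k)"
proof -
  show *: "\<theta> v \<in> terms \<Sigma> n" if v: "v \<in> avars (fst c)" for v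
  proof -
    obtain t where t: "t \<in> set (snd (fst c))" "v \<in> vars t" using v by (auto simp: avars_def)
    then have "subst \<theta> t \<in> terms \<Sigma> n" using assms by (auto simp: canonical_def asubst_def)
    then show ?thesis using t(2) by (rule subst_terms_vars)
  qed
  show "\<theta> v \<in> terms \<Sigma> (n + k)" if "v \<in> clause_vars c"
  proof (cases "v \<in> exvars c")
    case True
    then obtain e where e: "bij_betw e (exvars c) {..<k}" "\<theta> v = Var (n + e v)"
      using assms(1) by (auto simp: canonical_def)
    then have "e v < k" using True by (auto simp: bij_betw_def)
    then show ?thesis by (simp add: e(2) terms.intros)
  next
    case False
    then show ?thesis using *[of v] that terms_mono[of "\<theta> v" \<Sigma> n "n + k"] by (auto simp: exvars_def)
  qed
qed

lemma canonical_mgm: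
  assumes can: "canonical n k c A \<theta>" and A: "set (snd A) \<subseteq> terms \<Sigma> n"
  shows "mgm \<Sigma> n (n + k) c A \<theta>"
  unfolding mgm_def
proof (intro conjI allI impI)
  show "n \<le> n + k" by simp
  show "matcher \<Sigma> (n + k) c A \<theta>"
    unfolding matcher_def using canonical_vars(2)[OF can A] can by (simp add: canonical_def)
  fix m' \<sigma> assume \<sigma>: "n \<le> m' \<and> matcher \<Sigma> m' c A \<sigma>"
  obtain e where e: "bij_betw e (exvars c) {..<k}" "\<forall>v\<in>exvars c. \<theta> v = Var (n + e v)"
    using can by (auto simp: canonical_def)
  \<comment> \<open>The variable \<open>n + j\<close> of the normal form stands for the existential
    variable with number \<open>j\<close>, so \<tau> has to return the value of \<sigma>
    there.\<close>
  define \<tau> where "\<tau> i = (if i < n then Var i else \<sigma> (the_inv_into (exvars c) e (i - n)))" for i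
  have inv: "the_inv_into (exvars c) e j \<in> exvars c" if "j < k" for j
    using the_inv_into_into[OF bij_betw_imp_inj_on[OF e(1)], of j "exvars c"] e(1) that by (auto simp: bij_betw_def)
  have "\<tau> i \<in> terms \<Sigma> m'" if "i < n + k" for i
  proof (cases "i < n")
    case True then show ?thesis using \<sigma> by (auto simp: \<tau>_def intro: terms.intros)
  next
    case False then show ?thesis using \<sigma> inv[of "i - n"] that by (auto simp: \<tau>_def matcher_def exvars_def)
  qed
  moreover have "\<sigma> v = subst \<tau> (\<theta> v)" if "v \<in> clause_vars c" for v
  proof (cases "v \<in> exvars c")
    case True
    then show ?thesis using e the_inv_into_f_f[OF bij_betw_imp_inj_on[OF e(1)]] by (simp add: \<tau>_def)
  next
    case False
    then have v: "v \<in> avars (fst c)" using that by (simp add: exvars_def)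
    then have "\<sigma> v = \<theta> v" using \<sigma> can by (intro asubst_eq_vars[of \<sigma> "fst c" \<theta>]) (auto simp: matcher_def canonical_def)
    moreover have "subst \<tau> (\<theta> v) = subst Var (\<theta> v)"
      by (rule subst_nth_cong[OF canonical_vars(1)[OF can A v]]) (simp add: \<tau>_def)
    ultimately show ?thesis by (simp add: subst_Var)
  qed
  ultimately show "\<exists>\<tau>. (\<forall>i<n. \<tau> i = Var i) \<and> (\<forall>i<n + k. \<tau> i \<in> terms \<Sigma> m') \<and> (\<forall>v\<in>clause_vars c. \<sigma> v = subst \<tau> (\<theta> v))"
    by (intro exI[of _ \<tau>]) (simp add: \<tau>_def)
qed

lemma mgm_canonical_iff:
  assumes "set (snd A) \<subseteq> terms \<Sigma> n"
  shows "(\<exists>m \<theta>. mgm \<Sigma> n m c A \<theta>) \<longleftrightarrow> (\<exists>k \<theta>. canonical n k c A \<theta>)"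
proof
  assume "\<exists>m \<theta>. mgm \<Sigma> n m c A \<theta>"
  then obtain \<theta> where "asubst \<theta> (fst c) = A" unfolding mgm_def matcher_def by blast
  then show "\<exists>k \<theta>. canonical n k c A \<theta>" by (rule canonical_ex)
qed (use canonical_mgm[OF _ assms] in blast)

text \<open>Comparing the normal form with another most general matcher in both directions shows that
  the latter sends the existential variables to distinct variables outside the context.\<close>

lemma mgm_canonical:
  assumes can: "canonical n k c A \<theta>0" and A: "set (snd A) \<subseteq> terms \<Sigma> n" and mg: "mgm \<Sigma> n m c A \<theta>"
  obtains w where "w \<in> injs k (m - n)" "\<And>v. v \<in> clause_vars c \<Longrightarrow> \<theta> v = subst ((!) (J (shift n w))) (\<theta>0 v)"
proof -
  have nm: "n \<le> m" and ma: "matcher \<Sigma> m c A \<theta>" using mg by (auto simp: mgm_def)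
  have m0: "matcher \<Sigma> (n + k) c A \<theta>0" using canonical_mgm[OF can A] by (simp add: mgm_def)
  obtain \<tau> where \<tau>: "\<forall>i<n. \<tau> i = Var i" "\<forall>v\<in>clause_vars c. \<theta>0 v = subst \<tau> (\<theta> v)"
    using mg m0 unfolding mgm_def by (metis le_add1)
  obtain e where e: "bij_betw e (exvars c) {..<k}" "\<forall>v\<in>exvars c. \<theta>0 v = Var (n + e v)"
    using can by (auto simp: canonical_def)
  \<comment> \<open>\<tau> takes \<open>\<theta> v\<close> back to a variable, so
    \<open>\<theta> v\<close> is a variable as well. It lies outside the context because \<tau>
    fixes the context, and it determines \<open>v\<close> because \<tau> returns the number of
    \<open>v\<close>.\<close>
  have "\<exists>x. \<theta> v = Var x \<and> x < m \<and> n \<le> x \<and> \<tau> x = Var (n + e v)" if v: "v \<in> exvars c" for v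
  proof -
    have s: "subst \<tau> (\<theta> v) = Var (n + e v)" using \<tau>(2) e(2) v by (simp add: exvars_def)
    then obtain x where x: "\<theta> v = Var x" by (cases "\<theta> v") auto
    have "\<theta> v \<in> terms \<Sigma> m" using ma v by (simp add: matcher_def exvars_def)
    then have "x < m" using terms_vars[of "\<theta> v"] x by auto
    moreover have "n \<le> x" using s x \<tau>(1) by (cases "x < n") auto
    ultimately show ?thesis using s x by auto
  qed
  then obtain \<rho> where \<rho>: "\<And>v. v \<in> exvars c \<Longrightarrow> \<theta> v = Var (\<rho> v) \<and> \<rho> v < m \<and> n \<le> \<rho> v \<and> \<tau> (\<rho> v) = Var (n + e v)"
    by metis
  define iv where "iv = the_inv_into (exvars c) e"
  have iv: "iv j \<in> exvars c" "e (iv j) = j" if "j < k" for j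
    using the_inv_into_into[OF bij_betw_imp_inj_on[OF e(1)], of j "exvars c"]
      f_the_inv_into_f[OF bij_betw_imp_inj_on[OF e(1)], of j] e(1) that by (auto simp: bij_betw_def iv_def)
  have ive: "iv (e v) = v" "e v < k" if "v \<in> exvars c" for v
    using the_inv_into_f_f[OF bij_betw_imp_inj_on[OF e(1)]] e(1) that by (auto simp: iv_def bij_betw_def)
  define w where "w = map (\<lambda>j. \<rho> (iv j) - n) [0..<k]"
  have "inj_on (\<lambda>j. \<rho> (iv j) - n) {0..<k}"
  proof (rule inj_onI)
    fix i j assume ij: "i \<in> {0..<k}" "j \<in> {0..<k}" "\<rho> (iv i) - n = \<rho> (iv j) - n"
    then have l: "i < k" "j < k" by auto
    have "\<rho> (iv i) = \<rho> (iv j)" using \<rho>[OF iv(1)[OF l(1)]] \<rho>[OF iv(1)[OF l(2)]] ij(3) by linarith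
    moreover have "\<tau> (\<rho> (iv i)) = Var (n + i)" "\<tau> (\<rho> (iv j)) = Var (n + j)"
      using \<rho>[OF iv(1)[OF l(1)]] \<rho>[OF iv(1)[OF l(2)]] iv(2)[OF l(1)] iv(2)[OF l(2)] by simp_all
    ultimately show "i = j" by (metis add_left_cancel trm.inject(1))
  qed
  moreover have "\<rho> (iv j) - n < m - n" if "j < k" for j using \<rho>[OF iv(1)[OF that]] by auto
  ultimately have w: "w \<in> injs k (m - n)" by (auto simp: injs_def w_def distinct_map)
  have "\<theta> v = subst ((!) (J (shift n w))) (\<theta>0 v)" if v: "v \<in> clause_vars c" for v
  proof (cases "v \<in> exvars c")
    case True
    then show ?thesis using \<rho>[OF True] e(2) ive[OF True]
      by (simp add: J_shift nth_append law_id_def w_def)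
  next
    case False
    then have v: "v \<in> avars (fst c)" using v by (simp add: exvars_def)
    then have "\<theta> v = \<theta>0 v" using ma can by (intro asubst_eq_vars[of \<theta> "fst c" \<theta>0]) (auto simp: matcher_def canonical_def)
    moreover have "subst ((!) (J (shift n w))) (\<theta>0 v) = subst Var (\<theta>0 v)"
      by (rule subst_nth_cong[OF canonical_vars(1)[OF can A v]]) (simp add: J_shift nth_append law_id_def)
    ultimately show ?thesis by (simp add: subst_Var)
  qed
  with w show thesis using that by blast
qed

text \<open>A clause that matches an atom also matches its instances, with the same number of
  existential variables. Instances may match further clauses, hence the laxness of the program
  map.\<close>

lemma canonical_subst:
  assumes can: "canonical m k c A \<theta>" and A: "set (snd A) \<subseteq> terms \<Sigma> m" and f: "f \<in> law \<Sigma> n m"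
  shows "canonical n k c (asubst ((!) f) A) (\<lambda>v. subst ((!) (law_plus n k f)) (\<theta> v))"
proof -
  note l = law_length[OF f]
  have "asubst (\<lambda>v. subst ((!) (law_plus n k f)) (\<theta> v)) (fst c) = asubst ((!) (law_plus n k f)) A"
    using can by (simp add: asubst_asubst[symmetric] canonical_def)
  also have "\<dots> = asubst ((!) f) A"
    by (rule asubst_terms[OF A]) (simp add: law_plus_def nth_append l)
  finally have "asubst (\<lambda>v. subst ((!) (law_plus n k f)) (\<theta> v)) (fst c) = asubst ((!) f) A" .
  moreover obtain e where e: "bij_betw e (exvars c) {..<k}" "\<forall>v\<in>exvars c. \<theta> v = Var (m + e v)"
    using can by (auto simp: canonical_def)
  moreover have "e v < k" if "v \<in> exvars c" for v using e(1) that by (auto simp: bij_betw_def)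
  ultimately show ?thesis
    unfolding canonical_def by (auto intro!: exI[of _ e] simp: law_plus_def nth_append l)
qed

text \<open>A renaming can be undone on the variables of \<open>A\<close>, so the renamed atom
  matches no further clauses. This gives strictness on injections.\<close>

lemma canonical_unrename:
  fixes A :: "('p, 'f) atm"
  assumes "canonical n k c (asubst ((!) (J i)) A) \<theta>" "i \<in> injs m n" "set (snd A) \<subseteq> terms \<Sigma> m"
  shows "\<exists>k \<theta>. canonical m k c A \<theta>"
proof -
  define \<rho> :: "nat \<Rightarrow> 'f trm" where "\<rho> x = Var (the_inv_into {..<m} ((!) i) x)" for x
  have i: "inj_on ((!) i) {..<m}" "length i = m" using assms(2) by (auto simp: injs_def inj_on_nth)
  have "asubst (\<lambda>v. subst \<rho> (\<theta> v)) (fst c) = asubst \<rho> (asubst ((!) (J i)) A)"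
    using assms(1) by (simp add: canonical_def asubst_asubst[symmetric])
  also have "\<dots> = asubst Var A"
    unfolding asubst_asubst by (rule asubst_terms[OF assms(3)]) (simp add: J_def \<rho>_def i the_inv_into_f_f)
  also have "\<dots> = A" by (simp add: asubst_def subst_Var[abs_def])
  finally show ?thesis using canonical_ex by blast
qed

section \<open>Logic programs as coalgebras\<close>

lemma atoms_asubst: "A \<in> atoms \<Sigma> P m \<Longrightarrow> f \<in> law \<Sigma> n m \<Longrightarrow> asubst ((!) f) A \<in> atoms \<Sigma> P n"
  by (auto simp: atoms_def asubst_def intro!: subst_in_terms[of _ \<Sigma> m] law_nth)

lemma atoms_terms: "A \<in> atoms \<Sigma> P n \<Longrightarrow> set (snd A) \<subseteq> terms \<Sigma> n"
  by (auto simp: atoms_def)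

lemma At_pts: "pts (ob (At \<Sigma> P) n) = Atm ` atoms \<Sigma> P n" and At_le: "le (ob (At \<Sigma> P) n) = Id_on (Atm ` atoms \<Sigma> P n)"
  by (auto simp: At_def At_ob_def)

lemma Atm_inject [simp]: "Atm A = Atm B \<longleftrightarrow> A = B"
  by (simp add: Atm_def)

lemma At_act: "A \<in> atoms \<Sigma> P m \<Longrightarrow> f \<in> law \<Sigma> n m \<Longrightarrow> act (At \<Sigma> P) n f (Atm A) = Atm (asubst ((!) f) A)"
  by (simp add: At_def act_on_eq At_ob_def) (simp add: Atm_def)

lemma At_presheaf: "presheaf \<Sigma> (At \<Sigma> P)"
  unfolding At_def
proof (rule presheafI)
  let ?\<phi> = "\<lambda>f x. case x of Elem (Inl A) \<Rightarrow> Atm (asubst ((!) f) A)"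
  fix n m f x assume f: "f \<in> law \<Sigma> n m" and "x \<in> pts (At_ob \<Sigma> P m)"
  then obtain A where A: "A \<in> atoms \<Sigma> P m" "x = Atm A" by (auto simp: At_ob_def)
  then show "?\<phi> f x \<in> pts (At_ob \<Sigma> P n)"
    using atoms_asubst[OF A(1) f] by (simp add: At_ob_def Atm_def)
next
  let ?\<phi> = "\<lambda>f x. case x of Elem (Inl A) \<Rightarrow> Atm (asubst ((!) f) A)"
  fix n m f x y assume f: "f \<in> law \<Sigma> n m" and "(x, y) \<in> le (At_ob \<Sigma> P m)"
  then obtain A where A: "A \<in> atoms \<Sigma> P m" "x = Atm A" "y = Atm A" by (auto simp: At_ob_def)
  then show "(?\<phi> f x, ?\<phi> f y) \<in> le (At_ob \<Sigma> P n)"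
    using atoms_asubst[OF A(1) f] by (auto simp: At_ob_def Atm_def Id_on_def)
next
  let ?\<phi> = "\<lambda>f x. case x of Elem (Inl A) \<Rightarrow> Atm (asubst ((!) f) A)"
  fix n x assume "x \<in> pts (At_ob \<Sigma> P n)"
  then obtain A where A: "A \<in> atoms \<Sigma> P n" "x = Atm A" by (auto simp: At_ob_def)
  have "asubst ((!) (law_id n)) A = asubst Var A"
    by (rule asubst_terms[OF atoms_terms[OF A(1)]]) (simp add: law_id_def)
  also have "\<dots> = A" by (simp add: asubst_def subst_Var[abs_def])
  finally show "?\<phi> (law_id n) x = x" by (simp add: A(2) Atm_def)
next
  let ?\<phi> = "\<lambda>f x. case x of Elem (Inl A) \<Rightarrow> Atm (asubst ((!) f) A)"
  fix n m k f g x assume f: "f \<in> law \<Sigma> n m" and g: "g \<in> law \<Sigma> m k" and "x \<in> pts (At_ob \<Sigma> P k)"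
  then obtain A where A: "A \<in> atoms \<Sigma> P k" "x = Atm A" by (auto simp: At_ob_def)
  have "asubst ((!) (law_comp g f)) A = asubst (\<lambda>v. subst ((!) f) (g ! v)) A"
    by (rule asubst_terms[OF atoms_terms[OF A(1)]]) (simp add: law_comp_def law_length[OF g])
  then show "?\<phi> (law_comp g f) x = ?\<phi> f (?\<phi> g x)" by (simp add: A(2) Atm_def asubst_asubst)
qed (auto simp: At_ob_def)

text \<open>\<open>urelements\<close> fixes the type \<open>'e\<close>, which occurs neither in
  \<Sigma> nor in \<open>P\<close>.\<close>

locale program =
  fixes \<Sigma> :: "'f sig" and P :: "('p, 'f) clause set" and urelements :: "'e itself"
  assumes P: "logic_program \<Sigma> P"
begin

abbreviation AtP :: "('f, ('p, 'f, 'e) luniv) psh" where "AtP \<equiv> At \<Sigma> P"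

lemma asubst_clause:
  assumes "c \<in> P" "B \<in> clause_atoms c" "\<And>v. v \<in> clause_vars c \<Longrightarrow> \<theta> v \<in> terms \<Sigma> m"
  shows "asubst \<theta> B \<in> atoms \<Sigma> P m"
proof -
  have "(fst B, length (snd B)) \<in> preds P" using assms(1,2) unfolding preds_def by blast
  moreover have "subst \<theta> t \<in> terms \<Sigma> m" if t: "t \<in> set (snd B)" for t
  proof -
    obtain m0 where "t \<in> terms \<Sigma> m0" using P assms(1,2) t unfolding logic_program_def by blast
    then show ?thesis using assms(2,3) t by (intro subst_in_terms_vars) (auto simp: clause_vars_def)
  qed
  ultimately show ?thesis by (auto simp: atoms_def asubst_def)
qed

lemma asubst_body:
  "c \<in> P \<Longrightarrow> B \<in> set (snd c) \<Longrightarrow> canonical n k c A \<theta> \<Longrightarrow> A \<in> atoms \<Sigma> P n \<Longrightarrow> asubst \<theta> B \<in> atoms \<Sigma> P (n + k)"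
  using asubst_clause[of c B \<theta> "n + k"] canonical_vars(2)[of n k c A \<theta> \<Sigma>] atoms_terms[of A \<Sigma> P n]
  by (auto simp: clause_atoms_def)

definition body :: "('p, 'f) clause \<Rightarrow> nat \<Rightarrow> (nat \<Rightarrow> 'f trm) \<Rightarrow> (nat \<times> ('p, 'f, 'e) luniv) set" where
  "body c k \<theta> = (\<lambda>B. (k, Atm (asubst \<theta> B))) ` set (snd c)"

definition matches :: "nat \<Rightarrow> ('p, 'f) atm \<Rightarrow> ('p, 'f) clause set" where
  "matches n A = {c \<in> P. \<exists>k \<theta>. canonical n k c A \<theta>}"

definition pick :: "nat \<Rightarrow> ('p, 'f) atm \<Rightarrow> ('p, 'f) clause \<Rightarrow> nat \<times> (nat \<Rightarrow> 'f trm)" where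
  "pick n A c = (SOME x. canonical n (fst x) c A (snd x))"

definition cbody :: "nat \<Rightarrow> ('p, 'f) atm \<Rightarrow> ('p, 'f) clause \<Rightarrow> (nat \<times> ('p, 'f, 'e) luniv) set" where
  "cbody n A c = body c (fst (pick n A c)) (snd (pick n A c))"

lemma pick: "c \<in> matches n A \<Longrightarrow> canonical n (fst (pick n A c)) c A (snd (pick n A c))"
  unfolding pick_def by (rule someI_ex) (auto simp: matches_def)

lemma valid_body:
  "c \<in> P \<Longrightarrow> canonical n k c A \<theta> \<Longrightarrow> A \<in> atoms \<Sigma> P n \<Longrightarrow> p \<in> body c k \<theta> \<Longrightarrow> valid AtP n p"
  unfolding body_def valid_def At_pts using asubst_body[of c _ n k A \<theta>] by fastforce

lemma finite_body: "finite (body c k \<theta>)" by (simp add: body_def)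

text \<open>The normal form becomes the given matcher after an injection \<open>w\<close> of the
  added variables, and the colimit identifies an element with its image under such an
  injection.\<close>

lemma inc_mgm:
  assumes c: "c \<in> P" and A: "A \<in> atoms \<Sigma> P n" and can: "canonical n k c A \<theta>0" and mg: "mgm \<Sigma> n m c A \<theta>"
    and B: "B \<in> set (snd c)"
  shows "valid AtP n (m - n, Atm (asubst \<theta> B))"
    "inc AtP n (m - n, Atm (asubst \<theta> B)) = inc AtP n (k, Atm (asubst \<theta>0 B))"
proof -
  obtain w where w: "w \<in> injs k (m - n)" "\<And>v. v \<in> clause_vars c \<Longrightarrow> \<theta> v = subst ((!) (J (shift n w))) (\<theta>0 v)"
    by (rule mgm_canonical[OF can atoms_terms[OF A] mg]) blast
  have a: "asubst \<theta>0 B \<in> atoms \<Sigma> P (n + k)" using asubst_body[OF c B can A] .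
  note J = J_law[OF shift_injs[OF w(1), of n]]
  have B': "asubst \<theta> B = asubst ((!) (J (shift n w))) (asubst \<theta>0 B)"
    unfolding asubst_asubst by (rule asubst_cong) (use w(2) B in \<open>auto simp: clause_vars_avars clause_atoms_def\<close>)
  have a': "asubst \<theta> B \<in> atoms \<Sigma> P (n + (m - n))" unfolding B' by (rule atoms_asubst[OF a J])
  then show v: "valid AtP n (m - n, Atm (asubst \<theta> B))" by (simp add: valid_def At_pts)
  have v0: "valid AtP n (k, Atm (asubst \<theta>0 B))" using a by (simp add: valid_def At_pts)
  have "act AtP (n + (m - n)) (J [0..<n + (m - n)]) (Atm (asubst \<theta> B)) = Atm (asubst \<theta> B)"
    unfolding J_upt by (rule presheaf_id[OF At_presheaf]) (use a' in \<open>simp add: At_pts\<close>)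
  moreover have "act AtP (n + (m - n)) (J (shift n w)) (Atm (asubst \<theta>0 B)) = Atm (asubst \<theta> B)"
    unfolding B' by (rule At_act[OF a J])
  ultimately have "IR (act AtP) (XR AtP True) n (m - n, Atm (asubst \<theta> B)) (k, Atm (asubst \<theta>0 B))"
    unfolding IR_def using w(1) upt_injs[of "m - n" "m - n"] a'
    by (intro exI[of _ "m - n"] bexI[of _ "[0..<m - n]"] bexI[of _ w]) (auto simp: shift_upt XR_def At_pts)
  then show "inc AtP n (m - n, Atm (asubst \<theta> B)) = inc AtP n (k, Atm (asubst \<theta>0 B))"
    using inc_eq[OF At_presheaf v v0] by simp
qed

lemma inc_cbody:
  assumes c: "c \<in> P" and A: "A \<in> atoms \<Sigma> P n" and can: "canonical n k c A \<theta>"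
  shows "c \<in> matches n A" "inc AtP n ` body c k \<theta> = inc AtP n ` cbody n A c"
proof -
  show c': "c \<in> matches n A" using c can by (auto simp: matches_def)
  show "inc AtP n ` body c k \<theta> = inc AtP n ` cbody n A c"
    using inc_mgm(2)[OF c A pick[OF c'] canonical_mgm[OF can atoms_terms[OF A]]]
    by (force simp: body_def cbody_def image_iff)
qed

lemma good_prog: "A \<in> atoms \<Sigma> P n \<Longrightarrow> good AtP n (cbody n A ` matches n A)"
proof -
  assume A: "A \<in> atoms \<Sigma> P n"
  have "finite (matches n A)" using P by (simp add: logic_program_def matches_def)
  moreover have "valid AtP n p" if "c \<in> matches n A" "p \<in> cbody n A c" for c p
    using valid_body[OF _ pick[OF that(1)] A, of p] that by (simp add: matches_def cbody_def)
  ultimately show ?thesis by (auto simp: good_def cbody_def finite_body)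
qed

text \<open>The definition collects over all contexts \<open>m\<close> and all most general
  matchers. By \<open>inc_mgm\<close> each clause contributes a single set, so the collection is
  finite and \<open>fin\<close> has its intended value.\<close>

lemma prog_Atm:
  assumes A: "A \<in> atoms \<Sigma> P n"
  shows "cmpt (prog_map \<Sigma> P) n (Atm A) = enc AtP n (cbody n A ` matches n A)"
proof -
  have "{fin ((\<lambda>B. incl AtP n m (Atm (asubst \<theta> B))) ` set (snd c)) | c m \<theta> A'.
      (Atm A :: ('p, 'f, 'e) luniv) = Atm A' \<and> c \<in> P \<and> mgm \<Sigma> n m c A' \<theta>} = (\<lambda>S. fin (inc AtP n ` S)) ` cbody n A ` matches n A" (is "?L = ?R")
  proof (intro set_eqI iffI)
    fix x assume "x \<in> ?L"
    then obtain c m \<theta> where x: "x = fin ((\<lambda>B. incl AtP n m (Atm (asubst \<theta> B))) ` set (snd c))" "c \<in> P" "mgm \<Sigma> n m c A \<theta>"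
      by auto
    then have c: "c \<in> matches n A" using mgm_canonical_iff[OF atoms_terms[OF A], of c] by (auto simp: matches_def)
    have "n + (m - n) = m" using x(3) by (simp add: mgm_def)
    then have "(\<lambda>B. incl AtP n m (Atm (asubst \<theta> B))) ` set (snd c) = inc AtP n ` cbody n A c"
      using inc_mgm(2)[OF x(2) A pick[OF c] x(3)] by (force simp: inc_def cbody_def body_def image_iff)
    then have "x = fin (inc AtP n ` cbody n A c)" using x(1) by simp
    then show "x \<in> ?R" using c by blast
  next
    fix x assume "x \<in> ?R"
    then obtain c where c: "c \<in> matches n A" "x = fin (inc AtP n ` cbody n A c)" by auto
    have "x = fin ((\<lambda>B. incl AtP n (n + fst (pick n A c)) (Atm (asubst (snd (pick n A c)) B))) ` set (snd c))"
      by (simp add: c(2) cbody_def body_def image_image inc_def)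
    moreover have "c \<in> P" using c(1) by (simp add: matches_def)
    ultimately show "x \<in> ?L" using canonical_mgm[OF pick[OF c(1)] atoms_terms[OF A]] by blast
  qed
  moreover have "cmpt (prog_map \<Sigma> P) n (Atm A) = fin ?L"
    unfolding prog_map_def lax.select_convs using A by (subst restrict_apply') (auto simp only: At_ob_def proset.select_convs)
  ultimately show ?thesis by (simp only: enc_def)
qed

lemma papp_body:
  assumes c: "c \<in> P" and A: "A \<in> atoms \<Sigma> P m" and can: "canonical m k c A \<theta>" and f: "f \<in> law \<Sigma> n m"
  shows "papp (act AtP) n f ` body c k \<theta> = body c k (\<lambda>v. subst ((!) (law_plus n k f)) (\<theta> v))"
proof -
  have "papp (act AtP) n f (k, Atm (asubst \<theta> B)) = (k, Atm (asubst (\<lambda>v. subst ((!) (law_plus n k f)) (\<theta> v)) B))"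
    if "B \<in> set (snd c)" for B
    using At_act[OF asubst_body[OF c that can A] law_plus_law[OF f]] by (simp add: papp_def asubst_asubst)
  then show ?thesis by (force simp: body_def image_iff)
qed

lemma prog_lax: "lax_inj \<Sigma> (prog_map \<Sigma> P :: ('f, ('p, 'f, 'e) luniv) lax)"
proof -
  let ?A = "AtP :: ('f, ('p, 'f, 'e) luniv) psh" and ?p = "prog_map \<Sigma> P :: ('f, ('p, 'f, 'e) luniv) lax"
  let ?F = "fob (PfPfInt \<Sigma>) ?A"
  have H: "presheaf \<Sigma> ?A" by (rule At_presheaf)
  have key: "XR ?F b n (act ?F n f (cmpt ?p m (Atm A))) (cmpt ?p n (act ?A n f (Atm A)))"
    if f: "f \<in> law \<Sigma> n m" and A: "A \<in> atoms \<Sigma> P m" and b: "b \<Longrightarrow> \<exists>i\<in>injs m n. f = J i" for b n m f A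
  proof -
    let ?B = "asubst ((!) f) A"
    have B: "?B \<in> atoms \<Sigma> P n" using atoms_asubst[OF A f] .
    have c1: "c \<in> matches n ?B \<and> inc ?A n ` papp (act ?A) n f ` cbody m A c = inc ?A n ` cbody n ?B c"
      if c: "c \<in> matches m A" for c
    proof -
      have cP: "c \<in> P" using c by (simp add: matches_def)
      note can = canonical_subst[OF pick[OF c] atoms_terms[OF A] f]
      have "papp (act ?A) n f ` cbody m A c = body c (fst (pick m A c))
          (\<lambda>v. subst ((!) (law_plus n (fst (pick m A c)) f)) (snd (pick m A c) v))"
        unfolding cbody_def by (rule papp_body[OF cP A pick[OF c] f])
      then show ?thesis using inc_cbody(1)[OF cP B can] by (simp only: inc_cbody(2)[OF cP B can] simp_thms)
    qed
    \<comment> \<open>Equal sets in the colimit satisfy the two-sided lifting of equality, which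
      implies what either value of \<open>b\<close> asks for.\<close>
    have PRS: "PR b (IR (act ?A) (XR ?A b) n) S S'"
      if "inc ?A n ` S = inc ?A n ` S'" "\<forall>p\<in>S. valid ?A n p" "\<forall>p\<in>S'. valid ?A n p" for S S'
    proof -
      have "PR True (\<lambda>p q. inc ?A n p = inc ?A n q) S S'"
        using that(1) unfolding PR_def by (metis (mono_tags, lifting) imageE imageI)
      then have "PR b (\<lambda>p q. inc ?A n p = inc ?A n q) S S'" unfolding PR_def by blast
      then show ?thesis
        by (rule PR_mono_mem) (use that inc_eq[OF H] XR_weak[OF H] in \<open>blast intro: IR_mono\<close>)
    qed
    let ?Z = "(`) (papp (act ?A) n f) ` cbody m A ` matches m A" and ?Z' = "cbody n ?B ` matches n ?B"
    have gZ: "good ?A n ?Z" "good ?A n ?Z'" using good_papp[OF H f good_prog[OF A]] good_prog[OF B] by auto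
    have PRc: "PR b (IR (act ?A) (XR ?A b) n) (papp (act ?A) n f ` cbody m A c) (cbody n ?B c)" if "c \<in> matches m A" for c
      using c1[OF that] gZ that by (intro PRS) (auto simp: good_def)
    \<comment> \<open>Only equality requires that every clause matching the instance already matches
      \<open>A\<close>; this is where \<open>f\<close> has to be a renaming.\<close>
    have "matches n ?B \<subseteq> matches m A" if b
    proof
      fix c assume "c \<in> matches n ?B"
      then obtain k \<theta> where c: "c \<in> P" "canonical n k c ?B \<theta>" by (auto simp: matches_def)
      obtain i where i: "i \<in> injs m n" "f = J i" using b \<open>b\<close> by blast
      show "c \<in> matches m A"
        using canonical_unrename[OF c(2)[unfolded i(2)] i(1) atoms_terms[OF A]] c(1) by (simp add: matches_def)
    qed
    then have "PR b (PR b (IR (act ?A) (XR ?A b) n)) ?Z ?Z'"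
      using PRc c1 unfolding PR_def[of b "PR b (IR (act ?A) (XR ?A b) n)"] by blast
    then show ?thesis
      using F_XR[OF H gZ, of b] F_act[OF H f good_prog[OF A]] prog_Atm[OF A] prog_Atm[OF B]
      by (simp add: At_act[OF A f])
  qed
  have eq: "?p = mk_lax ?A ?F (cmpt ?p)"
    by (simp add: prog_map_def mk_lax_def At_def restrict_def fun_eq_iff)
  show ?thesis
  proof (subst eq, rule lax_mk_lax[OF H F_presheaf[OF H]])
    show p: "cmpt ?p n x \<in> pts (ob ?F n)" if "x \<in> pts (ob ?A n)" for n x
      using that enc_in[OF H good_prog] by (auto simp: At_pts prog_Atm)
    show "(cmpt ?p n x, cmpt ?p n y) \<in> le (ob ?F n)" if "(x, y) \<in> le (ob ?A n)" for n x y
      using that presheaf_refl[OF F_presheaf[OF H]] p by (auto simp: At_le At_pts)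
    show "(act ?F n f (cmpt ?p m x), cmpt ?p n (act ?A n f x)) \<in> le (ob ?F n)"
      if "f \<in> law \<Sigma> n m" "x \<in> pts (ob ?A m)" for n m f x
      using key[OF that(1), of _ False] that(2) by (auto simp: At_pts XR_def)
    show "act ?F n (J i) (cmpt ?p m x) = cmpt ?p n (act ?A n (J i) x)"
      if "i \<in> injs m n" "x \<in> pts (ob ?A m)" for n m i x
      using key[OF J_law[OF that(1)], of _ True] that by (auto simp: At_pts XR_def)
  qed
qed

lemma prog_simps [simp]: "src (prog_map \<Sigma> P) = AtP" "tgt (prog_map \<Sigma> P) = fob (PfPfInt \<Sigma>) AtP"
  by (auto simp: prog_map_def)

end

section \<open>Coinductive trees\<close>

primcorec mk_ctree :: "(nat \<Rightarrow> ('p, 'f) atm \<Rightarrow> ('p, 'f) clause \<Rightarrow> (nat \<times> ('p, 'f) atm) fset option) \<Rightarrow>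
    nat \<times> ('p, 'f) atm \<Rightarrow> ('p, 'f) ctree" where
  "mk_ctree s x = And_node (fst x) (snd x) (\<lambda>c. map_option (fimage (mk_ctree s)) (s (fst x) (snd x) c))"

context program
begin

definition subgoals :: "nat \<Rightarrow> ('p, 'f) atm \<Rightarrow> ('p, 'f) clause \<Rightarrow> (nat \<times> ('p, 'f) atm) fset option" where
  "subgoals n A c = (if c \<in> matches n A
     then Some ((\<lambda>B. (n + fst (pick n A c), asubst (snd (pick n A c)) B)) |`| fset_of_list (snd c)) else None)"

lemma matches_mgm: "A \<in> atoms \<Sigma> P n \<Longrightarrow> matches n A = {c \<in> P. \<exists>m \<theta>. mgm \<Sigma> n m c A \<theta>}"
  using mgm_canonical_iff[OF atoms_terms] unfolding matches_def by blast

lemma coinductive_tree_ex: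
  assumes "A \<in> atoms \<Sigma> P n"
  shows "coinductive_tree \<Sigma> P n A (mk_ctree subgoals (n, A))"
  using assms
proof (coinduction arbitrary: n A)
  case (coinductive_tree n A)
  let ?t = "mk_ctree subgoals (n, A)"
  have "dom (or_nodes ?t) = matches n A" by (auto simp: subgoals_def split: if_splits)
  then have dom: "dom (or_nodes ?t) = {c \<in> P. \<exists>m \<theta>. mgm \<Sigma> n m c A \<theta>}"
    using matches_mgm[OF coinductive_tree] by simp
  have "\<exists>m \<theta>. mgm \<Sigma> n m c A \<theta> \<and> bij_betw label (fset S) (asubst \<theta> ` set (snd c)) \<and>
      (\<forall>s\<in>fset S. ctx s = m \<and> ((\<exists>n A. m = n \<and> label s = A \<and> s = mk_ctree subgoals (n, A) \<and> A \<in> atoms \<Sigma> P n) \<or>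
        coinductive_tree \<Sigma> P m (label s) s))"
    if S: "or_nodes ?t c = Some S" for c S
  proof -
    have c: "c \<in> matches n A" using S by (auto simp: subgoals_def split: if_splits)
    define k \<theta> where "k = fst (pick n A c)" and "\<theta> = snd (pick n A c)"
    have can: "canonical n k c A \<theta>" using pick[OF c] by (simp add: k_def \<theta>_def)
    have S': "fset S = (\<lambda>B. mk_ctree subgoals (n + k, asubst \<theta> B)) ` set (snd c)"
      using S c by (auto simp: subgoals_def k_def \<theta>_def fset_of_list.rep_eq)
    \<comment> \<open>The children are the image of the set of instances, so equal instances share
      one child, and \<open>label\<close> recovers the instance from the child.\<close>
    have "bij_betw label (fset S) (asubst \<theta> ` set (snd c))"
      unfolding S' by (auto simp: bij_betw_def inj_on_def image_image)
    moreover have "asubst \<theta> B \<in> atoms \<Sigma> P (n + k)" if "B \<in> set (snd c)" for B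
      using asubst_body[OF _ that can coinductive_tree] c by (simp add: matches_def)
    ultimately show ?thesis
      using canonical_mgm[OF can atoms_terms[OF coinductive_tree]] S'
      by (intro exI[of _ "n + k"] exI[of _ \<theta>]) auto
  qed
  moreover have "ctx ?t = n" "label ?t = A" by simp_all
  ultimately show ?case using dom by blast
qed

lemma coinductive_treeD:
  assumes t: "coinductive_tree \<Sigma> P n A t" and A: "A \<in> atoms \<Sigma> P n"
  shows "ctx t = n" "label t = A" "dom (or_nodes t) = matches n A" "finite (ran (or_nodes t))"
    and "or_nodes t c = Some S \<Longrightarrow> \<exists>m \<theta>. mgm \<Sigma> n m c A \<theta> \<and> label ` fset S = asubst \<theta> ` set (snd c) \<and>
      (\<forall>s\<in>fset S. ctx s = m)"
    and "S \<in> ran (or_nodes t) \<Longrightarrow> s \<in> fset S \<Longrightarrow> n \<le> ctx s \<and> label s \<in> atoms \<Sigma> P (ctx s) \<and>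
      coinductive_tree \<Sigma> P (ctx s) (label s) s"
proof -
  from t show ctx: "ctx t = n" "label t = A" by (auto elim: coinductive_tree.cases)
  from t have d: "dom (or_nodes t) = {c \<in> P. \<exists>m \<theta>. mgm \<Sigma> n m c A \<theta>}"
    by (cases rule: coinductive_tree.cases)
  then show dom: "dom (or_nodes t) = matches n A" using matches_mgm[OF A] by simp
  have "finite P" using P by (simp add: logic_program_def)
  then have "finite (dom (or_nodes t))" using d by simp
  then show "finite (ran (or_nodes t))" by (rule finite_ran)
  have *: "\<exists>m \<theta>. mgm \<Sigma> n m c A \<theta> \<and> bij_betw label (fset S) (asubst \<theta> ` set (snd c)) \<and>
     (\<forall>s\<in>fset S. ctx s = m \<and> coinductive_tree \<Sigma> P m (label s) s)" if "or_nodes t c = Some S" for c S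
    using t by (cases rule: coinductive_tree.cases) (use that in blast)
  show "\<exists>m \<theta>. mgm \<Sigma> n m c A \<theta> \<and> label ` fset S = asubst \<theta> ` set (snd c) \<and> (\<forall>s\<in>fset S. ctx s = m)"
    if "or_nodes t c = Some S" using *[OF that] by (meson bij_betw_imp_surj_on)
  show "n \<le> ctx s \<and> label s \<in> atoms \<Sigma> P (ctx s) \<and> coinductive_tree \<Sigma> P (ctx s) (label s) s"
    if S: "S \<in> ran (or_nodes t)" and s: "s \<in> fset S"
  proof -
    obtain c where c: "or_nodes t c = Some S" using S by (auto simp: ran_def)
    obtain m \<theta> where m: "mgm \<Sigma> n m c A \<theta>" "bij_betw label (fset S) (asubst \<theta> ` set (snd c))"
      "\<forall>s\<in>fset S. ctx s = m \<and> coinductive_tree \<Sigma> P m (label s) s" using *[OF c] by blast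
    have cP: "c \<in> P" using c d by blast
    have "label s \<in> asubst \<theta> ` set (snd c)" using m(2) s unfolding bij_betw_def by blast
    then obtain B where B: "B \<in> set (snd c)" "label s = asubst \<theta> B" by blast
    have "label s \<in> atoms \<Sigma> P m"
      unfolding B(2) using m(1) B(1) by (intro asubst_clause[OF cP]) (auto simp: clause_atoms_def mgm_def matcher_def)
    then show ?thesis using m s by (simp add: mgm_def)
  qed
qed

text \<open>The tree may use other most general matchers than \<open>cbody\<close> does; in the
  colimit the difference disappears. The equation is pushed forward along \<open>h\<close> because
  \<open>denotes\<close> places the subtrees in the carrier of another coalgebra.\<close>

lemma tree_image:
  assumes t: "coinductive_tree \<Sigma> P n A t" and A: "A \<in> atoms \<Sigma> P n" and h: "lax_inj \<Sigma> h" "src h = AtP"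
  shows "(\<lambda>S. (\<lambda>s. incl (tgt h) n (ctx s) (cmpt h (ctx s) (Atm (label s)))) ` fset S) ` ran (or_nodes t) =
    (\<lambda>S. inc (tgt h) n ` S) ` (`) (pmap (cmpt h) n) ` cbody n A ` matches n A"
proof -
  have 1: "(\<lambda>s. incl (tgt h) n (ctx s) (cmpt h (ctx s) (Atm (label s)))) ` fset S =
      inc (tgt h) n ` pmap (cmpt h) n ` cbody n A c" if S: "or_nodes t c = Some S" for c S
  proof -
    obtain m \<theta> where m: "mgm \<Sigma> n m c A \<theta>" "label ` fset S = asubst \<theta> ` set (snd c)" "\<forall>s\<in>fset S. ctx s = m"
      using coinductive_treeD(5)[OF t A S] by blast
    have c: "c \<in> matches n A" using coinductive_treeD(3)[OF t A] S by blast
    then have cP: "c \<in> P" by (simp add: matches_def)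
    let ?k = "fst (pick n A c)" and ?\<theta> = "snd (pick n A c)"
    have nm: "n + (m - n) = m" using m(1) by (simp add: mgm_def)
    have B: "incl (tgt h) n m (cmpt h m (Atm (asubst \<theta> B))) = inc (tgt h) n (pmap (cmpt h) n (?k, Atm (asubst ?\<theta> B)))"
      if "B \<in> set (snd c)" for B
    proof -
      note i = inc_mgm[OF cP A pick[OF c] m(1) that]
      have v: "valid AtP n (?k, Atm (asubst ?\<theta> B))"
        using asubst_body[OF cP that pick[OF c] A] by (simp add: valid_def At_pts)
      have "incl (tgt h) n m (cmpt h m (Atm (asubst \<theta> B))) = inc (tgt h) n (pmap (cmpt h) n (m - n, Atm (asubst \<theta> B)))"
        by (simp add: inc_def pmap_def nm)
      \<comment> \<open>\<open>inc_mgm\<close> is an equation in the colimit of \<open>At\<close>;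
        \<open>Int_map h\<close> carries it to the target of \<open>h\<close>.\<close>
      also have "\<dots> = Int_map h n (inc AtP n (m - n, Atm (asubst \<theta> B)))"
        using Int_map_inc[OF h(1), of n "(m - n, Atm (asubst \<theta> B))"] i(1) by (simp add: h(2))
      also have "\<dots> = inc (tgt h) n (pmap (cmpt h) n (?k, Atm (asubst ?\<theta> B)))"
        unfolding i(2) using Int_map_inc[OF h(1), of n "(?k, Atm (asubst ?\<theta> B))"] v by (simp add: h(2))
      finally show ?thesis .
    qed
    have "(\<lambda>s. incl (tgt h) n (ctx s) (cmpt h (ctx s) (Atm (label s)))) ` fset S =
        (\<lambda>B. incl (tgt h) n m (cmpt h m (Atm B))) ` label ` fset S"
      using m(3) by (force simp: image_iff)
    also have "\<dots> = inc (tgt h) n ` pmap (cmpt h) n ` cbody n A c"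
      unfolding m(2) using B by (force simp: image_iff cbody_def body_def)
    finally show ?thesis .
  qed
  have "(\<lambda>S. (\<lambda>s. incl (tgt h) n (ctx s) (cmpt h (ctx s) (Atm (label s)))) ` fset S) ` ran (or_nodes t) =
      (\<lambda>c. inc (tgt h) n ` pmap (cmpt h) n ` cbody n A c) ` dom (or_nodes t)" (is "?L = ?R")
  proof (intro set_eqI iffI)
    fix x assume "x \<in> ?L"
    then obtain S c where "or_nodes t c = Some S" "x = (\<lambda>s. incl (tgt h) n (ctx s) (cmpt h (ctx s) (Atm (label s)))) ` fset S"
      unfolding ran_def by blast
    then show "x \<in> ?R" using 1 by blast
  next
    fix x assume "x \<in> ?R"
    then obtain c S where c: "or_nodes t c = Some S" "x = inc (tgt h) n ` pmap (cmpt h) n ` cbody n A c" by blast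
    then have "x = (\<lambda>s. incl (tgt h) n (ctx s) (cmpt h (ctx s) (Atm (label s)))) ` fset S" using 1 by simp
    moreover have "S \<in> ran (or_nodes t)" using c(1) unfolding ran_def by blast
    ultimately show "x \<in> ?L" by blast
  qed
  then show ?thesis by (simp add: image_image coinductive_treeD(3)[OF t A])
qed

text \<open>The values of \<open>h\<close> at the labels of the subtrees are the witnesses that
  \<open>denotes\<close> asks for; since \<open>h\<close> commutes with the structures, the bodies
  of the program are turned into the required set.\<close>

lemma denotes_coalgebra_map:
  assumes h: "lax_inj \<Sigma> h" "src h = AtP"
    and r: "\<And>n A. A \<in> atoms \<Sigma> P n \<Longrightarrow> cmpt r n (cmpt h n (Atm A)) = cmpt (far (PfPfInt \<Sigma>) h) n (cmpt (prog_map \<Sigma> P) n (Atm A))"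
    and e: "\<And>n A. A \<in> atoms \<Sigma> P n \<Longrightarrow> cmpt e n (cmpt h n (Atm A)) = Atm A"
    and t: "coinductive_tree \<Sigma> P n A t" "A \<in> atoms \<Sigma> P n"
  shows "denotes (tgt h) e r n (cmpt h n (Atm A)) t"
  using t
proof (coinduction arbitrary: n A t)
  case (denotes n A t)
  let ?y = "\<lambda>s. cmpt h (ctx s) (Atm (label s))"
  note D = coinductive_treeD[OF denotes]
  have "cmpt h n (Atm A) \<in> pts (ob (tgt h) n)" using lax_pts[OF h(1)] denotes(2) by (simp add: h(2) At_pts)
  moreover have "cmpt r n (cmpt h n (Atm A)) =
      fin ((\<lambda>S. fin ((\<lambda>s. incl (tgt h) n (ctx s) (?y s)) ` fset S)) ` ran (or_nodes t))"
  proof -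
    have "cmpt r n (cmpt h n (Atm A)) = enc (tgt h) n ((`) (pmap (cmpt h) n) ` cbody n A ` matches n A)"
      using r[OF denotes(2)] prog_Atm[OF denotes(2)] F_far[OF h(1), of n] good_prog[OF denotes(2)] by (simp add: h(2))
    also have "\<dots> = fin (fin ` (\<lambda>S. inc (tgt h) n ` S) ` (`) (pmap (cmpt h) n) ` cbody n A ` matches n A)"
      unfolding enc_def by (simp only: image_image)
    also have "\<dots> = fin (fin ` (\<lambda>S. (\<lambda>s. incl (tgt h) n (ctx s) (?y s)) ` fset S) ` ran (or_nodes t))"
      unfolding tree_image[OF denotes h] ..
    finally show ?thesis by (simp only: image_image)
  qed
  moreover have "cmpt e n (cmpt h n (Atm A)) = Atm (label t)" using e[OF denotes(2)] D(2) by simp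
  moreover have "\<forall>S\<in>ran (or_nodes t). \<forall>s\<in>fset S. n \<le> ctx s \<and>
      ((\<exists>n' A' t'. ctx s = n' \<and> ?y s = cmpt h n' (Atm A') \<and> s = t' \<and> coinductive_tree \<Sigma> P n' A' t' \<and> A' \<in> atoms \<Sigma> P n') \<or>
        denotes (tgt h) e r (ctx s) (?y s) s)"
    using D(6) by blast
  ultimately show ?case using D(1)
    by - (rule exI[of _ "cmpt h n (Atm A)"], rule exI[of _ n], rule exI[of _ t], rule exI[of _ ?y],
      intro conjI refl, assumption+)
qed

sublocale B: base_psh \<Sigma> AtP
  by unfold_locales (rule At_presheaf)

lemma denotes_pts: "denotes K e r n x t \<Longrightarrow> x \<in> pts (ob K n)"
  by (auto elim: denotes.cases)

text \<open>Elements denoted by the same tree are identified in the cofree coalgebra: renamings of such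
  pairs form a bisimulation.\<close>

lemma denotes_unique:
  fixes \<phi> r e :: "('f, ('p, 'f, 'e) luniv) lax"
  assumes \<phi>: "lax_inj \<Sigma> \<phi>" "tgt \<phi> = B.T"
    and str: "\<And>n x. x \<in> pts (ob (src \<phi>) n) \<Longrightarrow> cmpt B.str n (cmpt \<phi> n x) = cmpt (far (PfPfInt \<Sigma>) \<phi>) n (cmpt r n x)"
    and co: "\<And>n x. x \<in> pts (ob (src \<phi>) n) \<Longrightarrow> cmpt B.counit n (cmpt \<phi> n x) = cmpt e n x"
    and t: "coinductive_tree \<Sigma> P n A t" "A \<in> atoms \<Sigma> P n"
    and d: "denotes (src \<phi>) e r n x t" "denotes (src \<phi>) e r n x' t"
  shows "cmpt \<phi> n x = cmpt \<phi> n x'"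
proof -
  let ?T = "B.T" and ?K = "src \<phi>"
  let ?\<rho> = "\<lambda>n u v. \<exists>m i x x' t A. i \<in> injs m n \<and> coinductive_tree \<Sigma> P m A t \<and> A \<in> atoms \<Sigma> P m \<and>
    denotes ?K e r m x t \<and> denotes ?K e r m x' t \<and> u = act ?T n (J i) (cmpt \<phi> m x) \<and> v = act ?T n (J i) (cmpt \<phi> m x')"
  have K: "presheaf \<Sigma> ?K" using lax_src[OF \<phi>(1)] .
  have \<phi>p: "cmpt \<phi> m x \<in> pts (ob ?T m)" if "x \<in> pts (ob ?K m)" for m x
    using lax_pts[OF \<phi>(1) that] by (simp add: \<phi>(2))
  have id: "act ?T n (J [0..<n]) (cmpt \<phi> n x) = cmpt \<phi> n x" if "x \<in> pts (ob ?K n)" for n x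
    unfolding J_upt by (rule presheaf_id[OF B.T_presheaf \<phi>p[OF that]])
  have "?\<rho> n (cmpt \<phi> n x) (cmpt \<phi> n x')"
    using t d id[OF denotes_pts[OF d(1)]] id[OF denotes_pts[OF d(2)]] upt_injs[OF order_refl[of n]] by metis
  then show ?thesis
  proof (rule B.T_coinduct[where \<rho> = ?\<rho>])
    fix n n' j u v assume "?\<rho> n u v" and j: "j \<in> injs n n'"
    then obtain m i x x' t A where *: "i \<in> injs m n" "coinductive_tree \<Sigma> P m A t" "A \<in> atoms \<Sigma> P m"
      "denotes ?K e r m x t" "denotes ?K e r m x' t"
      and uv: "u = act ?T n (J i) (cmpt \<phi> m x)" "v = act ?T n (J i) (cmpt \<phi> m x')" by blast
    have "act ?T n' (J j) u = act ?T n' (J (inj_comp j i)) (cmpt \<phi> m x)"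
      "act ?T n' (J j) v = act ?T n' (J (inj_comp j i)) (cmpt \<phi> m x')"
      unfolding uv using presheaf_J_comp[OF B.T_presheaf *(1) j \<phi>p[OF denotes_pts[OF *(4)]]]
        presheaf_J_comp[OF B.T_presheaf *(1) j \<phi>p[OF denotes_pts[OF *(5)]]] by auto
    then show "?\<rho> n' (act ?T n' (J j) u) (act ?T n' (J j) v)"
      using inj_comp_injs[OF *(1) j] *(2-) by blast
  next
    fix n u v assume "?\<rho> n u v"
    then obtain m i x x' t A where *: "i \<in> injs m n" "coinductive_tree \<Sigma> P m A t" "A \<in> atoms \<Sigma> P m"
      "denotes ?K e r m x t" "denotes ?K e r m x' t"
      and uv: "u = act ?T n (J i) (cmpt \<phi> m x)" "v = act ?T n (J i) (cmpt \<phi> m x')" by blast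
    note D = coinductive_treeD[OF *(2,3)]
    note Ji = J_law[OF *(1)]
    \<comment> \<open>Two derivations of \<open>denotes\<close> may choose different elements for
      one subtree. Indexing both choices by the nodes of \<open>t\<close> makes the presentations
      match node by node.\<close>
    define W where "W y = (\<lambda>S. (\<lambda>s. (ctx s - m, y s)) ` fset S) ` ran (or_nodes t)" for y :: "('p, 'f) ctree \<Rightarrow> ('p, 'f, 'e) luniv"
    let ?g = "\<lambda>p. papp (act ?T) n (J i) (pmap (cmpt \<phi>) m p)"
    have den: "\<exists>y. good ?T n ((`) ?g ` W y) \<and> cmpt B.str n (act ?T n (J i) (cmpt \<phi> m x)) = enc ?T n ((`) ?g ` W y) \<and>
        cmpt B.counit n (act ?T n (J i) (cmpt \<phi> m x)) = act AtP n (J i) (Atm (label t)) \<and>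
        act ?T n (J i) (cmpt \<phi> m x) \<in> pts (ob ?T n) \<and>
        (\<forall>S\<in>ran (or_nodes t). \<forall>s\<in>fset S. denotes ?K e r (ctx s) (y s) s)"
      if dx: "denotes ?K e r m x t" for x
    proof -
      from dx obtain y where x: "x \<in> pts (ob ?K m)" and ex: "cmpt e m x = Atm (label t)"
        and y: "\<forall>S\<in>ran (or_nodes t). \<forall>s\<in>fset S. m \<le> ctx s \<and> denotes ?K e r (ctx s) (y s) s"
        and rx: "cmpt r m x = fin ((\<lambda>S. fin ((\<lambda>s. incl ?K m (ctx s) (y s)) ` fset S)) ` ran (or_nodes t))"
        by (rule denotes.cases) blast
      have gW: "good ?K m (W y)"
        using D(4) y denotes_pts by (fastforce simp: good_def W_def valid_def)
      have "(\<lambda>s. incl ?K m (ctx s) (y s)) ` fset S = inc ?K m ` (\<lambda>s. (ctx s - m, y s)) ` fset S"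
        if "S \<in> ran (or_nodes t)" for S
        using y that by (force simp: inc_def image_iff)
      then have "cmpt r m x = enc ?K m (W y)"
        unfolding rx enc_def W_def by (simp add: image_image)
      then have s: "cmpt B.str m (cmpt \<phi> m x) = enc ?T m ((`) (pmap (cmpt \<phi>) m) ` W y)"
        using str[OF x] F_far[OF \<phi>(1) gW] by (simp add: \<phi>(2))
      have gP: "good ?T m ((`) (pmap (cmpt \<phi>) m) ` W y)" using good_pmap[OF \<phi>(1) gW] by (simp add: \<phi>(2))
      have g: "(`) (papp (act ?T) n (J i)) ` (`) (pmap (cmpt \<phi>) m) ` W y = (`) ?g ` W y"
        by (simp add: image_image)
      have "cmpt B.str n (act ?T n (J i) (cmpt \<phi> m x)) = enc ?T n ((`) ?g ` W y)"
        using lax_strict[OF B.str_lax *(1), of "cmpt \<phi> m x"] \<phi>p[OF x] s F_act[OF B.T_presheaf Ji gP] g by simp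
      moreover have "cmpt B.counit n (act ?T n (J i) (cmpt \<phi> m x)) = act AtP n (J i) (Atm (label t))"
        using lax_strict[OF B.counit_lax *(1), of "cmpt \<phi> m x"] \<phi>p[OF x] co[OF x] ex by simp
      moreover have "good ?T n ((`) ?g ` W y)" using good_papp[OF B.T_presheaf Ji gP] g by simp
      moreover have "act ?T n (J i) (cmpt \<phi> m x) \<in> pts (ob ?T n)"
        using presheaf_act[OF B.T_presheaf Ji \<phi>p[OF x]] .
      ultimately show ?thesis using y by blast
    qed
    obtain y where y: "good ?T n ((`) ?g ` W y)" "cmpt B.str n u = enc ?T n ((`) ?g ` W y)"
      "cmpt B.counit n u = act AtP n (J i) (Atm (label t))" "u \<in> pts (ob ?T n)"
      "\<forall>S\<in>ran (or_nodes t). \<forall>s\<in>fset S. denotes ?K e r (ctx s) (y s) s"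
      using den[OF *(4)] unfolding uv by blast
    obtain y' where y': "good ?T n ((`) ?g ` W y')" "cmpt B.str n v = enc ?T n ((`) ?g ` W y')"
      "cmpt B.counit n v = act AtP n (J i) (Atm (label t))" "v \<in> pts (ob ?T n)"
      "\<forall>S\<in>ran (or_nodes t). \<forall>s\<in>fset S. denotes ?K e r (ctx s) (y' s) s"
      using den[OF *(5)] unfolding uv by blast
    have "PR True (PR True (\<lambda>p p'. fst p = fst p' \<and> ?\<rho> (n + fst p) (snd p) (snd p'))) ((`) ?g ` W y) ((`) ?g ` W y')"
      unfolding W_def PR_image
    proof (intro PR_refl conjI)
      fix S s assume S: "S \<in> ran (or_nodes t)" "s \<in> fset S"
      show "fst (?g (ctx s - m, y s)) = fst (?g (ctx s - m, y' s))" by simp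
      have m: "m + (ctx s - m) = ctx s" using D(6)[OF S] by simp
      have j: "i @ [n..<n + (ctx s - m)] \<in> injs (ctx s) (n + (ctx s - m))"
        using injs_plus[OF *(1), of "ctx s - m"] m by simp
      show "?\<rho> (n + fst (?g (ctx s - m, y s))) (snd (?g (ctx s - m, y s))) (snd (?g (ctx s - m, y' s)))"
        using j D(6)[OF S] y(5) y'(5) S by (fastforce simp: papp_def pmap_def law_plus_J m)
    qed
    then show "u \<in> pts (ob ?T n) \<and> v \<in> pts (ob ?T n) \<and> cmpt B.counit n u = cmpt B.counit n v \<and>
      (\<exists>Z Z'. good ?T n Z \<and> good ?T n Z' \<and> cmpt B.str n u = enc ?T n Z \<and> cmpt B.str n v = enc ?T n Z' \<and>
        PR True (PR True (\<lambda>p p'. fst p = fst p' \<and> ?\<rho> (n + fst p) (snd p) (snd p'))) Z Z')"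
      using y(1-4) y'(1-4)
      by - (rule conjI, assumption, rule conjI, assumption, rule conjI, simp only:,
        rule exI[of _ "(`) ?g ` W y"], rule exI[of _ "(`) ?g ` W y'"], intro conjI)
  qed
qed

end

section \<open>Transfer to an arbitrary cofree adjunction\<close>

theorem theorem16:
  fixes \<Sigma> :: "'f sig" and P :: "('p, 'f) clause set"
  assumes "logic_program \<Sigma> P"
  shows
    "let L = (Lax_Inj \<Sigma> :: (('f, ('p, 'f, 'e) luniv) psh, ('f, ('p, 'f, 'e) luniv) lax) cat);
         F = PfPfInt \<Sigma>;
         p = (At \<Sigma> P, prog_map \<Sigma> P)
     in is_functor L L F \<and>
        p \<in> Obj (coalg_cat L F) \<and>
        (\<exists>R \<eta> \<epsilon>. cofree_adjunction L F R \<eta> \<epsilon>) \<and>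
        (\<forall>R \<eta> \<epsilon>. cofree_adjunction L F R \<eta> \<epsilon> \<longrightarrow>
          (let G = cofree_comonad R; \<delta> = cofree_comult R \<eta>;
               pbar = snd (fob (comparison \<eta>) p)
           in comonad L G \<epsilon> \<delta> \<and>
              cat_iso (coalg_cat L F) (comonad_coalg_cat L G \<epsilon> \<delta>) (comparison \<eta>) \<and>
              (At \<Sigma> P, pbar) \<in> Obj (comonad_coalg_cat L G \<epsilon> \<delta>) \<and>
              (\<forall>n. \<forall>A\<in>atoms \<Sigma> P n.
                 (\<exists>t. coinductive_tree \<Sigma> P n A t) \<and>
                 (\<forall>t. coinductive_tree \<Sigma> P n A t \<longrightarrow>
                    {x. denotes (fob G (At \<Sigma> P)) (\<epsilon> (At \<Sigma> P)) (snd (fob R (At \<Sigma> P))) n x t}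
                      = {cmpt pbar n (Atm A)}))))"
proof -
  interpret program \<Sigma> P "TYPE('e)" by unfold_locales (rule assms)
  define L where "L = (Lax_Inj \<Sigma> :: (('f, ('p, 'f, 'e) luniv) psh, ('f, ('p, 'f, 'e) luniv) lax) cat)"
  define F where "F = (PfPfInt \<Sigma> :: (('f, ('p, 'f, 'e) luniv) psh, ('f, ('p, 'f, 'e) luniv) lax, _, _) fctr)"
  define p where "p = (AtP, prog_map \<Sigma> P :: ('f, ('p, 'f, 'e) luniv) lax)"
  have F: "is_functor L L F" unfolding L_def F_def by (rule PfPfInt_functor)
  have p: "p \<in> Obj (coalg_cat L F)"
    unfolding p_def L_def F_def endo.coalg_Obj[OF endo_Lax] using prog_lax At_presheaf by (simp add: Lax_hom)
  have ex: "\<exists>R \<eta> \<epsilon>. cofree_adjunction L F R \<eta> \<epsilon>" unfolding L_def F_def by (rule cofree_adjunction_ex)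
  have main: "comonad L (cofree_comonad R) \<epsilon> (cofree_comult R \<eta>) \<and>
      cat_iso (coalg_cat L F) (comonad_coalg_cat L (cofree_comonad R) \<epsilon> (cofree_comult R \<eta>)) (comparison \<eta>) \<and>
      (AtP, snd (fob (comparison \<eta>) p)) \<in> Obj (comonad_coalg_cat L (cofree_comonad R) \<epsilon> (cofree_comult R \<eta>)) \<and>
      (\<forall>n. \<forall>A\<in>atoms \<Sigma> P n. (\<exists>t. coinductive_tree \<Sigma> P n A t) \<and>
        (\<forall>t. coinductive_tree \<Sigma> P n A t \<longrightarrow>
          {x. denotes (fob (cofree_comonad R) AtP) (\<epsilon> AtP) (snd (fob R AtP)) n x t} = {cmpt (snd (fob (comparison \<eta>) p)) n (Atm A)}))"
    if adj: "cofree_adjunction L F R \<eta> \<epsilon>" for R \<eta> \<epsilon>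
  proof -
    interpret A: cofree_adj L F R \<eta> \<epsilon> by unfold_locales (rule F adj)+
    define K r where "K = fst (fob R AtP)" and "r = snd (fob R AtP)"
    have KR: "fob R AtP = (K, r)" by (simp add: K_def r_def)
    have X: "AtP \<in> Obj L" unfolding L_def using At_presheaf by simp
    let ?h = "A.un p"
    have h: "A.chom p (K, r) ?h" using A.un[OF p] by (simp add: p_def KR[symmetric])
    then have h': "lax_inj \<Sigma> ?h" "src ?h = AtP" "tgt ?h = K"
      "\<And>n A. A \<in> atoms \<Sigma> P n \<Longrightarrow> cmpt r n (cmpt ?h n (Atm A)) = cmpt (far (PfPfInt \<Sigma>) ?h) n (cmpt (prog_map \<Sigma> P) n (Atm A))"
      unfolding p_def L_def F_def chom_Lax by (auto simp: At_pts)
    have "Cmp L (\<epsilon> AtP) ?h = Ide L AtP" using A.tri1[OF p] by (simp add: p_def)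
    then have e: "cmpt (\<epsilon> AtP) n (cmpt ?h n (Atm A)) = Atm A" if "A \<in> atoms \<Sigma> P n" for n A
    proof -
      have a: "Atm A \<in> pts (ob AtP n)" using that by (simp add: At_pts)
      have "cmpt (Cmp L (\<epsilon> AtP) ?h) n (Atm A) = cmpt (Ide L AtP) n (Atm A)"
        using \<open>Cmp L (\<epsilon> AtP) ?h = Ide L AtP\<close> by simp
      then show ?thesis using a h'(2) by (simp add: L_def)
    qed
    have cR: "A.cofree_on AtP (K, r) (\<epsilon> AtP)" using A.cofree_on[OF X] by (simp add: KR)
    have cT: "A.cofree_on AtP (B.T, B.str) B.counit" unfolding L_def F_def by (rule B.cofree)
    \<comment> \<open>Cofree coalgebras on one object are compared through their universal
      properties. Only the composite on \<open>K\<close> is computed: it makes \<phi> injective on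
      points, so uniqueness of the denoted element can be tested in the constructed carrier
      \<open>B.T\<close>.\<close>
    obtain \<phi> where \<phi>: "A.chom (K, r) (B.T, B.str) \<phi>" "Cmp L B.counit \<phi> = \<epsilon> AtP"
      using cT cR unfolding A.cofree_on_def by (metis (no_types, lifting))
    obtain \<psi> where \<psi>: "A.chom (B.T, B.str) (K, r) \<psi>" "Cmp L (\<epsilon> AtP) \<psi> = B.counit"
      using cT cR unfolding A.cofree_on_def by (metis (no_types, lifting))
    have eps: "\<epsilon> AtP \<in> hom L K AtP" using cR by (simp add: A.cofree_on_def)
    have hom: "\<phi> \<in> hom L K B.T" "\<psi> \<in> hom L B.T K" using A.chomD[OF \<phi>(1)] A.chomD[OF \<psi>(1)] by simp_all
    have "Cmp L (\<epsilon> AtP) (Cmp L \<psi> \<phi>) = \<epsilon> AtP"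
      unfolding Cmp_assoc[OF A.C hom eps, symmetric] \<psi>(2) by (rule \<phi>(2))
    moreover have "Cmp L (\<epsilon> AtP) (Ide L K) = \<epsilon> AtP" by (rule Cmp_Ide[OF A.C eps])
    moreover have "A.chom (K, r) (K, r) (Ide L K)"
      using A.chom_Ide[of "(K, r)"] cR by (simp add: A.cofree_on_def)
    ultimately have inv: "Cmp L \<psi> \<phi> = Ide L K"
      using A.chom_Cmp[OF \<phi>(1) \<psi>(1)] by - (rule A.cofree_on_uniq[OF cR, of "(K, r)"], simp_all)
    have \<phi>': "lax_inj \<Sigma> \<phi>" "src \<phi> = K" "tgt \<phi> = B.T"
      "\<And>n x. x \<in> pts (ob (src \<phi>) n) \<Longrightarrow> cmpt B.str n (cmpt \<phi> n x) = cmpt (far (PfPfInt \<Sigma>) \<phi>) n (cmpt r n x)"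
      using \<phi>(1) unfolding L_def F_def chom_Lax by auto
    have co: "cmpt B.counit n (cmpt \<phi> n x) = cmpt (\<epsilon> AtP) n x" if "x \<in> pts (ob (src \<phi>) n)" for n x
      using that unfolding \<phi>(2)[symmetric] L_def by simp
    have inj: "cmpt \<psi> n (cmpt \<phi> n x) = x" if "x \<in> pts (ob K n)" for n x
    proof -
      have "cmpt (Cmp L \<psi> \<phi>) n x = cmpt (Ide L K) n x" using inv by simp
      then show ?thesis using that \<phi>'(2) by (simp add: L_def)
    qed
    have "{x. denotes K (\<epsilon> AtP) r n x t} = {cmpt ?h n (Atm A)}"
      if A: "A \<in> atoms \<Sigma> P n" and t: "coinductive_tree \<Sigma> P n A t" for n A t
    proof -
      have d: "denotes K (\<epsilon> AtP) r n (cmpt ?h n (Atm A)) t"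
        using denotes_coalgebra_map[OF h'(1,2,4) e t A] by (simp add: h'(3))
      have "x = cmpt ?h n (Atm A)" if x: "denotes K (\<epsilon> AtP) r n x t" for x
        using denotes_unique[OF \<phi>'(1,3,4) co t A, of x "cmpt ?h n (Atm A)"] d x inj denotes_pts
        unfolding \<phi>'(2) by metis
      with d show ?thesis by blast
    qed
    moreover have "(AtP, ?h) \<in> Obj A.EM" using A.comp_Obj[OF p] by (simp add: p_def)
    moreover have "fob (cofree_comonad R) AtP = K" by (simp add: A.G_fob K_def)
    moreover have "snd (fob (comparison \<eta>) p) = ?h" by simp
    ultimately show ?thesis
      using A.comonad A.cat_iso coinductive_tree_ex unfolding r_def[symmetric] by metis
  qed
  show ?thesis
    unfolding Let_def using F p ex main unfolding L_def F_def p_def by blast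
qed

end
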